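(* Let $n\ge 6$ and $\lambda\vdash n$. Then $s_{(n-2,2)}\ast s_\lambda$ is multiplicity free if and only if $\lambda$ is one of $(n-1,1)$, $(n)$, $(1^n)$, $(2,1^{n-2})$, or $\lambda=(m^k)$ (a rectangle with $k$ rows of length $m$) for some positive integers $m,k$.
   Context: For $\lambda,\mu\vdash n$, the Kronecker product is $s_\lambda\ast s_\mu=\sum_{\nu\vdash n}g_{\lambda,\mu,\nu}s_\nu$, where $g_{\lambda,\mu,\nu}$ is the multiplicity of the irreducible $S_n$-character $\chi^\nu$ in the pointwise product $\chi^\lambda\chi^\mu$. A symmetric function is multiplicity free if every coefficient in its expansion in Schur functions is $0$ or $1$. $(a^k)$ denotes the partition with $k$ parts all equal to $a$. *)

theory Defs
  imports
    Complex_Main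
    "HOL-Library.Function_Algebras"
    "HOL-Library.FuncSet"
    "HOL-Library.Multiset"
    "HOL-Combinatorics.Permutations"
begin

definition partitions_of :: "nat \<Rightarrow> nat list set" where
  "partitions_of n = {l. sorted_wrt (\<ge>) l \<and> 0 \<notin> set l \<and> sum_list l = n}"

definition integer_partitions :: "nat list set" where
  "integer_partitions = (\<Union>n. partitions_of n)"

definition young_diagram :: "nat list \<Rightarrow> (nat \<times> nat) set" where
  "young_diagram l = {(i, j). i < length l \<and> j < l ! i}"


text \<open>
  Complex group algebra of the symmetric group: an element is a function on permutations that
  vanishes outside \<open>sym_group n\<close>, the permutations of \<open>{..<n}\<close>.
\<close>

definition sym_group :: "nat \<Rightarrow> (nat \<Rightarrow> nat) set" where
  "sym_group n = {p. p permutes {..<n}}"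

type_synonym galg = "(nat \<Rightarrow> nat) \<Rightarrow> complex"

definition galg_scale :: "complex \<Rightarrow> galg \<Rightarrow> galg" where
  "galg_scale c f = (\<lambda>p. c * f p)"

interpretation galg: vector_space galg_scale
  by unfold_locales (auto simp: galg_scale_def fun_eq_iff algebra_simps)

definition galg_carrier :: "nat \<Rightarrow> galg set" where
  "galg_carrier n = {f. \<forall>p. p \<notin> sym_group n \<longrightarrow> f p = 0}"

definition galg_basis :: "(nat \<Rightarrow> nat) \<Rightarrow> galg" where
  "galg_basis p = (\<lambda>q. if q = p then 1 else 0)"

definition galg_mult :: "nat \<Rightarrow> galg \<Rightarrow> galg \<Rightarrow> galg" where
  "galg_mult n f g = (\<lambda>p. \<Sum>q\<in>sym_group n. f q * g (inv q \<circ> p))"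

text \<open>
  Trace on a finite-dimensional invariant subspace \<open>V\<close> of an operator \<open>T\<close>, computed in an
  arbitrary basis of \<open>V\<close>.
\<close>

definition galg_trace :: "galg set \<Rightarrow> (galg \<Rightarrow> galg) \<Rightarrow> complex" where
  "galg_trace V T =
     (let B = (SOME B. B \<subseteq> V \<and> galg.independent B \<and> V \<subseteq> galg.span B)
      in \<Sum>b\<in>B. galg.representation B (T b) b)"


text \<open>
  Row and column of the number \<open>x < n\<close> in the tableau of shape \<open>l\<close> filled with
  \<open>0, \<dots>, n - 1\<close> row by row.
\<close>

definition tab_row :: "nat list \<Rightarrow> nat \<Rightarrow> nat" where
  "tab_row l x = (LEAST i. x < sum_list (take (Suc i) l))"

definition tab_col :: "nat list \<Rightarrow> nat \<Rightarrow> nat" where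
  "tab_col l x = x - sum_list (take (tab_row l x) l)"

definition row_group :: "nat list \<Rightarrow> (nat \<Rightarrow> nat) set" where
  "row_group l =
     {p \<in> sym_group (sum_list l). \<forall>x<sum_list l. tab_row l (p x) = tab_row l x}"

definition col_group :: "nat list \<Rightarrow> (nat \<Rightarrow> nat) set" where
  "col_group l =
     {p \<in> sym_group (sum_list l). \<forall>x<sum_list l. tab_col l (p x) = tab_col l x}"

definition young_symmetrizer :: "nat list \<Rightarrow> galg" where
  "young_symmetrizer l =
     galg_mult (sum_list l)
       (\<lambda>p. if p \<in> row_group l then 1 else 0)
       (\<lambda>p. if p \<in> col_group l then of_int (sign p) else 0)"

text \<open>
  The Specht module, realised as the left ideal of the group algebra generated by the Young
  symmetrizer; its character is \<open>\<chi>\<^sup>\<lambda>\<close>.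
  With this convention \<open>(n)\<close> gives the trivial and \<open>(1\<^sup>n)\<close> the sign character.
\<close>

definition specht_module :: "nat list \<Rightarrow> galg set" where
  "specht_module l =
     (\<lambda>f. galg_mult (sum_list l) f (young_symmetrizer l)) ` galg_carrier (sum_list l)"

definition irr_char :: "nat list \<Rightarrow> (nat \<Rightarrow> nat) \<Rightarrow> complex" where
  "irr_char l p = galg_trace (specht_module l) (galg_mult (sum_list l) (galg_basis p))"

definition char_inner ::
    "nat \<Rightarrow> ((nat \<Rightarrow> nat) \<Rightarrow> complex) \<Rightarrow> ((nat \<Rightarrow> nat) \<Rightarrow> complex) \<Rightarrow> complex" where
  "char_inner n \<phi> \<psi> = (\<Sum>p\<in>sym_group n. \<phi> p * cnj (\<psi> p)) / fact n"

text \<open>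
  The multiplicity of an irreducible character in a character is their inner product.
\<close>

definition kronecker_coeff :: "nat list \<Rightarrow> nat list \<Rightarrow> nat list \<Rightarrow> complex" where
  "kronecker_coeff l m v =
     char_inner (sum_list l) (\<lambda>p. irr_char l p * irr_char m p) (irr_char v)"


text \<open>
  Symmetric functions are formal power series in \<open>x\<^sub>0, x\<^sub>1, \<dots>\<close>: a monomial is the
  multiset of the indices of its variables, and a series maps each monomial to its coefficient.
\<close>

type_synonym symfun = "nat multiset \<Rightarrow> complex"

definition ssyt :: "nat list \<Rightarrow> (nat \<times> nat \<Rightarrow> nat) set" where
  "ssyt l = {T \<in> extensional (young_diagram l).
     (\<forall>i j. (i, Suc j) \<in> young_diagram l \<longrightarrow> T (i, j) \<le> T (i, Suc j)) \<and>
     (\<forall>i j. (Suc i, j) \<in> young_diagram l \<longrightarrow> T (i, j) < T (Suc i, j))}"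

definition schur :: "nat list \<Rightarrow> symfun" where
  "schur l M =
     of_nat (card {T \<in> ssyt l. image_mset T (mset_set (young_diagram l)) = M})"

definition kronecker_schur :: "nat list \<Rightarrow> nat list \<Rightarrow> symfun" where
  "kronecker_schur l m =
     (\<lambda>M. \<Sum>v\<in>partitions_of (sum_list l). kronecker_coeff l m v * schur v M)"

text \<open>
  Schur functions are linearly independent, so the expansion below is unique if it exists.
\<close>

definition multiplicity_free :: "symfun \<Rightarrow> bool" where
  "multiplicity_free f \<longleftrightarrow>
     (\<exists>c. finite {v \<in> integer_partitions. c v \<noteq> 0} \<and>
          f = (\<lambda>M. \<Sum>v\<in>{v \<in> integer_partitions. c v \<noteq> 0}. c v * schur v M) \<and>
          (\<forall>v\<in>integer_partitions. c v \<in> {0, 1}))"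

end

theory Submission
  imports Defs
begin

text \<open>
  The Specht character is read off from the Young symmetrizer \<open>c\<close>: since \<open>c\<^sup>2 = \<kappa> c\<close>, the trace of a
  permutation \<open>p\<close> on the left ideal of \<open>c\<close> is \<open>\<kappa>\<^sup>-\<^sup>1 \<Sum>\<^sub>g c(g\<^sup>-\<^sup>1 p\<^sup>-\<^sup>1 g)\<close>, and von Neumann's lemma gives it norm 1.
  It equals the determinantal character \<open>\<psi>\<close> of Frobenius' formula because both have norm 1 and their
  inner product is 1: \<open>\<psi>\<close> is an alternating sum of permutation characters on words, and the symmetrizer
  annihilates every one of them except the leading one.

  From Frobenius' formula the restriction to \<open>S\<^sub>n\<^sub>-\<^sub>1\<close> and the value on a permutation times a disjoint
  transposition are immediate, and they determine the restriction to \<open>S\<^sub>n\<^sub>-\<^sub>2 \<times> S\<^sub>2\<close>.  As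
  \<open>s\<^bsub>(n-2,2)\<^esub> = h\<^bsub>(n-2,2)\<^esub> - h\<^bsub>(n-1,1)\<^esub>\<close>, this yields
  \<open>s\<^bsub>(n-2,2)\<^esub> * s\<^sub>\<lambda> = s\<^bsub>\<lambda>/(2)\<^esub> h\<^sub>2 + s\<^bsub>\<lambda>/(1,1)\<^esub> e\<^sub>2 - s\<^bsub>\<lambda>/(1)\<^esub> h\<^sub>1\<close>.

  The coefficient of \<open>s\<^sub>\<lambda>\<close> itself is at least \<open>c\<^sup>2 - 2c\<close> plus the number of removable dominoes, where
  \<open>c\<close> is the number of corners of \<open>\<lambda>\<close>.  Hence multiplicity freeness forces \<open>c \<le> 2\<close>, and for \<open>c = 2\<close>
  at most one removable domino; apart from \<open>(n-1,1)\<close> and its conjugate this leaves only \<open>(b+1,b)\<close> and its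
  conjugate, where \<open>(b+1,b-1,1)\<close> occurs twice.
\<close>

section \<open>Sums over subgroups of the symmetric group\<close>

text \<open>The coefficients are defined by traces on left ideals in an unspecified basis, whereas
  the classification counts boxes. The bridge is that right multiplication by c / \<kappa> projects
  the whole group algebra onto the ideal, and there the delta functions are an explicit basis. About
  \<kappa> only \<kappa> \<noteq> 0 has to be known, because it cancels both in the norm and in the
  pairing with words. On the coset of S_n that carries the transposition of the two extra points,
  the horizontal and the vertical strips enter with opposite signs. Averaging over S_n and this
  coset therefore removes the mixed terms and leaves strips common to both diagrams, counted
  separately by kind. The bound on n enters where shapes are thin. In a one-row rectangle or a hook,
  the box by which another diagram differs must not share a column with a removed box; for (b+1,b)
  the bound forces b \<ge> 3, so that the two boxes distinguishing the witness lie in different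
  columns.\<close>

abbreviation rsgn :: "(nat \<Rightarrow> nat) \<Rightarrow> real" where
  "rsgn p \<equiv> real_of_int (sign p)"

definition perm_subgroup :: "nat \<Rightarrow> (nat \<Rightarrow> nat) set \<Rightarrow> bool" where
  "perm_subgroup n H \<longleftrightarrow> H \<subseteq> sym_group n \<and> id \<in> H \<and>
     (\<forall>p\<in>H. \<forall>q\<in>H. p \<circ> q \<in> H) \<and> (\<forall>p\<in>H. inv p \<in> H)"

definition stabilizer :: "nat \<Rightarrow> (nat \<Rightarrow> 'a) \<Rightarrow> (nat \<Rightarrow> nat) set" where
  "stabilizer n f = {p \<in> sym_group n. f \<circ> p = f}"

lemma finite_sym_group [simp]: "finite (sym_group n)"
  by (simp add: sym_group_def finite_permutations)

lemma card_sym_group: "card (sym_group n) = fact n"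
  by (simp add: sym_group_def card_permutations)

lemma sym_groupD:
  assumes "p \<in> sym_group n"
  shows "p permutes {..<n}" "bij p" "permutation p" "inj p" "surj p"
proof -
  show p: "p permutes {..<n}" using assms by (simp add: sym_group_def)
  show "bij p" "inj p" "surj p" using permutes_bij[OF p] permutes_inj[OF p] permutes_surj[OF p] by auto
  show "permutation p" using p by (auto simp: permutation_permutes)
qed

lemma sym_group_inv_o:
  assumes "p \<in> sym_group n"
  shows "p \<circ> inv p = id" "inv p \<circ> p = id" "p \<circ> (inv p \<circ> q) = q" "inv p \<circ> (p \<circ> q) = q"
    "inv (inv p) = p"
  using permutes_inv_o[OF sym_groupD(1)[OF assms]] inv_inv_eq[OF sym_groupD(2)[OF assms]]
  by (auto simp flip: comp_assoc)

lemma sym_group_inv_comp: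
  assumes "p \<in> sym_group n" "q \<in> sym_group n"
  shows "inv (p \<circ> q) = inv q \<circ> inv p"
  using assms by (simp add: o_inv_distrib sym_groupD)

lemma sym_group_eq_iff:
  assumes "p \<in> sym_group n"
  shows "p \<circ> x = y \<longleftrightarrow> x = inv p \<circ> y" "x \<circ> p = y \<longleftrightarrow> x = y \<circ> inv p"
  by (auto simp: comp_assoc sym_group_inv_o[OF assms])

lemma sym_group_cancel:
  assumes "p \<in> sym_group n"
  shows "p \<circ> x = p \<circ> y \<longleftrightarrow> x = y" "x \<circ> p = y \<circ> p \<longleftrightarrow> x = y"
  by (auto simp: comp_assoc sym_group_eq_iff[OF assms] sym_group_inv_o[OF assms])

lemma rsgn_comp:
  assumes "p \<in> sym_group n" "q \<in> sym_group n"
  shows "rsgn (p \<circ> q) = rsgn p * rsgn q"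
  using assms by (simp add: sign_compose sym_groupD)

lemma rsgn_inv: "p \<in> sym_group n \<Longrightarrow> rsgn (inv p) = rsgn p"
  by (simp add: sign_inverse sym_groupD)

lemma rsgn_square: "rsgn p * rsgn p = 1" "rsgn p * (rsgn p * x) = x"
proof -
  show a: "rsgn p * rsgn p = 1" by (metis of_int_1 of_int_mult sign_idempotent)
  show "rsgn p * (rsgn p * x) = x" using a by (simp flip: mult.assoc)
qed

lemma perm_subgroup_sym_group [simp]: "perm_subgroup n (sym_group n)"
  by (auto simp: perm_subgroup_def sym_group_def permutes_id permutes_compose permutes_inv)

lemma perm_subgroupD:
  assumes "perm_subgroup n H"
  shows "p \<in> H \<Longrightarrow> p \<in> sym_group n" "id \<in> H" "p \<in> H \<Longrightarrow> q \<in> H \<Longrightarrow> p \<circ> q \<in> H" "p \<in> H \<Longrightarrow> inv p \<in> H"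
    "finite H"
  using assms by (auto simp: perm_subgroup_def intro: finite_subset)

lemmas sym_group_closed [simp, intro] = perm_subgroupD(2-4)[OF perm_subgroup_sym_group]

lemma perm_subgroup_stabilizer: "perm_subgroup n (stabilizer n f)"
proof -
  have "f \<circ> inv p = f" if "p \<in> sym_group n" "f \<circ> p = f" for p
    using that(2) sym_group_inv_o(1)[OF that(1)] by (metis comp_assoc comp_id)
  moreover have "f \<circ> (p \<circ> q) = f" if "f \<circ> p = f" "f \<circ> q = f" for p q
    using that by (metis comp_assoc)
  ultimately show ?thesis
    unfolding perm_subgroup_def stabilizer_def by simp
qed

lemma perm_subgroup_cosets:
  assumes H: "perm_subgroup n H" and g: "g \<in> H"
  shows "bij_betw (\<lambda>p. g \<circ> p) H H" "bij_betw (\<lambda>p. p \<circ> g) H H" "bij_betw inv H H"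
proof -
  note D = perm_subgroupD[OF H] and gG = perm_subgroupD(1)[OF H g]
  show "bij_betw (\<lambda>p. g \<circ> p) H H"
    by (rule bij_betw_byWitness[where f' = "\<lambda>p. inv g \<circ> p"])
       (use D g sym_group_inv_o[OF gG] in auto)
  show "bij_betw (\<lambda>p. p \<circ> g) H H"
    by (rule bij_betw_byWitness[where f' = "\<lambda>p. p \<circ> inv g"])
       (use D g sym_group_inv_o[OF gG] in \<open>auto simp: comp_assoc\<close>)
  show "bij_betw inv H H"
    by (rule bij_betw_byWitness[where f' = inv])
       (use D in \<open>auto simp: sym_group_inv_o(5)[of _ n]\<close>)
qed

lemma sum_perm_subgroup:
  assumes H: "perm_subgroup n H"
  shows "g \<in> H \<Longrightarrow> (\<Sum>p\<in>H. f (g \<circ> p)) = (\<Sum>p\<in>H. f p)"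
    "g \<in> H \<Longrightarrow> (\<Sum>p\<in>H. f (p \<circ> g)) = (\<Sum>p\<in>H. f p)"
    "(\<Sum>p\<in>H. f (inv p)) = (\<Sum>p\<in>H. f p)"
  using perm_subgroup_cosets[OF H] perm_subgroupD(2)[OF H]
  by (auto intro: sum.reindex_bij_betw[of _ H H f])

lemmas sum_sym_group = sum_perm_subgroup[OF perm_subgroup_sym_group]

lemma sum_sym_group_conj:
  assumes "g \<in> sym_group n"
  shows "(\<Sum>p\<in>sym_group n. f (g \<circ> p \<circ> inv g)) = (\<Sum>p\<in>sym_group n. f p)"
  using sum_sym_group(1)[OF assms, of "\<lambda>p. f (p \<circ> inv g)"]
    sum_sym_group(2)[of "inv g" n f] assms by auto

section \<open>Young symmetrizers in test-function form\<close>

text \<open>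
  An identity between elements of the group algebra is stated as an equality of their pairings with an
  arbitrary function \<open>h\<close>.
\<close>

locale young_pair =
  fixes n :: nat and R C :: "(nat \<Rightarrow> nat) set"
  assumes R: "perm_subgroup n R" and C: "perm_subgroup n C"
    and disjoint: "\<And>p. p \<in> R \<Longrightarrow> p \<in> C \<Longrightarrow> p = id"
    and dichotomy: "\<And>x. x \<in> sym_group n \<Longrightarrow>
      (\<exists>r\<in>R. \<exists>q\<in>C. x = r \<circ> q) \<or> (\<exists>t\<in>R. inv x \<circ> t \<circ> x \<in> C \<and> sign (inv x \<circ> t \<circ> x) = -1)"
begin

lemmas RD = perm_subgroupD[OF R]
lemmas CD = perm_subgroupD[OF C]
lemmas sumR = sum_perm_subgroup[OF R]
lemmas sumC = sum_perm_subgroup[OF C]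

text \<open>The coefficient of \<open>x\<close> in the product of the row sum with the signed column
  sum. As \<open>R\<close> and \<open>C\<close> meet only in \<open>id\<close>, at most one term of
  the double sum is nonzero.\<close>

definition cf :: "(nat \<Rightarrow> nat) \<Rightarrow> real" where
  "cf x = (\<Sum>r\<in>R. \<Sum>q\<in>C. if r \<circ> q = x then rsgn q else 0)"

text \<open>After the inversions in both groups are absorbed, this is the coefficient of
  \<open>id\<close> in the square of the symmetrizer. The symmetrizer itself has coefficient 1
  there, so it is the only possible factor in c^2 = \<kappa> c.\<close>

definition kappa :: real where
  "kappa = (\<Sum>q\<in>C. \<Sum>r\<in>R. rsgn q * cf (q \<circ> r))"

lemma cf_test: "(\<Sum>x\<in>sym_group n. cf x * h x) = (\<Sum>r\<in>R. \<Sum>q\<in>C. rsgn q * h (r \<circ> q))"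
proof -
  have "(\<Sum>x\<in>sym_group n. cf x * h x) =
     (\<Sum>r\<in>R. \<Sum>q\<in>C. \<Sum>x\<in>sym_group n. if r \<circ> q = x then rsgn q * h x else 0)"
    unfolding cf_def sum_distrib_right
    by (subst sum.swap, rule sum.cong[OF refl], subst sum.swap) (auto intro!: sum.cong)
  also have "\<dots> = (\<Sum>r\<in>R. \<Sum>q\<in>C. rsgn q * h (r \<circ> q))"
    using RD CD by (auto intro!: sum.cong simp: sum.delta')
  finally show ?thesis .
qed

lemma cf_outside: "x \<notin> sym_group n \<Longrightarrow> cf x = 0"
  unfolding cf_def using RD CD by (auto intro!: sum.neutral)

lemma cf_left:
  assumes "s \<in> R" shows "cf (s \<circ> x) = cf x"
proof -
  have "r \<circ> q = s \<circ> x \<longleftrightarrow> (inv s \<circ> r) \<circ> q = x" for r q :: "nat \<Rightarrow> nat"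
    using RD(1)[OF assms] by (auto simp: comp_assoc sym_group_inv_o[of s n] dest: sym)
  then have "cf (s \<circ> x) = (\<Sum>r\<in>R. \<Sum>q\<in>C. if (inv s \<circ> r) \<circ> q = x then rsgn q else 0)"
    by (simp add: cf_def)
  also have "\<dots> = cf x"
    unfolding cf_def by (rule sumR(1)) (use assms RD in auto)
  finally show ?thesis .
qed

lemma cf_right:
  assumes "s \<in> C" shows "cf (x \<circ> s) = rsgn s * cf x"
proof -
  have s: "s \<in> sym_group n" using assms CD by auto
  have "r \<circ> q = x \<circ> s \<longleftrightarrow> r \<circ> (q \<circ> inv s) = x" for r q :: "nat \<Rightarrow> nat"
    using sym_group_eq_iff(2)[OF s, of x "r \<circ> q"] by (auto simp: comp_assoc)
  then have "cf (x \<circ> s) = (\<Sum>r\<in>R. \<Sum>q\<in>C. if r \<circ> (q \<circ> inv s) = x then rsgn q else 0)"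
    by (simp add: cf_def)
  also have "\<dots> = (\<Sum>r\<in>R. \<Sum>q\<in>C. if r \<circ> (q \<circ> inv s) = x then rsgn ((q \<circ> inv s) \<circ> s) else 0)"
    by (simp add: comp_assoc sym_group_inv_o[OF s] cong: if_cong)
  also have "\<dots> = (\<Sum>r\<in>R. \<Sum>q\<in>C. if r \<circ> q = x then rsgn (q \<circ> s) else 0)"
    by (rule sum.cong[OF refl], rule sumC(2)) (use assms CD in auto)
  also have "\<dots> = rsgn s * cf x"
    unfolding cf_def sum_distrib_left
    by (intro sum.cong refl) (use CD(1) s in \<open>auto simp: rsgn_comp[of _ n]\<close>)
  finally show ?thesis .
qed

lemma cf_RC:
  assumes "r \<in> R" "q \<in> C" shows "cf (r \<circ> q) = rsgn q"
proof -
  have "cf id = (\<Sum>r\<in>R. \<Sum>q\<in>C. if r = id \<and> q = id then rsgn q else 0)"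
    unfolding cf_def
  proof (intro sum.cong refl)
    fix r q assume "r \<in> R" "q \<in> C"
    have "r = id \<and> q = id" if "r \<circ> q = id"
    proof -
      have "q = inv r" using that sym_group_eq_iff(1)[of r n q id] RD \<open>r \<in> R\<close> by auto
      then have "q = id" using disjoint RD \<open>r \<in> R\<close> \<open>q \<in> C\<close> by metis
      then show ?thesis using that by auto
    qed
    then show "(if r \<circ> q = id then rsgn q else 0) = (if r = id \<and> q = id then rsgn q else 0)"
      by auto
  qed
  also have "\<dots> = (\<Sum>r\<in>R. if r = id then (\<Sum>q\<in>C. if q = id then 1 else 0) else 0)"
    by (intro sum.cong refl) (auto intro!: sum.cong)
  also have "\<dots> = 1"
    using RD CD by (simp add: sum.delta)
  finally have "cf id = 1" .
  then show ?thesis using cf_left[OF assms(1), of q] cf_right[OF assms(2), of id] by simp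
qed

text \<open>Von Neumann's lemma. If \<open>x\<close> is a row times a column element, translations
  absorb both factors up to a sign. Otherwise \<open>x\<close> carries an odd column element
  \<open>u\<close> to a row element \<open>t\<close>; translating by \<open>t\<close> on the left
  group and by \<open>u\<close> on the right one turns the sum into its negative, and the same
  translations force \<open>cf x = 0\<close>.\<close>

lemma sandwich_RC:
  assumes x: "x \<in> sym_group n"
  shows "(\<Sum>r\<in>R. \<Sum>q\<in>C. rsgn q * h (r \<circ> x \<circ> q)) =
    cf x * (\<Sum>r\<in>R. \<Sum>q\<in>C. rsgn q * h (r \<circ> q))" (is "?L = _")
  using dichotomy[OF x]
proof (elim disjE bexE conjE)
  fix s t assume st: "s \<in> R" "t \<in> C" and xe: "x = s \<circ> t"
  have "?L = (\<Sum>r\<in>R. \<Sum>q\<in>C. rsgn q * h ((r \<circ> s) \<circ> (t \<circ> q)))"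
    by (simp add: xe comp_assoc)
  also have "\<dots> = (\<Sum>r\<in>R. \<Sum>q\<in>C. rsgn q * h (r \<circ> (t \<circ> q)))"
    by (rule sumR(2)[OF st(1), of "\<lambda>r. \<Sum>q\<in>C. rsgn q * h (r \<circ> (t \<circ> q))"])
  also have "\<dots> = (\<Sum>r\<in>R. \<Sum>q\<in>C. rsgn t * (rsgn (t \<circ> q) * h (r \<circ> (t \<circ> q))))"
    by (intro sum.cong refl)
       (use CD(1) st rsgn_comp[of t n] rsgn_square in \<open>simp add: mult.assoc\<close>)
  also have "\<dots> = (\<Sum>r\<in>R. \<Sum>q\<in>C. rsgn t * (rsgn q * h (r \<circ> q)))"
    by (rule sum.cong[OF refl], rule sumC(1)[OF st(2)])
  finally show ?thesis using cf_RC[OF st] by (simp add: xe sum_distrib_left)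
next
  fix t assume t: "t \<in> R" "inv x \<circ> t \<circ> x \<in> C" and s: "sign (inv x \<circ> t \<circ> x) = -1"
  define u where "u = inv x \<circ> t \<circ> x"
  have xu: "x \<circ> u = t \<circ> x" using sym_group_inv_o[OF x] by (simp add: u_def comp_assoc)
  have neg: "rsgn u = -1" using s by (simp add: u_def)
  have u: "u \<in> C" using t by (simp add: u_def)
  have "?L = (\<Sum>r\<in>R. \<Sum>q\<in>C. rsgn q * h ((r \<circ> t) \<circ> x \<circ> q))"
    by (rule sumR(2)[OF t(1), of "\<lambda>r. \<Sum>q\<in>C. rsgn q * h (r \<circ> x \<circ> q)", symmetric])
  also have "\<dots> = (\<Sum>r\<in>R. \<Sum>q\<in>C. - (rsgn (u \<circ> q) * h (r \<circ> x \<circ> (u \<circ> q))))"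
  proof (intro sum.cong refl)
    fix r q :: "nat \<Rightarrow> nat" assume "q \<in> C"
    have "r \<circ> t \<circ> x \<circ> q = r \<circ> x \<circ> (u \<circ> q)" by (metis xu comp_assoc)
    then show "rsgn q * h (r \<circ> t \<circ> x \<circ> q) = - (rsgn (u \<circ> q) * h (r \<circ> x \<circ> (u \<circ> q)))"
      using rsgn_comp[of u n q] neg CD(1) u \<open>q \<in> C\<close> by simp
  qed
  also have "\<dots> = (\<Sum>r\<in>R. \<Sum>q\<in>C. - (rsgn q * h (r \<circ> x \<circ> q)))"
    by (rule sum.cong[OF refl], rule sumC(1)[OF u])
  also have "\<dots> = - ?L" by (simp add: sum_negf)
  finally have "?L = 0" by simp
  moreover have "cf x = 0"
    using cf_left[OF t(1), of x] cf_right[OF u, of x] neg by (simp add: xu)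
  ultimately show ?thesis by simp
qed

text \<open>Inversion reverses the order of the two groups and replaces \<open>x\<close> by its
  inverse, so this is the previous lemma for the test function composed with
  \<open>inv\<close>.\<close>

lemma sandwich_CR:
  assumes x: "x \<in> sym_group n"
  shows "(\<Sum>q\<in>C. \<Sum>r\<in>R. rsgn q * h (q \<circ> x \<circ> r)) =
    cf (inv x) * (\<Sum>q\<in>C. \<Sum>r\<in>R. rsgn q * h (q \<circ> r))"
proof -
  have flip: "(\<Sum>q\<in>C. \<Sum>r\<in>R. rsgn q * h (q \<circ> y \<circ> r)) =
      (\<Sum>r\<in>R. \<Sum>q\<in>C. rsgn q * h (inv (r \<circ> inv y \<circ> q)))" if y: "y \<in> sym_group n" for y
  proof -
    have "(\<Sum>q\<in>C. \<Sum>r\<in>R. rsgn q * h (q \<circ> y \<circ> r)) =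
        (\<Sum>q\<in>C. \<Sum>r\<in>R. rsgn (inv q) * h (inv q \<circ> y \<circ> r))"
      by (rule sumC(3)[symmetric])
    also have "\<dots> = (\<Sum>q\<in>C. \<Sum>r\<in>R. rsgn (inv q) * h (inv q \<circ> y \<circ> inv r))"
      by (rule sum.cong[OF refl], rule sumR(3)[symmetric])
    also have "\<dots> = (\<Sum>q\<in>C. \<Sum>r\<in>R. rsgn q * h (inv (r \<circ> inv y \<circ> q)))"
    proof (intro sum.cong refl)
      fix q r assume "q \<in> C" "r \<in> R"
      then have "q \<in> sym_group n" "r \<in> sym_group n" using RD CD by auto
      then show "rsgn (inv q) * h (inv q \<circ> y \<circ> inv r) = rsgn q * h (inv (r \<circ> inv y \<circ> q))"
        using y rsgn_inv[of q n]
        by (simp add: sym_group_inv_comp[of _ n] sym_group_inv_o[of _ n] comp_assoc)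
    qed
    also have "\<dots> = (\<Sum>r\<in>R. \<Sum>q\<in>C. rsgn q * h (inv (r \<circ> inv y \<circ> q)))"
      by (rule sum.swap)
    finally show ?thesis .
  qed
  have "(\<Sum>q\<in>C. \<Sum>r\<in>R. rsgn q * h (q \<circ> x \<circ> r)) =
      cf (inv x) * (\<Sum>r\<in>R. \<Sum>q\<in>C. rsgn q * h (inv (r \<circ> q)))"
    using flip[OF x] sandwich_RC[of "inv x" "\<lambda>z. h (inv z)"] x by auto
  also have "(\<Sum>r\<in>R. \<Sum>q\<in>C. rsgn q * h (inv (r \<circ> q))) = (\<Sum>q\<in>C. \<Sum>r\<in>R. rsgn q * h (q \<circ> r))"
    using flip[of id] by (simp add: comp_def)
  finally show ?thesis .
qed

text \<open>In a product r q r' q' the middle factor q r' stands between \<open>R\<close> and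
  \<open>C\<close>, so von Neumann's lemma trades it for the number
  \<open>cf (q \<circ> r')\<close>. The signed sum of these numbers is \<open>kappa\<close>.\<close>

lemma cf_square:
  "(\<Sum>x\<in>sym_group n. cf x * (\<Sum>y\<in>sym_group n. cf y * h (x \<circ> y))) =
    kappa * (\<Sum>x\<in>sym_group n. cf x * h x)"
proof -
  have "(\<Sum>x\<in>sym_group n. cf x * (\<Sum>y\<in>sym_group n. cf y * h (x \<circ> y))) =
     (\<Sum>r\<in>R. \<Sum>q\<in>C. rsgn q * (\<Sum>r'\<in>R. \<Sum>q'\<in>C. rsgn q' * h (r \<circ> (q \<circ> r') \<circ> q')))"
    by (simp add: cf_test comp_assoc)
  also have "\<dots> = (\<Sum>q\<in>C. \<Sum>r\<in>R. \<Sum>r'\<in>R. rsgn q * (\<Sum>q'\<in>C. rsgn q' * h (r \<circ> (q \<circ> r') \<circ> q')))"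
    by (subst sum.swap) (simp add: sum_distrib_left)
  also have "\<dots> = (\<Sum>q\<in>C. \<Sum>r'\<in>R. rsgn q * (\<Sum>r\<in>R. \<Sum>q'\<in>C. rsgn q' * h (r \<circ> (q \<circ> r') \<circ> q')))"
    by (rule sum.cong[OF refl], subst sum.swap) (simp add: sum_distrib_left)
  also have "\<dots> = (\<Sum>q\<in>C. \<Sum>r'\<in>R. rsgn q * (cf (q \<circ> r') * (\<Sum>r\<in>R. \<Sum>q'\<in>C. rsgn q' * h (r \<circ> q'))))"
    by (intro sum.cong refl) (use RD(1) CD(1) sandwich_RC in auto)
  also have "\<dots> = kappa * (\<Sum>x\<in>sym_group n. cf x * h x)"
    by (simp add: cf_test kappa_def sum_distrib_right mult.assoc)
  finally show ?thesis .
qed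

lemma card_R_pos: "card R > 0"
  using RD by (auto simp: card_gt_0_iff)

text \<open>\<open>|R|\<^sup>2 \<kappa>\<close> is the squared norm of the element \<open>\<Sum> sgn q \<cdot> r q r'\<close>, whose value at the identity is \<open>|R|\<close>.\<close>

lemma kappa_nonzero: "kappa \<noteq> 0"
proof -
  define u where "u x = (\<Sum>s\<in>R. cf (x \<circ> s))" for x
  have uR: "u (x \<circ> t) = u x" if "t \<in> R" for x t
    unfolding u_def using sumR(1)[OF that, of "\<lambda>s. cf (x \<circ> s)"] by (simp add: comp_assoc)
  have "(\<Sum>x\<in>sym_group n. u x * u x) = (\<Sum>s\<in>R. \<Sum>x\<in>sym_group n. cf (x \<circ> s) * u (x \<circ> s))"
    by (subst sum.swap) (simp add: uR, simp add: u_def sum_distrib_right)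
  also have "\<dots> = (\<Sum>s\<in>R. \<Sum>x\<in>sym_group n. cf x * u x)"
    by (rule sum.cong[OF refl], rule sum_sym_group(2)) (rule RD(1))
  also have "\<dots> = card R * (\<Sum>r\<in>R. \<Sum>q\<in>C. rsgn q * u (r \<circ> q))"
    by (simp add: cf_test)
  also have "(\<Sum>r\<in>R. \<Sum>q\<in>C. rsgn q * u (r \<circ> q)) = (\<Sum>r\<in>R. kappa)"
    by (rule sum.cong[OF refl]) (simp add: u_def kappa_def cf_left comp_assoc sum_distrib_left)
  finally have sq: "(\<Sum>x\<in>sym_group n. u x * u x) = card R * (card R * kappa)" by simp
  have "cf s = 1" if "s \<in> R" for s
    using cf_RC[OF that CD(2)] by simp
  then have "u id = card R" by (simp add: u_def)
  moreover have "u id * u id \<le> (\<Sum>x\<in>sym_group n. u x * u x)"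
    by (rule member_le_sum[of id]) auto
  ultimately show ?thesis using sq card_R_pos by auto
qed

text \<open>This sum becomes the norm of the character. Replacing g by r g cycles r q into q r, and
  the equation r' q' = g^-1 q r g is equivalent to r g q'^-1 = q^-1 g r'. Now g stands between
  \<open>R\<close> and \<open>C\<close> on one side and between \<open>C\<close> and
  \<open>R\<close> on the other, so the two sandwich lemmas give
  \<open>cf g * (cf (inv g) * kappa)\<close> for each g. Summing over g yields a second
  \<open>kappa\<close>.\<close>

lemma cf_conj_norm: "(\<Sum>g\<in>sym_group n. \<Sum>p\<in>sym_group n. cf (inv g \<circ> p \<circ> g) * cf p) = kappa * kappa"
proof -
  have "(\<Sum>g\<in>sym_group n. \<Sum>p\<in>sym_group n. cf (inv g \<circ> p \<circ> g) * cf p) =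
     (\<Sum>g\<in>sym_group n. \<Sum>r\<in>R. \<Sum>q\<in>C. rsgn q * cf (inv g \<circ> (r \<circ> q) \<circ> g))"
    by (subst mult.commute) (simp only: cf_test)
  also have "\<dots> = (\<Sum>r\<in>R. \<Sum>q\<in>C. \<Sum>g\<in>sym_group n. rsgn q * cf (inv g \<circ> (r \<circ> q) \<circ> g))"
    by (subst sum.swap, rule sum.cong[OF refl], rule sum.swap)
  also have "\<dots> = (\<Sum>r\<in>R. \<Sum>q\<in>C. \<Sum>g\<in>sym_group n. rsgn q * cf (inv (r \<circ> g) \<circ> (r \<circ> q) \<circ> (r \<circ> g)))"
    by (rule sum.cong[OF refl], rule sum.cong[OF refl],
        rule sum_sym_group(1)[where f = "\<lambda>g. rsgn _ * cf (inv g \<circ> _ \<circ> g)", symmetric]) (rule RD(1))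
  also have "\<dots> = (\<Sum>r\<in>R. \<Sum>q\<in>C. \<Sum>g\<in>sym_group n. rsgn q * cf (inv g \<circ> (q \<circ> r) \<circ> g))"
    by (intro sum.cong refl)
       (use RD(1) in \<open>simp add: sym_group_inv_comp[of _ n] sym_group_inv_o[of _ n] comp_assoc\<close>)
  also have "\<dots> = (\<Sum>g\<in>sym_group n. \<Sum>q\<in>C. \<Sum>r\<in>R. rsgn q * cf (inv g \<circ> (q \<circ> r) \<circ> g))"
  proof -
    have "(\<Sum>r\<in>R. \<Sum>q\<in>C. \<Sum>g\<in>G. F r q g) = (\<Sum>g\<in>G. \<Sum>q\<in>C. \<Sum>r\<in>R. F r q g)"
      for F :: "(nat \<Rightarrow> nat) \<Rightarrow> (nat \<Rightarrow> nat) \<Rightarrow> (nat \<Rightarrow> nat) \<Rightarrow> real" and G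
    proof -
      have "(\<Sum>r\<in>R. \<Sum>q\<in>C. \<Sum>g\<in>G. F r q g) = (\<Sum>q\<in>C. \<Sum>r\<in>R. \<Sum>g\<in>G. F r q g)" by (rule sum.swap)
      also have "\<dots> = (\<Sum>q\<in>C. \<Sum>g\<in>G. \<Sum>r\<in>R. F r q g)" by (rule sum.cong[OF refl], rule sum.swap)
      also have "\<dots> = (\<Sum>g\<in>G. \<Sum>q\<in>C. \<Sum>r\<in>R. F r q g)" by (rule sum.swap)
      finally show ?thesis .
    qed
    then show ?thesis .
  qed
  also have "\<dots> = (\<Sum>g\<in>sym_group n. cf g * (cf (inv g) * kappa))"
  proof (rule sum.cong[OF refl])
    fix g assume g: "g \<in> sym_group n"
    have eq: "r' \<circ> q' = inv g \<circ> (q \<circ> r) \<circ> g \<longleftrightarrow> r \<circ> g \<circ> inv q' = inv q \<circ> g \<circ> r'"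
      if "q \<in> C" "r \<in> R" "q' \<in> C" "r' \<in> R" for q r q' r'
    proof -
      have G: "q \<in> sym_group n" "q' \<in> sym_group n" using that CD by auto
      have "r' \<circ> q' = inv g \<circ> (q \<circ> r) \<circ> g \<longleftrightarrow> g \<circ> (r' \<circ> q') = g \<circ> (inv g \<circ> (q \<circ> r) \<circ> g)"
        using sym_group_cancel[OF g] by simp
      also have "\<dots> \<longleftrightarrow> g \<circ> r' \<circ> q' = q \<circ> (r \<circ> g)"
        by (simp add: comp_assoc sym_group_inv_o[OF g])
      also have "\<dots> \<longleftrightarrow> r \<circ> g \<circ> inv q' = inv q \<circ> g \<circ> r'"
        using sym_group_eq_iff(2)[OF G(2), of "g \<circ> r'" "q \<circ> (r \<circ> g)"]
          sym_group_eq_iff(1)[OF G(1), of "r \<circ> g \<circ> inv q'" "g \<circ> r'"] by (auto simp: comp_assoc)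
      finally show ?thesis .
    qed
    have "(\<Sum>q\<in>C. \<Sum>r\<in>R. rsgn q * cf (inv g \<circ> (q \<circ> r) \<circ> g)) =
      (\<Sum>q\<in>C. \<Sum>r\<in>R. \<Sum>r'\<in>R. \<Sum>q'\<in>C. rsgn q * (if r \<circ> g \<circ> inv q' = inv q \<circ> g \<circ> r' then rsgn q' else 0))"
      unfolding cf_def sum_distrib_left by (intro sum.cong refl) (simp add: eq)
    also have "\<dots> = (\<Sum>q\<in>C. \<Sum>r\<in>R. \<Sum>r'\<in>R. \<Sum>q'\<in>C.
        rsgn (inv q) * (if r \<circ> g \<circ> inv q' = inv q \<circ> g \<circ> r' then rsgn (inv q') else 0))"
      by (intro sum.cong refl) (use CD(1) in \<open>simp add: rsgn_inv[of _ n]\<close>)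
    also have "\<dots> = (\<Sum>q\<in>C. \<Sum>r\<in>R. \<Sum>r'\<in>R. \<Sum>q'\<in>C.
        rsgn q * (if r \<circ> g \<circ> inv q' = q \<circ> g \<circ> r' then rsgn (inv q') else 0))"
      by (rule sumC(3))
    also have "\<dots> = (\<Sum>q\<in>C. \<Sum>r\<in>R. \<Sum>r'\<in>R. \<Sum>q'\<in>C.
        rsgn q * (if r \<circ> g \<circ> q' = q \<circ> g \<circ> r' then rsgn q' else 0))"
      by (rule sum.cong[OF refl], rule sum.cong[OF refl], rule sum.cong[OF refl], rule sumC(3))
    also have "\<dots> = (\<Sum>q\<in>C. \<Sum>r'\<in>R. rsgn q * (\<Sum>r\<in>R. \<Sum>q'\<in>C.
        rsgn q' * (if r \<circ> g \<circ> q' = q \<circ> g \<circ> r' then 1 else 0)))"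
      by (rule sum.cong[OF refl], subst sum.swap)
         (auto simp: sum_distrib_left intro!: sum.cong)
    also have "\<dots> = (\<Sum>q\<in>C. \<Sum>r'\<in>R. rsgn q * (cf g * (\<Sum>r\<in>R. \<Sum>q'\<in>C.
        rsgn q' * (if r \<circ> q' = q \<circ> g \<circ> r' then 1 else 0))))"
      by (simp only: sandwich_RC[OF g, of "\<lambda>z. if z = _ then 1 else 0"])
    also have "\<dots> = (\<Sum>q\<in>C. \<Sum>r'\<in>R. rsgn q * (cf g * cf (q \<circ> g \<circ> r')))"
      unfolding cf_def by (intro sum.cong refl arg_cong2[where f = "(*)"]) auto
    also have "\<dots> = cf g * (\<Sum>q\<in>C. \<Sum>r'\<in>R. rsgn q * cf (q \<circ> g \<circ> r'))"
      by (simp add: sum_distrib_left mult.left_commute)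
    also have "\<dots> = cf g * (cf (inv g) * kappa)"
      by (simp add: sandwich_CR[OF g] kappa_def)
    finally show "(\<Sum>q\<in>C. \<Sum>r\<in>R. rsgn q * cf (inv g \<circ> (q \<circ> r) \<circ> g)) = cf g * (cf (inv g) * kappa)" .
  qed
  also have "\<dots> = (\<Sum>r\<in>R. \<Sum>q\<in>C. rsgn q * (cf (inv (r \<circ> q)) * kappa))"
    by (rule cf_test)
  also have "\<dots> = (\<Sum>r\<in>R. \<Sum>q\<in>C. rsgn (inv q) * (cf (inv q \<circ> inv r) * kappa))"
    by (intro sum.cong refl)
       (use RD(1) CD(1) in \<open>simp add: rsgn_inv[of _ n] sym_group_inv_comp[of _ n]\<close>)
  also have "\<dots> = (\<Sum>r\<in>R. \<Sum>q\<in>C. rsgn q * (cf (q \<circ> inv r) * kappa))"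
    by (rule sum.cong[OF refl], rule sumC(3))
  also have "\<dots> = (\<Sum>r\<in>R. \<Sum>q\<in>C. rsgn q * (cf (q \<circ> r) * kappa))"
    by (rule sumR(3))
  also have "\<dots> = kappa * kappa"
    unfolding kappa_def by (subst sum.swap) (simp add: sum_distrib_right mult.assoc)
  finally show ?thesis .
qed

end

section \<open>Tableaux and column-injective colourings\<close>

lemma card_rows_below:
  fixes S :: "(nat \<times> nat) set"
  assumes "finite S" "\<And>i j. (i, j) \<in> S \<Longrightarrow> j < m"
  shows "card {(i, j) \<in> S. i < k} = (\<Sum>j<m. card {i. (i, j) \<in> S \<and> i < k})"
proof -
  have fin: "finite {i. (i, j) \<in> S \<and> i < k}" for j
    by simp
  have "{(i, j) \<in> S. i < k} = (\<lambda>(j, i). (i, j)) ` (SIGMA j:{..<m}. {i. (i, j) \<in> S \<and> i < k})"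
    using assms(2) by force
  moreover have "inj_on (\<lambda>(j, i). (i, j)) (SIGMA j:{..<m}. {i. (i, j) \<in> S \<and> i < k})"
    by (auto simp: inj_on_def)
  ultimately show ?thesis
    using fin by (simp add: card_image)
qed

context
  fixes D S :: "(nat \<times> nat) set"
  assumes finD: "finite D" and down: "\<And>i i' j. (i, j) \<in> D \<Longrightarrow> i' \<le> i \<Longrightarrow> (i', j) \<in> D"
    and finS: "finite S" and cols: "\<And>j. card {i. (i, j) \<in> S} = card {i. (i, j) \<in> D}"
begin

lemma finite_columns: "finite {i. (i, j) \<in> D}" "finite {i. (i, j) \<in> S}"
proof -
  have "{i. (i, j) \<in> D} \<subseteq> fst ` D" "{i. (i, j) \<in> S} \<subseteq> fst ` S" by force+
  then show "finite {i. (i, j) \<in> D}" "finite {i. (i, j) \<in> S}"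
    using finD finS by (auto intro: finite_subset)
qed

lemma column_below: "card {i. (i, j) \<in> S \<and> i < k} \<le> card {i. (i, j) \<in> D \<and> i < k}"
proof (cases "(k, j) \<in> D")
  case True
  then have "{i. (i, j) \<in> D \<and> i < k} = {..<k}"
    using down by (auto intro: less_imp_le)
  moreover have "card {i. (i, j) \<in> S \<and> i < k} \<le> card {..<k}"
    by (rule card_mono) auto
  ultimately show ?thesis by simp
next
  case False
  then have "{i. (i, j) \<in> D \<and> i < k} = {i. (i, j) \<in> D}"
    by (auto simp: not_less) (meson down not_less)
  moreover have "card {i. (i, j) \<in> S \<and> i < k} \<le> card {i. (i, j) \<in> S}"
    by (rule card_mono) (use finite_columns in auto)
  ultimately show ?thesis using cols by simp
qed

lemma column_bound: obtains m where "\<And>i j. (i, j) \<in> S \<union> D \<Longrightarrow> j < m"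
proof -
  have "finite (snd ` (S \<union> D))" using finS finD by simp
  then obtain m where "\<forall>j\<in>snd ` (S \<union> D). j < m"
    using finite_nat_set_iff_bounded by metis
  then show ?thesis using that[of m] by force
qed

text \<open>Among the finite sets with prescribed column lengths, the top-justified one has the most
  boxes in its first \<open>k\<close> rows, as already holds in each single column. This is the
  source of every dominance statement about tableaux below.\<close>

lemma rows_below_le: "card {(i, j) \<in> S. i < k} \<le> card {(i, j) \<in> D. i < k}"
proof -
  obtain m where m: "\<And>i j. (i, j) \<in> S \<union> D \<Longrightarrow> j < m" using column_bound by blast
  show ?thesis
    using card_rows_below[OF finS m[OF UnI1], where k = k] card_rows_below[OF finD m[OF UnI2], where k = k]
      sum_mono[OF column_below, where K = "{..<m}"] by simp
qed

text \<open>The columnwise inequalities all point the same way, so equality of the totals forces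
  equality in every column. Differences in \<open>k\<close> then decide membership of each single
  box.\<close>

lemma rows_below_eq_imp_eq:
  assumes eq: "\<And>k. card {(i, j) \<in> S. i < k} = card {(i, j) \<in> D. i < k}"
  shows "S = D"
proof -
  obtain m where m: "\<And>i j. (i, j) \<in> S \<union> D \<Longrightarrow> j < m" using column_bound by blast
  have col: "card {i. (i, j) \<in> S \<and> i < k} = card {i. (i, j) \<in> D \<and> i < k}" for j k
  proof (cases "j < m")
    case True
    have "(\<Sum>j<m. card {i. (i, j) \<in> S \<and> i < k}) = (\<Sum>j<m. card {i. (i, j) \<in> D \<and> i < k})"
      using card_rows_below[OF finS m[OF UnI1], where k = k] card_rows_below[OF finD m[OF UnI2], where k = k] eq[of k]
      by simp
    then show ?thesis
      using sum_mono_inv[of _ "{..<m}" _ j] column_below True by auto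
  next
    case False
    then have "(i, j) \<notin> S" "(i, j) \<notin> D" for i using m[of i j] by auto
    then show ?thesis by simp
  qed
  have step: "card {i. (i, j) \<in> A \<and> i < Suc k} = card {i. (i, j) \<in> A \<and> i < k} + (if (k, j) \<in> A then 1 else 0)"
    for A j k
  proof -
    have "{i. (i, j) \<in> A \<and> i < Suc k} = {i. (i, j) \<in> A \<and> i < k} \<union> (if (k, j) \<in> A then {k} else {})"
      by (auto simp: less_Suc_eq)
    then show ?thesis by (simp add: card_Un_disjoint)
  qed
  have "(k, j) \<in> S \<longleftrightarrow> (k, j) \<in> D" for k j
    using step[of j S k] step[of j D k] col[of j "Suc k"] col[of j k] by (auto split: if_splits)
  then show ?thesis by auto
qed

end

section \<open>Row lengths, padded by zeros, and the row-by-row tableau\<close>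

definition row_len :: "nat list \<Rightarrow> nat \<Rightarrow> nat" where
  "row_len l i = (if i < length l then l ! i else 0)"

lemma row_len_antimono:
  assumes "l \<in> partitions_of n" "i \<le> j" shows "row_len l j \<le> row_len l i"
  using assms by (cases "i = j") (auto simp: partitions_of_def row_len_def sorted_wrt_iff_nth_less)

lemma sum_row_len: "(\<Sum>i<k. row_len l i) = sum_list (take k l)"
proof (induction k)
  case (Suc k)
  then show ?case
    by (cases "k < length l") (auto simp: row_len_def take_Suc_conv_app_nth)
qed simp

lemma sum_row_len_total: "length l \<le> k \<Longrightarrow> (\<Sum>i<k. row_len l i) = sum_list l"
  by (simp add: sum_row_len)

lemma young_diagram_row_len: "young_diagram l = {(i, j). j < row_len l i}"
  by (auto simp: young_diagram_def row_len_def split: if_splits)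

lemma young_diagram_Sigma: "young_diagram l = (SIGMA i:{..<length l}. {..<l ! i})"
  by (auto simp: young_diagram_def)

lemma finite_young_diagram [simp]: "finite (young_diagram l)"
  by (simp add: young_diagram_Sigma)

lemma card_young_diagram: "card (young_diagram l) = sum_list l"
  by (simp add: young_diagram_Sigma sum_list_sum_nth atLeast0LessThan)

lemma young_diagram_down:
  assumes "l \<in> partitions_of n" "(i, j) \<in> young_diagram l" "i' \<le> i" "j' \<le> j"
  shows "(i', j') \<in> young_diagram l"
  using row_len_antimono[OF assms(1,3)] assms(2,4) by (auto simp: young_diagram_row_len)

lemma card_young_diagram_rows: "card {(i, j) \<in> young_diagram l. i < k} = (\<Sum>i<k. row_len l i)"
proof -
  have "{(i, j) \<in> young_diagram l. i < k} = (SIGMA i:{..<k}. {..<row_len l i})"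
    by (auto simp: young_diagram_row_len)
  then show ?thesis by simp
qed

lemma tab_position:
  assumes "x < sum_list l"
  shows "tab_row l x < length l" "x = sum_list (take (tab_row l x) l) + tab_col l x"
    "tab_col l x < l ! tab_row l x"
proof -
  define i where "i = tab_row l x"
  have ex: "x < sum_list (take (Suc (length l)) l)" using assms by simp
  have lt: "x < sum_list (take (Suc i) l)"
    unfolding i_def tab_row_def by (rule LeastI[where P = "\<lambda>i. x < sum_list (take (Suc i) l)"]) (rule ex)
  have ge: "sum_list (take i l) \<le> x"
  proof (cases i)
    case (Suc i')
    then have "\<not> x < sum_list (take (Suc i') l)"
      using not_less_Least[where P = "\<lambda>i. x < sum_list (take (Suc i) l)" and k = i'] by (auto simp: i_def tab_row_def)
    then show ?thesis using Suc by simp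
  qed simp
  show il: "tab_row l x < length l"
  proof (rule ccontr)
    assume "\<not> tab_row l x < length l"
    then show False using ge assms by (simp add: i_def)
  qed
  show e: "x = sum_list (take (tab_row l x) l) + tab_col l x"
    using ge by (simp add: tab_col_def i_def)
  show "tab_col l x < l ! tab_row l x"
    using lt il e by (simp add: i_def take_Suc_conv_app_nth)
qed

lemma tab_bij: "bij_betw (\<lambda>x. (tab_row l x, tab_col l x)) {..<sum_list l} (young_diagram l)"
proof -
  have inj: "inj_on (\<lambda>x. (tab_row l x, tab_col l x)) {..<sum_list l}"
  proof (rule inj_onI)
    fix x y assume "x \<in> {..<sum_list l}" "y \<in> {..<sum_list l}"
      and "(tab_row l x, tab_col l x) = (tab_row l y, tab_col l y)"
    then show "x = y" using tab_position(2)[of x l] tab_position(2)[of y l] by simp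
  qed
  have "(\<lambda>x. (tab_row l x, tab_col l x)) ` {..<sum_list l} \<subseteq> young_diagram l"
    using tab_position[of _ l] by (auto simp: young_diagram_def)
  then have "(\<lambda>x. (tab_row l x, tab_col l x)) ` {..<sum_list l} = young_diagram l"
    by (rule card_subset_eq[rotated]) (auto simp: card_image[OF inj] card_young_diagram)
  with inj show ?thesis by (simp add: bij_betw_def)
qed

lemma stabilizer_iff:
  assumes "p \<in> sym_group n"
  shows "p \<in> stabilizer n f \<longleftrightarrow> (\<forall>x<n. f (p x) = f x)"
proof -
  have "p x = x" if "\<not> x < n" for x
    using sym_groupD(1)[OF assms] that by (auto simp: permutes_def)
  then show ?thesis using assms by (auto simp: stabilizer_def fun_eq_iff) metis
qed

lemma row_group_stabilizer: "row_group l = stabilizer (sum_list l) (tab_row l)"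
  by (auto simp: row_group_def stabilizer_iff) (auto simp: stabilizer_def dest: fun_cong)

lemma col_group_stabilizer: "col_group l = stabilizer (sum_list l) (tab_col l)"
  by (auto simp: col_group_def stabilizer_iff) (auto simp: stabilizer_def dest: fun_cong)

section \<open>Column-injective colourings and the two groups of a tableau\<close>

context
  fixes l :: "nat list" and n :: nat
  assumes l: "l \<in> partitions_of n"
begin

lemma size_l: "sum_list l = n"
  using l by (simp add: partitions_of_def)

context
  fixes f :: "nat \<Rightarrow> nat"
  assumes inj: "\<And>x y. x < n \<Longrightarrow> y < n \<Longrightarrow> x \<noteq> y \<Longrightarrow> tab_col l x = tab_col l y \<Longrightarrow> f x \<noteq> f y"
begin

private definition "S = (\<lambda>x. (f x, tab_col l x)) ` {..<n}"

private lemma S_inj: "inj_on (\<lambda>x. (f x, tab_col l x)) {..<n}"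
  using inj by (auto simp: inj_on_def)

private lemma S_columns: "card {i. (i, j) \<in> S} = card {i. (i, j) \<in> young_diagram l}"
proof -
  have *: "card {i. (i, j) \<in> (\<lambda>x. (g x, tab_col l x)) ` {..<n}} = card {x. x < n \<and> tab_col l x = j}"
    if "inj_on (\<lambda>x. (g x, tab_col l x)) {..<n}" for g :: "nat \<Rightarrow> nat"
  proof -
    have "{i. (i, j) \<in> (\<lambda>x. (g x, tab_col l x)) ` {..<n}} = g ` {x. x < n \<and> tab_col l x = j}"
      by auto
    moreover have "inj_on g {x. x < n \<and> tab_col l x = j}"
      using that by (auto simp: inj_on_def)
    ultimately show ?thesis by (simp add: card_image)
  qed
  have "young_diagram l = (\<lambda>x. (tab_row l x, tab_col l x)) ` {..<n}"
    and "inj_on (\<lambda>x. (tab_row l x, tab_col l x)) {..<n}"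
    using tab_bij[of l] by (auto simp: bij_betw_def size_l)
  then show ?thesis using *[of f] *[of "tab_row l"] S_inj by (simp add: S_def)
qed

private lemma S_rows: "card {(i, j) \<in> S. i < k} = card {x. x < n \<and> f x < k}"
proof -
  have "{(i, j) \<in> S. i < k} = (\<lambda>x. (f x, tab_col l x)) ` {x. x < n \<and> f x < k}"
    by (auto simp: S_def)
  moreover have "inj_on (\<lambda>x. (f x, tab_col l x)) {x. x < n \<and> f x < k}"
    using S_inj by (rule inj_on_subset) auto
  ultimately show ?thesis by (simp add: card_image)
qed

text \<open>Move each entry \<open>x\<close> within its column to row \<open>f x\<close>.
  Injectivity of \<open>f\<close> on columns makes this a set of boxes with the column lengths of
  the diagram, to which the packing bound applies.\<close>

lemma column_injective_dominated: "card {x. x < n \<and> f x < k} \<le> (\<Sum>i<k. row_len l i)"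
  using rows_below_le[of "young_diagram l" S k] S_columns S_rows young_diagram_down[OF l]
  by (auto simp: card_young_diagram_rows S_def)

text \<open>In the extremal case the moved boxes fill the diagram exactly. Comparing this filling
  with the original tableau gives a permutation that keeps columns, and it is the required
  \<open>s\<close>.\<close>

lemma column_injective_rows:
  assumes "\<And>k. card {x. x < n \<and> f x < k} = (\<Sum>i<k. row_len l i)"
  obtains s where "s \<in> col_group l" "\<And>x. x < n \<Longrightarrow> f x = tab_row l (s x)"
proof -
  have "S = young_diagram l"
    using assms S_columns S_rows young_diagram_down[OF l]
    by (intro rows_below_eq_imp_eq) (auto simp: card_young_diagram_rows S_def)
  then have bS: "bij_betw (\<lambda>x. (f x, tab_col l x)) {..<n} (young_diagram l)"
    using S_inj by (simp add: bij_betw_def S_def)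
  have bT: "bij_betw (\<lambda>x. (tab_row l x, tab_col l x)) {..<n} (young_diagram l)"
    using tab_bij[of l] by (simp add: size_l)
  define T where "T x = (tab_row l x, tab_col l x)" for x
  define h where "h = inv_into {..<n} T \<circ> (\<lambda>x. (f x, tab_col l x))"
  define s where "s x = (if x < n then h x else x)" for x
  have Ts: "T (h x) = (f x, tab_col l x)" if "x < n" for x
  proof -
    have "(f x, tab_col l x) \<in> T ` {..<n}" using bS bT that by (auto simp: bij_betw_def T_def[abs_def])
    then show ?thesis by (simp add: h_def f_inv_into_f)
  qed
  have "bij_betw h {..<n} {..<n}"
    unfolding h_def by (rule bij_betw_trans[OF bS]) (use bT in \<open>auto simp: T_def[abs_def] intro: bij_betw_inv_into\<close>)
  then have "bij_betw s {..<n} {..<n}"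
    by (rule bij_betw_cong[THEN iffD1, rotated]) (simp add: s_def)
  then have sG: "s permutes {..<n}"
    by (rule bij_imp_permutes) (simp add: s_def)
  have "tab_row l (s x) = f x" "tab_col l (s x) = tab_col l x" if "x < n" for x
    using Ts[OF that] that by (auto simp: T_def s_def)
  then show ?thesis
    using sG by (intro that[of s]) (auto simp: col_group_def sym_group_def size_l)
qed

end

lemma tab_row_count: "card {x. x < n \<and> tab_row l x = i} = row_len l i"
proof -
  let ?T = "\<lambda>x. (tab_row l x, tab_col l x)"
  have T: "inj_on ?T {..<n}" "?T ` {..<n} = {(i, j). j < row_len l i}"
    using tab_bij[of l] by (simp_all add: bij_betw_def size_l young_diagram_row_len)
  have "?T ` {x. x < n \<and> tab_row l x = i} = (?T ` {..<n}) \<inter> ({i} \<times> UNIV)" by auto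
  also have "\<dots> = {i} \<times> {..<row_len l i}" unfolding T(2) by auto
  finally have "card {x. x < n \<and> tab_row l x = i} = card ({i} \<times> {..<row_len l i})"
    using card_image[OF inj_on_subset[OF T(1), of "{x. x < n \<and> tab_row l x = i}"]] by fastforce
  then show ?thesis by simp
qed

lemma card_below_eq_sum: "card {x. x < n \<and> f x < k} = (\<Sum>i<k. card {x. x < n \<and> f x = i})"
  for f :: "nat \<Rightarrow> nat"
proof -
  have "{x. x < n \<and> f x < k} = (\<Union>i\<in>{..<k}. {x. x < n \<and> f x = i})" by auto
  then show ?thesis by (simp only:) (subst card_UN_disjoint, auto)
qed

lemma row_col_unique: "x < n \<Longrightarrow> y < n \<Longrightarrow> tab_row l x = tab_row l y \<Longrightarrow> tab_col l x = tab_col l y \<Longrightarrow> x = y"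
  using tab_bij[of l] by (auto simp: bij_betw_def inj_on_def size_l)

lemma transpose_in_stabilizer:
  fixes f :: "nat \<Rightarrow> 'a"
  assumes "x < n" "y < n" "f x = f y" shows "transpose x y \<in> stabilizer n f"
  using assms by (auto simp: stabilizer_def sym_group_def permutes_swap_id fun_eq_iff transpose_def)

text \<open>If \<open>x\<close> sends two entries of one column into the same row, the transposition
  of the images is a row element whose conjugate is a transposition in the column group. Otherwise
  the row of \<open>x y\<close>, as a colouring of \<open>y\<close>, is column injective with the
  row lengths as contents, so it comes from a column permutation \<open>s\<close>, and
  \<open>x \<circ> inv s\<close> preserves rows.\<close>

lemma young_pair_groups: "young_pair n (row_group l) (col_group l)"
proof
  show "perm_subgroup n (row_group l)" "perm_subgroup n (col_group l)"
    using perm_subgroup_stabilizer by (auto simp: row_group_stabilizer col_group_stabilizer size_l)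
next
  fix p assume p: "p \<in> row_group l" "p \<in> col_group l"
  then have perm: "p permutes {..<n}" by (simp add: row_group_def sym_group_def size_l)
  show "p = id"
  proof
    fix x
    show "p x = id x"
    proof (cases "x < n")
      case True
      then have "p x < n" using permutes_in_image[OF perm, of x] by simp
      then show ?thesis using p True row_col_unique by (simp add: row_group_def col_group_def size_l)
    qed (use perm in \<open>auto simp: permutes_def\<close>)
  qed
next
  fix x assume x: "x \<in> sym_group n"
  note perm = sym_groupD(1)[OF x]
  have xn: "x y < n \<longleftrightarrow> y < n" for y using permutes_in_image[OF perm, of y] by simp
  show "(\<exists>r\<in>row_group l. \<exists>q\<in>col_group l. x = r \<circ> q) \<or>
    (\<exists>t\<in>row_group l. inv x \<circ> t \<circ> x \<in> col_group l \<and> sign (inv x \<circ> t \<circ> x) = -1)"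
  proof (cases "\<exists>y z. y < n \<and> z < n \<and> y \<noteq> z \<and> tab_col l y = tab_col l z \<and> tab_row l (x y) = tab_row l (x z)")
    case True
    then obtain y z where yz: "y < n" "z < n" "y \<noteq> z" "tab_col l y = tab_col l z"
      "tab_row l (x y) = tab_row l (x z)" by blast
    have "inv x \<circ> transpose (x y) (x z) \<circ> x = transpose y z"
    proof
      fix w
      show "(inv x \<circ> transpose (x y) (x z) \<circ> x) w = transpose y z w"
        using sym_groupD(4)[OF x] by (auto simp: transpose_def inj_eq)
    qed
    moreover have "transpose y z \<in> col_group l" "transpose (x y) (x z) \<in> row_group l"
      using yz xn by (auto simp: col_group_stabilizer row_group_stabilizer size_l transpose_in_stabilizer)
    ultimately show ?thesis using yz(3) by (intro disjI2 bexI[of _ "transpose (x y) (x z)"]) (auto simp: sign_swap_id)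
  next
    case False
    have "card {y. y < n \<and> tab_row l (x y) = i} = row_len l i" for i
    proof -
      have "y \<in> x ` {y. y < n \<and> tab_row l (x y) = i}" if "y < n" "tab_row l y = i" for y
        using that xn[of "inv x y"] permutes_inverses(1)[OF perm, of y] by (auto intro!: image_eqI[of _ _ "inv x y"])
      then have "x ` {y. y < n \<and> tab_row l (x y) = i} = {y. y < n \<and> tab_row l y = i}"
        using xn by auto
      then have "card {y. y < n \<and> tab_row l y = i} = card {y. y < n \<and> tab_row l (x y) = i}"
        using card_image[OF inj_on_subset[OF sym_groupD(4)[OF x]], of "{y. y < n \<and> tab_row l (x y) = i}"] by simp
      then show ?thesis by (simp add: tab_row_count)
    qed
    then have "card {y. y < n \<and> tab_row l (x y) < k} = (\<Sum>i<k. row_len l i)" for k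
      using card_below_eq_sum[of "\<lambda>y. tab_row l (x y)" k] by simp
    moreover have "tab_row l (x y) \<noteq> tab_row l (x z)" if "y < n" "z < n" "y \<noteq> z" "tab_col l y = tab_col l z" for y z
      using False that by blast
    ultimately obtain s where s: "s \<in> col_group l" "\<And>y. y < n \<Longrightarrow> tab_row l (x y) = tab_row l (s y)"
      using column_injective_rows[of "\<lambda>y. tab_row l (x y)"] by metis
    have sG: "s \<in> sym_group n" using s by (simp add: col_group_def size_l)
    have "x \<circ> inv s \<in> row_group l"
    proof -
      have "tab_row l (x (inv s z)) = tab_row l z" if "z < n" for z
      proof -
        have "inv s z < n" using permutes_in_image[OF permutes_inv[OF sym_groupD(1)[OF sG]], of z] that by simp
        then show ?thesis using s(2)[of "inv s z"] permutes_inverses(1)[OF sym_groupD(1)[OF sG]] by simp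
      qed
      then show ?thesis using x sG by (auto simp: row_group_def size_l)
    qed
    moreover have "x = (x \<circ> inv s) \<circ> s" using sym_group_inv_o[OF sG] by (simp add: comp_assoc)
    ultimately show ?thesis using s(1) by blast
  qed
qed

end

section \<open>The character of the left ideal\<close>

lemma sum_fun_apply: "(\<Sum>i\<in>A. f i) x = (\<Sum>i\<in>A. f i x)"
  for f :: "'a \<Rightarrow> 'b \<Rightarrow> 'c::comm_monoid_add"
  by (induction A rule: infinite_finite_induct) auto

lemma galg_expand:
  assumes "f \<in> galg_carrier n"
  shows "f = (\<Sum>g\<in>sym_group n. galg_scale (f g) (galg_basis g))"
proof
  fix x
  have "(\<Sum>g\<in>sym_group n. galg_scale (f g) (galg_basis g)) x = (\<Sum>g\<in>sym_group n. if x = g then f g else 0)"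
    unfolding sum_fun_apply by (intro sum.cong refl) (auto simp: galg_scale_def galg_basis_def)
  then show "f x = (\<Sum>g\<in>sym_group n. galg_scale (f g) (galg_basis g)) x"
    using assms by (simp add: galg_carrier_def)
qed

text \<open>The right-hand side is the trace of \<open>T P\<close> on the whole group algebra in the basis of delta functions.\<close>

lemma galg_trace_projection:
  assumes V: "galg.subspace V" "V \<subseteq> galg_carrier n"
    and TV: "\<And>v. v \<in> V \<Longrightarrow> T v \<in> V" and PV: "\<And>f. f \<in> galg_carrier n \<Longrightarrow> P f \<in> V"
    and P: "\<And>v. v \<in> V \<Longrightarrow> P v = v"
    and T_lin: "\<And>(A :: galg set) a b. T (\<Sum>i\<in>A. galg_scale (a i) (b i)) = (\<Sum>i\<in>A. galg_scale (a i) (T (b i)))"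
    and P_lin: "\<And>(A :: (nat \<Rightarrow> nat) set) a b. P (\<Sum>i\<in>A. galg_scale (a i) (b i)) = (\<Sum>i\<in>A. galg_scale (a i) (P (b i)))"
  shows "galg_trace V T = (\<Sum>g\<in>sym_group n. T (P (galg_basis g)) g)"
proof -
  define B where "B = (SOME B. B \<subseteq> V \<and> galg.independent B \<and> V \<subseteq> galg.span B)"
  have "\<exists>B. B \<subseteq> V \<and> galg.independent B \<and> V \<subseteq> galg.span B"
    using galg.maximal_independent_subset[of V] by metis
  then have B: "B \<subseteq> V" "galg.independent B" "V \<subseteq> galg.span B"
    unfolding B_def by (metis (mono_tags, lifting) someI_ex)+
  \<comment> \<open>A sum over an infinite basis would default to 0. The elements of
    \<open>B\<close> lie in the span of finitely many delta functions, which makes the independent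
    set \<open>B\<close> finite.\<close>
  have "B \<subseteq> galg.span (galg_basis ` sym_group n)"
  proof
    fix b assume "b \<in> B"
    then have "b = (\<Sum>g\<in>sym_group n. galg_scale (b g) (galg_basis g))"
      using B V galg_expand by auto
    also have "\<dots> \<in> galg.span (galg_basis ` sym_group n)"
      by (intro galg.span_sum galg.span_scale galg.span_base) auto
    finally show "b \<in> galg.span (galg_basis ` sym_group n)" .
  qed
  then have finB: "finite B"
    using galg.independent_span_bound[OF _ B(2), of "galg_basis ` sym_group n"] by simp
  have basis: "galg_basis g \<in> galg_carrier n" if "g \<in> sym_group n" for g
    using that by (auto simp: galg_carrier_def galg_basis_def)
  have rep: "galg.representation B (T b) b =
      (\<Sum>g\<in>sym_group n. T b g * galg.representation B (P (galg_basis g)) b)" if "b \<in> B" for b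
  proof -
    have bV: "b \<in> V" using B(1) that by auto
    \<comment> \<open>\<open>P\<close> fixes \<open>T b\<close>, so expanding \<open>T b\<close> in
      delta functions and applying \<open>P\<close> termwise writes it through elements of
      \<open>V\<close>, whose coordinates in \<open>B\<close> are available.\<close>
    have "T b = P (\<Sum>g\<in>sym_group n. galg_scale (T b g) (galg_basis g))"
      using P[OF TV[OF bV]] galg_expand[of "T b" n] TV[OF bV] V(2) by auto
    then have "T b = (\<Sum>g\<in>sym_group n. galg_scale (T b g) (P (galg_basis g)))"
      by (simp only: P_lin)
    then have "galg.representation B (T b) b =
        galg.representation B (\<Sum>g\<in>sym_group n. galg_scale (T b g) (P (galg_basis g))) b"
      by (rule arg_cong)
    also have "\<dots> = (\<Sum>g\<in>sym_group n. T b g * galg.representation B (P (galg_basis g)) b)"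
    proof -
      have sp: "P (galg_basis g) \<in> galg.span B" if "g \<in> sym_group n" for g
        using PV[OF basis[OF that]] B(3) by auto
      have "galg.representation B (\<Sum>g\<in>sym_group n. galg_scale (T b g) (P (galg_basis g))) =
          (\<lambda>v. \<Sum>g\<in>sym_group n. galg.representation B (galg_scale (T b g) (P (galg_basis g))) v)"
        by (rule galg.representation_sum[OF B(2)]) (auto intro: galg.span_scale sp)
      then show ?thesis
        using sp by (auto simp: galg.representation_scale[OF B(2)] intro!: sum.cong)
    qed
    finally show ?thesis .
  qed
  have "galg_trace V T = (\<Sum>b\<in>B. \<Sum>g\<in>sym_group n. T b g * galg.representation B (P (galg_basis g)) b)"
    unfolding galg_trace_def B_def[symmetric] Let_def by (rule sum.cong[OF refl rep])
  also have "\<dots> = (\<Sum>g\<in>sym_group n. \<Sum>b\<in>B. galg.representation B (P (galg_basis g)) b * T b g)"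
    by (subst sum.swap) (simp add: mult.commute)
  also have "\<dots> = (\<Sum>g\<in>sym_group n. T (P (galg_basis g)) g)"
  proof (rule sum.cong[OF refl])
    fix g assume g: "g \<in> sym_group n"
    have "P (galg_basis g) \<in> galg.span B" using PV[OF basis[OF g]] B(3) by auto
    then have "(\<Sum>b\<in>B. galg_scale (galg.representation B (P (galg_basis g)) b) b) = P (galg_basis g)"
      by (intro galg.sum_representation_eq[OF B(2)]) (auto simp: finB)
    then have "T (P (galg_basis g)) = (\<Sum>b\<in>B. galg_scale (galg.representation B (P (galg_basis g)) b) (T b))"
      using T_lin[of "\<lambda>b. galg.representation B (P (galg_basis g)) b" "\<lambda>b. b" B] by simp
    then have "T (P (galg_basis g)) g = (\<Sum>b\<in>B. galg_scale (galg.representation B (P (galg_basis g)) b) (T b)) g"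
      by (rule fun_cong)
    then show "(\<Sum>b\<in>B. galg.representation B (P (galg_basis g)) b * T b g) = T (P (galg_basis g)) g"
      by (simp add: sum_fun_apply galg_scale_def)
  qed
  finally show ?thesis .
qed

lemma galg_mult_assoc: "galg_mult n (galg_mult n f g) h = galg_mult n f (galg_mult n g h)"
proof
  fix p
  have "galg_mult n (galg_mult n f g) h p =
      (\<Sum>q\<in>sym_group n. \<Sum>r\<in>sym_group n. f r * g (inv r \<circ> q) * h (inv q \<circ> p))"
    by (simp add: galg_mult_def sum_distrib_right)
  also have "\<dots> = (\<Sum>r\<in>sym_group n. \<Sum>q\<in>sym_group n. f r * g (inv r \<circ> q) * h (inv q \<circ> p))"
    by (rule sum.swap)
  also have "\<dots> = (\<Sum>r\<in>sym_group n. \<Sum>q\<in>sym_group n. f r * g q * h (inv q \<circ> (inv r \<circ> p)))"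
  proof (rule sum.cong[OF refl])
    fix r assume r: "r \<in> sym_group n"
    have "(\<Sum>q\<in>sym_group n. f r * g (inv r \<circ> q) * h (inv q \<circ> p)) =
       (\<Sum>q\<in>sym_group n. f r * g (inv r \<circ> (r \<circ> q)) * h (inv (r \<circ> q) \<circ> p))"
      by (rule sum_sym_group(1)[OF r, symmetric])
    also have "\<dots> = (\<Sum>q\<in>sym_group n. f r * g q * h (inv q \<circ> (inv r \<circ> p)))"
      using r by (intro sum.cong refl) (simp add: sym_group_inv_o[of _ n] sym_group_inv_comp[of _ n] comp_assoc)
    finally show "(\<Sum>q\<in>sym_group n. f r * g (inv r \<circ> q) * h (inv q \<circ> p)) =
       (\<Sum>q\<in>sym_group n. f r * g q * h (inv q \<circ> (inv r \<circ> p)))" .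
  qed
  also have "\<dots> = galg_mult n f (galg_mult n g h) p"
    by (simp add: galg_mult_def sum_distrib_left mult.assoc)
  finally show "galg_mult n (galg_mult n f g) h p = galg_mult n f (galg_mult n g h) p" .
qed

lemma galg_mult_carrier:
  assumes "g \<in> galg_carrier n" shows "galg_mult n f g \<in> galg_carrier n"
  unfolding galg_carrier_def
proof (intro CollectI allI impI)
  fix p assume p: "p \<notin> sym_group n"
  have "inv q \<circ> p \<notin> sym_group n" if "q \<in> sym_group n" for q
  proof
    assume "inv q \<circ> p \<in> sym_group n"
    then have "q \<circ> (inv q \<circ> p) \<in> sym_group n" using that by blast
    then show False using p by (simp add: sym_group_inv_o[OF that])
  qed
  then show "galg_mult n f g p = 0"
    using assms by (simp add: galg_mult_def galg_carrier_def)
qed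

lemma galg_mult_sum_left:
  "galg_mult n (\<Sum>i\<in>A. galg_scale (a i) (b i)) g = (\<Sum>i\<in>A. galg_scale (a i) (galg_mult n (b i) g))"
proof
  fix p
  have "galg_mult n (\<Sum>i\<in>A. galg_scale (a i) (b i)) g p = (\<Sum>q\<in>sym_group n. \<Sum>i\<in>A. a i * b i q * g (inv q \<circ> p))"
    by (simp add: galg_mult_def sum_fun_apply galg_scale_def sum_distrib_right)
  also have "\<dots> = (\<Sum>i\<in>A. galg_scale (a i) (galg_mult n (b i) g)) p"
    by (subst sum.swap) (simp add: galg_mult_def sum_fun_apply galg_scale_def sum_distrib_left mult.assoc)
  finally show "galg_mult n (\<Sum>i\<in>A. galg_scale (a i) (b i)) g p = (\<Sum>i\<in>A. galg_scale (a i) (galg_mult n (b i) g)) p" .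
qed

lemma galg_mult_sum_right:
  "galg_mult n f (\<Sum>i\<in>A. galg_scale (a i) (b i)) = (\<Sum>i\<in>A. galg_scale (a i) (galg_mult n f (b i)))"
proof
  fix p
  have "galg_mult n f (\<Sum>i\<in>A. galg_scale (a i) (b i)) p = (\<Sum>q\<in>sym_group n. \<Sum>i\<in>A. f q * (a i * b i (inv q \<circ> p)))"
    by (simp add: galg_mult_def sum_fun_apply galg_scale_def sum_distrib_left)
  also have "\<dots> = (\<Sum>i\<in>A. galg_scale (a i) (galg_mult n f (b i))) p"
    by (subst sum.swap) (simp add: galg_mult_def sum_fun_apply galg_scale_def sum_distrib_left mult.left_commute)
  finally show "galg_mult n f (\<Sum>i\<in>A. galg_scale (a i) (b i)) p = (\<Sum>i\<in>A. galg_scale (a i) (galg_mult n f (b i))) p" .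
qed

lemma galg_mult_scale_left: "galg_mult n (galg_scale a f) g = galg_scale a (galg_mult n f g)"
  by (simp add: galg_mult_def galg_scale_def fun_eq_iff sum_distrib_left mult.assoc)

lemma galg_mult_scale_right: "galg_mult n f (galg_scale a g) = galg_scale a (galg_mult n f g)"
  by (simp add: galg_mult_def galg_scale_def fun_eq_iff sum_distrib_left mult.left_commute)

lemma galg_mult_add_left: "galg_mult n (f + f') g = galg_mult n f g + galg_mult n f' g"
  by (simp add: galg_mult_def fun_eq_iff sum.distrib distrib_right)

lemma galg_mult_basis:
  assumes "p \<in> sym_group n" shows "galg_mult n (galg_basis p) f x = f (inv p \<circ> x)"
proof -
  have "galg_mult n (galg_basis p) f x = (\<Sum>q\<in>sym_group n. if q = p then f (inv q \<circ> x) else 0)"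
    unfolding galg_mult_def by (intro sum.cong refl) (auto simp: galg_basis_def)
  then show ?thesis using assms by simp
qed

section \<open>The left ideal of the symmetrizer and its character\<close>

context young_pair
begin

definition chi :: "(nat \<Rightarrow> nat) \<Rightarrow> real" where
  "chi p = (\<Sum>g\<in>sym_group n. cf (inv g \<circ> inv p \<circ> g)) / kappa"

lemma cf_convolution:
  assumes "p \<in> sym_group n"
  shows "(\<Sum>q\<in>sym_group n. cf q * cf (inv q \<circ> p)) = kappa * cf p"
proof -
  let ?h = "\<lambda>z. if z = p then 1 else 0 :: real"
  have "(\<Sum>y\<in>sym_group n. cf y * ?h (x \<circ> y)) = cf (inv x \<circ> p)" if "x \<in> sym_group n" for x
  proof -
    have "(\<Sum>y\<in>sym_group n. cf y * ?h (x \<circ> y)) = (\<Sum>y\<in>sym_group n. if y = inv x \<circ> p then cf y else 0)"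
      by (intro sum.cong refl) (simp add: sym_group_eq_iff[OF that])
    then show ?thesis using assms that by simp
  qed
  moreover have "(\<Sum>x\<in>sym_group n. cf x * ?h x) = cf p"
    using assms by (simp add: if_distrib[of "(*) _"] cong: if_cong)
  ultimately show ?thesis using cf_square[of ?h] by simp
qed

text \<open>The projection used is right multiplication by \<open>c\<close> divided by
  \<open>kappa\<close>: it maps into the ideal by construction and fixes it because of the square
  identity. The diagonal entry at \<open>g\<close> of the composite with left translation is then a
  single value of \<open>cf\<close>.\<close>

lemma trace_left_ideal:
  defines "c \<equiv> \<lambda>x. complex_of_real (cf x)"
  assumes p: "p \<in> sym_group n"
  shows "galg_trace ((\<lambda>f. galg_mult n f c) ` galg_carrier n) (galg_mult n (galg_basis p)) = of_real (chi p)"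
proof -
  let ?V = "(\<lambda>f. galg_mult n f c) ` galg_carrier n"
  define P where "P f = galg_scale (1 / of_real kappa) (galg_mult n f c)" for f
  have cC: "c \<in> galg_carrier n" by (auto simp: galg_carrier_def c_def cf_outside)
  have sc: "galg_scale a f \<in> galg_carrier n" if "f \<in> galg_carrier n" for a f
    using that by (auto simp: galg_carrier_def galg_scale_def)
  have cc: "galg_mult n c c = galg_scale (of_real kappa) c"
  proof
    fix p
    show "galg_mult n c c p = galg_scale (of_real kappa) c p"
    proof (cases "p \<in> sym_group n")
      case True
      then show ?thesis
        using cf_convolution[OF True]
        by (simp add: galg_mult_def galg_scale_def c_def flip: of_real_mult of_real_sum)
    next
      case False
      then show ?thesis using galg_mult_carrier[OF cC, of c] cC
        by (auto simp: galg_carrier_def galg_scale_def)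
    qed
  qed
  have P_V: "P f = galg_mult n (galg_scale (1 / of_real kappa) f) c" for f
    by (simp add: P_def galg_mult_scale_left)
  have "galg_trace ?V (galg_mult n (galg_basis p)) = (\<Sum>g\<in>sym_group n. galg_mult n (galg_basis p) (P (galg_basis g)) g)"
  proof (rule galg_trace_projection)
    show "galg.subspace ?V"
      unfolding galg.subspace_def
    proof (intro conjI ballI allI)
      show "0 \<in> ?V"
        by (rule image_eqI[of _ _ 0]) (auto simp: galg_carrier_def galg_mult_def)
      fix x y assume "x \<in> ?V" "y \<in> ?V"
      then obtain f g where "f \<in> galg_carrier n" "g \<in> galg_carrier n" "x = galg_mult n f c" "y = galg_mult n g c" by auto
      then show "x + y \<in> ?V"
        by (intro image_eqI[of _ _ "f + g"]) (auto simp: galg_carrier_def galg_mult_add_left)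
    next
      fix a x assume "x \<in> ?V"
      then obtain f where "f \<in> galg_carrier n" "x = galg_mult n f c" by auto
      then show "galg_scale a x \<in> ?V"
        by (intro image_eqI[of _ _ "galg_scale a f"]) (auto simp: sc galg_mult_scale_left)
    qed
    show "?V \<subseteq> galg_carrier n" using galg_mult_carrier[OF cC] by auto
    show "galg_mult n (galg_basis p) v \<in> ?V" if "v \<in> ?V" for v
      using that galg_mult_carrier by (auto simp flip: galg_mult_assoc)
    show "P f \<in> ?V" if "f \<in> galg_carrier n" for f
      using that sc by (auto simp: P_V)
    show "P v = v" if v: "v \<in> ?V" for v
    proof -
      obtain f where "v = galg_mult n f c" using v by auto
      then show ?thesis using kappa_nonzero
        by (simp add: P_def galg_mult_assoc cc galg_mult_scale_right)
    qed
    show "galg_mult n (galg_basis p) (\<Sum>i\<in>A. galg_scale (a i) (b i)) =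
        (\<Sum>i\<in>A. galg_scale (a i) (galg_mult n (galg_basis p) (b i)))" for A :: "galg set" and a b
      by (rule galg_mult_sum_right)
    show "P (\<Sum>i\<in>A. galg_scale (a i) (b i)) = (\<Sum>i\<in>A. galg_scale (a i) (P (b i)))"
      for A :: "(nat \<Rightarrow> nat) set" and a b
      by (simp add: P_def galg_mult_sum_left) (simp add: fun_eq_iff sum_fun_apply galg_scale_def sum_divide_distrib)
  qed
  also have "\<dots> = (\<Sum>g\<in>sym_group n. c (inv g \<circ> (inv p \<circ> g)) / of_real kappa)"
    by (intro sum.cong refl) (simp add: galg_mult_basis[of _ n] p P_def galg_scale_def)
  also have "\<dots> = of_real (chi p)"
    by (simp add: chi_def c_def comp_assoc sum_divide_distrib)
  finally show ?thesis .
qed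

lemma chi_conj:
  assumes "h \<in> sym_group n" "p \<in> sym_group n"
  shows "chi (h \<circ> p \<circ> inv h) = chi p"
proof -
  have "(\<Sum>g\<in>sym_group n. cf (inv g \<circ> inv (h \<circ> p \<circ> inv h) \<circ> g)) =
      (\<Sum>g\<in>sym_group n. cf (inv (inv h \<circ> g) \<circ> inv p \<circ> (inv h \<circ> g)))"
    using assms by (intro sum.cong refl) (simp add: sym_group_inv_comp[of _ n] sym_group_inv_o[of _ n] comp_assoc)
  also have "\<dots> = (\<Sum>g\<in>sym_group n. cf (inv g \<circ> inv p \<circ> g))"
    using sum_sym_group(1)[of "inv h" n "\<lambda>g. cf (inv g \<circ> inv p \<circ> g)"] assms by auto
  finally show ?thesis by (simp add: chi_def)
qed

lemma chi_pair:
  assumes "\<And>g p. g \<in> sym_group n \<Longrightarrow> p \<in> sym_group n \<Longrightarrow> \<phi> (g \<circ> p \<circ> inv g) = \<phi> p"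
  shows "(\<Sum>p\<in>sym_group n. \<phi> p * chi p) = fact n / kappa * (\<Sum>p\<in>sym_group n. \<phi> p * cf (inv p))"
proof -
  have "(\<Sum>p\<in>sym_group n. \<phi> p * chi p) =
      (\<Sum>g\<in>sym_group n. \<Sum>p\<in>sym_group n. \<phi> p * cf (inv g \<circ> inv p \<circ> g)) / kappa"
    by (subst sum.swap) (simp add: chi_def sum_divide_distrib sum_distrib_left)
  also have "(\<Sum>g\<in>sym_group n. \<Sum>p\<in>sym_group n. \<phi> p * cf (inv g \<circ> inv p \<circ> g)) =
      (\<Sum>g\<in>sym_group n. \<Sum>p\<in>sym_group n. \<phi> p * cf (inv p))"
  proof (rule sum.cong[OF refl])
    fix g assume g: "g \<in> sym_group n"
    have "(\<Sum>p\<in>sym_group n. \<phi> p * cf (inv g \<circ> inv p \<circ> g)) =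
      (\<Sum>p\<in>sym_group n. \<phi> (g \<circ> p \<circ> inv g) * cf (inv g \<circ> inv (g \<circ> p \<circ> inv g) \<circ> g))"
      by (rule sum_sym_group_conj[OF g, symmetric])
    also have "\<dots> = (\<Sum>p\<in>sym_group n. \<phi> p * cf (inv p))"
      using g assms by (intro sum.cong refl) (simp add: sym_group_inv_comp[of _ n] sym_group_inv_o[of _ n] comp_assoc)
    finally show "(\<Sum>p\<in>sym_group n. \<phi> p * cf (inv g \<circ> inv p \<circ> g)) = (\<Sum>p\<in>sym_group n. \<phi> p * cf (inv p))" .
  qed
  finally show ?thesis by (simp add: card_sym_group)
qed

text \<open>Two factors 1 / \<open>kappa\<close>, one from \<open>chi_pair\<close> and one from the
  definition of \<open>chi\<close>, cancel the square of \<open>kappa\<close> in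
  \<open>cf_conj_norm\<close>.\<close>

lemma chi_norm: "(\<Sum>p\<in>sym_group n. chi p * chi p) = fact n"
proof -
  have "(\<Sum>p\<in>sym_group n. chi p * chi p) = fact n / kappa * (\<Sum>p\<in>sym_group n. chi p * cf (inv p))"
    by (rule chi_pair) (rule chi_conj)
  also have "(\<Sum>p\<in>sym_group n. chi p * cf (inv p)) =
      (\<Sum>p\<in>sym_group n. \<Sum>g\<in>sym_group n. cf (inv g \<circ> inv p \<circ> g) * cf (inv p)) / kappa"
    by (simp add: chi_def sum_distrib_right sum_divide_distrib)
  also have "(\<Sum>p\<in>sym_group n. \<Sum>g\<in>sym_group n. cf (inv g \<circ> inv p \<circ> g) * cf (inv p)) =
      (\<Sum>p\<in>sym_group n. \<Sum>g\<in>sym_group n. cf (inv g \<circ> p \<circ> g) * cf p)"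
    by (rule sum_sym_group(3))
  also have "\<dots> = kappa * kappa"
    by (subst sum.swap) (rule cf_conj_norm)
  finally show ?thesis using kappa_nonzero by simp
qed

text \<open>Right translation by \<open>t\<close> permutes \<open>H\<close> and reverses the sign of
  \<open>cf\<close>. It is applied to the stabilizer of a colouring that takes equal values on two
  entries of one column, with \<open>t\<close> their transposition.\<close>

lemma sum_cf_subgroup_zero:
  assumes H: "perm_subgroup n H" and t: "t \<in> H" "t \<in> C" "sign t = -1"
  shows "(\<Sum>p\<in>H. cf p) = 0"
proof -
  have "(\<Sum>p\<in>H. cf p) = (\<Sum>p\<in>H. cf (p \<circ> t))"
    by (rule sum_perm_subgroup(2)[OF H t(1), symmetric])
  also have "\<dots> = - (\<Sum>p\<in>H. cf p)"
    using t by (simp add: cf_right sum_negf)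
  finally show ?thesis by simp
qed

text \<open>The sets of conjugates summed here are the stabilizers of the colourings
  \<open>tab_row l \<circ> s\<close>, the only ones that contribute to the leading word
  character.\<close>

lemma sum_cf_conj_R:
  "(\<Sum>s\<in>C. \<Sum>r\<in>R. cf (inv s \<circ> r \<circ> s)) = kappa"
proof -
  have "(\<Sum>s\<in>C. \<Sum>r\<in>R. cf (inv s \<circ> r \<circ> s)) = (\<Sum>s\<in>C. \<Sum>r\<in>R. rsgn (inv s) * cf (inv s \<circ> r))"
    by (intro sum.cong refl) (use CD(1) in \<open>simp add: cf_right rsgn_inv[of _ n]\<close>)
  also have "\<dots> = kappa" unfolding kappa_def by (rule sumC(3))
  finally show ?thesis .
qed

end

section \<open>Pairing the Specht character with colourings\<close>

definition colourings :: "nat \<Rightarrow> nat \<Rightarrow> (nat \<Rightarrow> nat) set" where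
  "colourings n k = {..<n} \<rightarrow>\<^sub>E {..<k}"

definition content :: "nat \<Rightarrow> (nat \<Rightarrow> 'a) \<Rightarrow> 'a \<Rightarrow> nat" where
  "content n f i = card {x. x < n \<and> f x = i}"

definition specht_char :: "nat list \<Rightarrow> (nat \<Rightarrow> nat) \<Rightarrow> real" where
  "specht_char l = young_pair.chi (sum_list l) (row_group l) (col_group l)"

lemma finite_colourings [simp]: "finite (colourings n k)"
  by (simp add: colourings_def finite_PiE)

lemma stabilizer_cong:
  assumes "\<And>x. x < n \<Longrightarrow> f x = g x"
  shows "stabilizer n f = stabilizer n g"
proof -
  have "p x < n" if "p \<in> sym_group n" "x < n" for p x
    using permutes_in_image[OF sym_groupD(1)[OF that(1)], of x] that(2) by simp
  then have "p \<in> stabilizer n f \<longleftrightarrow> p \<in> stabilizer n g" if "p \<in> sym_group n" for p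
    using that assms by (simp add: stabilizer_iff)
  then show ?thesis by (auto simp: stabilizer_def)
qed

lemma stabilizer_comp:
  assumes s: "s \<in> sym_group n"
  shows "stabilizer n (f \<circ> s) = (\<lambda>r. inv s \<circ> r \<circ> s) ` stabilizer n f"
proof (intro equalityI subsetI)
  fix p assume "p \<in> stabilizer n (f \<circ> s)"
  then have p: "p \<in> sym_group n" "f \<circ> s \<circ> p = f \<circ> s" by (auto simp: stabilizer_def)
  have "f \<circ> (s \<circ> p \<circ> inv s) = f \<circ> s \<circ> p \<circ> inv s" by (simp add: comp_assoc)
  also have "\<dots> = f" unfolding p(2) by (simp add: comp_assoc sym_group_inv_o[OF s])
  finally have "s \<circ> p \<circ> inv s \<in> stabilizer n f" using p s by (auto simp: stabilizer_def)
  then show "p \<in> (\<lambda>r. inv s \<circ> r \<circ> s) ` stabilizer n f"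
    by (rule image_eqI[rotated]) (simp add: comp_assoc sym_group_inv_o[OF s])
next
  fix p assume "p \<in> (\<lambda>r. inv s \<circ> r \<circ> s) ` stabilizer n f"
  then obtain r where r: "r \<in> sym_group n" "f \<circ> r = f" "p = inv s \<circ> r \<circ> s" by (auto simp: stabilizer_def)
  have "f \<circ> s \<circ> p = f \<circ> r \<circ> s" by (simp add: r(3) comp_assoc sym_group_inv_o[OF s])
  then show "p \<in> stabilizer n (f \<circ> s)" using r s by (auto simp: stabilizer_def)
qed

lemma content_comp:
  assumes s: "s \<in> sym_group n"
  shows "content n (f \<circ> s) i = content n f i"
proof -
  note perm = sym_groupD(1)[OF s]
  have "y \<in> s ` {x. x < n \<and> f (s x) = i}" if "y < n" "f y = i" for y
    using that permutes_in_image[OF permutes_inv[OF perm], of y] permutes_inverses(1)[OF perm, of y]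
    by (auto intro!: image_eqI[of _ _ "inv s y"])
  then have "s ` {x. x < n \<and> f (s x) = i} = {x. x < n \<and> f x = i}"
    using permutes_in_image[OF perm] by auto
  then show ?thesis
    using card_image[OF inj_on_subset[OF sym_groupD(4)[OF s]], of "{x. x < n \<and> f (s x) = i}"]
    by (simp add: content_def)
qed

context
  fixes l :: "nat list" and n :: nat
  assumes l: "l \<in> partitions_of n"
begin

interpretation young_pair n "row_group l" "col_group l"
  by (rule young_pair_groups[OF l])

lemma young_symmetrizer_cf: "young_symmetrizer l x = complex_of_real (cf x)"
proof -
  have sub: "row_group l \<subseteq> sym_group n" "col_group l \<subseteq> sym_group n" using RD CD by auto
  have "cf x = (\<Sum>r\<in>row_group l. if inv r \<circ> x \<in> col_group l then rsgn (inv r \<circ> x) else 0)"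
    unfolding cf_def
  proof (rule sum.cong[OF refl])
    fix r assume r: "r \<in> row_group l"
    have "(\<Sum>q\<in>col_group l. if r \<circ> q = x then rsgn q else 0) = (\<Sum>q\<in>col_group l. if q = inv r \<circ> x then rsgn q else 0)"
      by (intro sum.cong refl) (simp add: sym_group_eq_iff[OF RD(1)[OF r]])
    then show "(\<Sum>q\<in>col_group l. if r \<circ> q = x then rsgn q else 0) = (if inv r \<circ> x \<in> col_group l then rsgn (inv r \<circ> x) else 0)"
      using CD(5) by simp
  qed
  also have "\<dots> = (\<Sum>r\<in>sym_group n. if r \<in> row_group l then (if inv r \<circ> x \<in> col_group l then rsgn (inv r \<circ> x) else 0) else 0)"
    using sub by (simp add: sum.inter_restrict[symmetric] Int_absorb1)
  finally show ?thesis
    unfolding young_symmetrizer_def galg_mult_def size_l[OF l] by (auto intro!: sum.cong)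
qed

lemma irr_char_specht:
  assumes "p \<in> sym_group n" shows "irr_char l p = of_real (specht_char l p)"
proof -
  have "young_symmetrizer l = (\<lambda>x. complex_of_real (cf x))" using young_symmetrizer_cf by auto
  then show ?thesis
    using trace_left_ideal[OF assms] by (simp add: irr_char_def specht_module_def specht_char_def size_l[OF l])
qed

lemma specht_char_norm: "(\<Sum>p\<in>sym_group n. specht_char l p * specht_char l p) = fact n"
  using chi_norm by (simp add: specht_char_def size_l[OF l])

text \<open>A colouring with too many small colours violates the bound for column-injective ones, so
  it repeats a colour in some column; the transposition of the two entries annihilates the
  sum.\<close>

lemma sum_cf_stabilizer_zero:
  assumes "(\<Sum>i<t. content n f i) > (\<Sum>i<t. row_len l i)"
  shows "(\<Sum>p\<in>stabilizer n f. cf p) = 0"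
proof -
  have "\<not> (\<forall>x y. x < n \<longrightarrow> y < n \<longrightarrow> x \<noteq> y \<longrightarrow> tab_col l x = tab_col l y \<longrightarrow> f x \<noteq> f y)"
    using column_injective_dominated[OF l, of f t] assms card_below_eq_sum[OF l, of f t]
    by (auto simp: content_def)
  then obtain x y where xy: "x < n" "y < n" "x \<noteq> y" "tab_col l x = tab_col l y" "f x = f y" by blast
  show ?thesis
    by (rule sum_cf_subgroup_zero[OF perm_subgroup_stabilizer, of "transpose x y"])
       (use xy transpose_in_stabilizer[OF l, of x y] in \<open>auto simp: col_group_stabilizer size_l[OF l] sign_swap_id\<close>)
qed

text \<open>The column-injective colourings with the row lengths as contents are exactly the
  \<open>tab_row l \<circ> s\<close> with \<open>s\<close> in the column group, and different
  \<open>s\<close> give different colourings. All others are annihilated by a transposition.\<close>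

lemma sum_cf_stabilizer_kappa:
  assumes k: "length l \<le> k"
  shows "(\<Sum>f | f \<in> colourings n k \<and> (\<forall>i<k. content n f i = row_len l i). \<Sum>p\<in>stabilizer n f. cf p) = kappa"
proof -
  define A where "A = {f \<in> colourings n k. \<forall>i<k. content n f i = row_len l i}"
  define \<rho> where "\<rho> s = restrict (tab_row l \<circ> s) {..<n}" for s
  have sn: "s x < n" if "s \<in> col_group l" "x < n" for s x
    using permutes_in_image[OF sym_groupD(1)[OF CD(1)[OF that(1)]], of x] that by simp
  have sub: "\<rho> ` col_group l \<subseteq> A"
  proof
    fix f assume "f \<in> \<rho> ` col_group l"
    then obtain s where s: "s \<in> col_group l" "f = \<rho> s" by auto
    have "tab_row l (s x) < k" if "x < n" for x
      using tab_position(1)[of "s x" l] sn[OF s(1) that] k by (simp add: size_l[OF l])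
    then have "f \<in> colourings n k"
      by (auto simp: s(2) \<rho>_def colourings_def)
    moreover have "content n f i = row_len l i" for i
    proof -
      have "content n f i = content n (tab_row l \<circ> s) i"
        unfolding content_def by (rule arg_cong[where f = card]) (auto simp: s(2) \<rho>_def)
      also have "\<dots> = row_len l i"
        using content_comp[OF CD(1)[OF s(1)], of "tab_row l" i] tab_row_count[OF l, of i] by (simp add: content_def)
      finally show ?thesis .
    qed
    ultimately show "f \<in> A" by (simp add: A_def)
  qed
  have inj: "inj_on \<rho> (col_group l)"
  proof (rule inj_onI)
    fix s s' assume s: "s \<in> col_group l" "s' \<in> col_group l" and eq: "\<rho> s = \<rho> s'"
    show "s = s'"
    proof
      fix x
      show "s x = s' x"
      proof (cases "x < n")
        case True
        then have "tab_row l (s x) = tab_row l (s' x)" using fun_cong[OF eq, of x] by (simp add: \<rho>_def)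
        then show ?thesis
          using s True sn row_col_unique[OF l, of "s x" "s' x"] by (simp add: col_group_def size_l[OF l])
      next
        case False
        then show ?thesis using sym_groupD(1)[OF CD(1)[OF s(1)]] sym_groupD(1)[OF CD(1)[OF s(2)]]
          by (auto simp: permutes_def)
      qed
    qed
  qed
  have "(\<Sum>p\<in>stabilizer n f. cf p) = 0" if f: "f \<in> A - \<rho> ` col_group l" for f
  proof (cases "\<forall>x y. x < n \<longrightarrow> y < n \<longrightarrow> x \<noteq> y \<longrightarrow> tab_col l x = tab_col l y \<longrightarrow> f x \<noteq> f y")
    case True
    have "content n f i = row_len l i" for i
    proof (cases "i < k")
      case False
      then have "{x. x < n \<and> f x = i} = {}" using f by (auto simp: A_def colourings_def)
      then show ?thesis using False k by (simp add: content_def row_len_def)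
    qed (use f in \<open>simp add: A_def\<close>)
    then have "card {x. x < n \<and> f x < k} = (\<Sum>i<k. row_len l i)" for k
      using card_below_eq_sum[OF l, of f k] by (simp add: content_def)
    then obtain s where s: "s \<in> col_group l" "\<And>x. x < n \<Longrightarrow> f x = tab_row l (s x)"
      using column_injective_rows[OF l, of f] True by metis
    have "f = \<rho> s"
    proof
      fix x show "f x = \<rho> s x"
        using f s(2)[of x] by (cases "x < n") (auto simp: \<rho>_def A_def colourings_def PiE_def extensional_def)
    qed
    then show ?thesis using f s(1) by auto
  next
    case False
    then obtain x y where xy: "x < n" "y < n" "x \<noteq> y" "tab_col l x = tab_col l y" "f x = f y" by blast
    show ?thesis
      by (rule sum_cf_subgroup_zero[OF perm_subgroup_stabilizer, of "transpose x y"])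
         (use xy transpose_in_stabilizer[OF l, of x y] in \<open>auto simp: col_group_stabilizer size_l[OF l] sign_swap_id\<close>)
  qed
  then have "(\<Sum>f\<in>A. \<Sum>p\<in>stabilizer n f. cf p) = (\<Sum>f\<in>\<rho> ` col_group l. \<Sum>p\<in>stabilizer n f. cf p)"
    using sub by (intro sum.mono_neutral_right) (auto simp: A_def)
  also have "\<dots> = (\<Sum>s\<in>col_group l. \<Sum>p\<in>stabilizer n (\<rho> s). cf p)"
    by (simp add: sum.reindex[OF inj])
  also have "\<dots> = (\<Sum>s\<in>col_group l. \<Sum>r\<in>row_group l. cf (inv s \<circ> r \<circ> s))"
  proof (rule sum.cong[OF refl])
    fix s assume s: "s \<in> col_group l"
    note sG = CD(1)[OF s]
    have "stabilizer n (\<rho> s) = (\<lambda>r. inv s \<circ> r \<circ> s) ` row_group l"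
      using stabilizer_cong[of n "\<rho> s" "tab_row l \<circ> s"] stabilizer_comp[OF sG, of "tab_row l"]
      by (simp add: \<rho>_def row_group_stabilizer size_l[OF l])
    moreover have "inj_on (\<lambda>r. inv s \<circ> r \<circ> s) (row_group l)"
      using sG by (auto simp: inj_on_def sym_group_cancel[of _ n] comp_assoc)
    ultimately show "(\<Sum>p\<in>stabilizer n (\<rho> s). cf p) = (\<Sum>r\<in>row_group l. cf (inv s \<circ> r \<circ> s))"
      by (simp add: sum.reindex)
  qed
  also have "\<dots> = kappa" by (rule sum_cf_conj_R)
  finally show ?thesis by (simp add: A_def)
qed

text \<open>Here \<phi> is a combination of permutation characters on words, and every content other
  than the leading one overshoots the shape in some partial sum, so only \<open>w0\<close> survives.
  The contents are integers because the values \<lambda>_i - i + w(i) used later can be negative; no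
  word has such a content.\<close>

lemma specht_char_pair_words:
  fixes W :: "'b set" and c :: "'b \<Rightarrow> real" and \<alpha> :: "'b \<Rightarrow> nat \<Rightarrow> int" and k :: nat
  defines "\<phi> \<equiv> \<lambda>p. \<Sum>w\<in>W. c w * card {f \<in> colourings n k. f \<circ> p = f \<and> (\<forall>i<k. int (content n f i) = \<alpha> w i)}"
  assumes k: "length l \<le> k" and W: "finite W" "w0 \<in> W" "c w0 = 1"
    and w0: "\<And>i. i < k \<Longrightarrow> \<alpha> w0 i = int (row_len l i)"
    and dom: "\<And>w. w \<in> W \<Longrightarrow> w \<noteq> w0 \<Longrightarrow> \<exists>t\<le>k. (\<Sum>i<t. \<alpha> w i) > (\<Sum>i<t. int (row_len l i))"
    and cl: "\<And>g p. g \<in> sym_group n \<Longrightarrow> p \<in> sym_group n \<Longrightarrow> \<phi> (g \<circ> p \<circ> inv g) = \<phi> p"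
  shows "(\<Sum>p\<in>sym_group n. \<phi> p * specht_char l p) = fact n"
proof -
  define A where "A w = {f \<in> colourings n k. \<forall>i<k. int (content n f i) = \<alpha> w i}" for w
  have finA: "finite (A w)" for w by (simp add: A_def)
  have \<phi>: "\<phi> p = (\<Sum>w\<in>W. c w * (\<Sum>f\<in>A w. if f \<circ> p = f then 1 else 0))" for p
  proof -
    have "real (card {f \<in> colourings n k. f \<circ> p = f \<and> (\<forall>i<k. int (content n f i) = \<alpha> w i)}) =
       (\<Sum>f\<in>A w. if f \<circ> p = f then 1 else 0)" for w
    proof -
      have "{f \<in> colourings n k. f \<circ> p = f \<and> (\<forall>i<k. int (content n f i) = \<alpha> w i)} = {f \<in> A w. f \<circ> p = f}"
        by (auto simp: A_def)
      then show ?thesis using finA by (simp add: sum.inter_filter[symmetric])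
    qed
    then show ?thesis by (simp add: \<phi>_def)
  qed
  have "(\<Sum>p\<in>sym_group n. \<phi> p * cf (inv p)) = (\<Sum>w\<in>W. c w * (\<Sum>f\<in>A w. \<Sum>p\<in>stabilizer n f. cf p))"
  proof -
    have inner: "(\<Sum>p\<in>sym_group n. (if f \<circ> p = f then 1 else 0) * cf (inv p)) = (\<Sum>p\<in>stabilizer n f. cf p)" for f
    proof -
      have "(\<Sum>p\<in>sym_group n. (if f \<circ> p = f then 1 else 0) * cf (inv p)) = (\<Sum>p\<in>stabilizer n f. cf (inv p))"
        unfolding stabilizer_def by (auto simp: sum.inter_filter intro!: sum.cong)
      then show ?thesis by (simp add: sum_perm_subgroup(3)[OF perm_subgroup_stabilizer])
    qed
    have "(\<Sum>p\<in>sym_group n. \<phi> p * cf (inv p)) =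
       (\<Sum>p\<in>sym_group n. \<Sum>w\<in>W. \<Sum>f\<in>A w. c w * ((if f \<circ> p = f then 1 else 0) * cf (inv p)))"
      by (simp add: \<phi> sum_distrib_left sum_distrib_right mult.assoc)
    also have "\<dots> = (\<Sum>w\<in>W. \<Sum>p\<in>sym_group n. \<Sum>f\<in>A w. c w * ((if f \<circ> p = f then 1 else 0) * cf (inv p)))"
      by (rule sum.swap)
    also have "\<dots> = (\<Sum>w\<in>W. \<Sum>f\<in>A w. \<Sum>p\<in>sym_group n. c w * ((if f \<circ> p = f then 1 else 0) * cf (inv p)))"
      by (rule sum.cong[OF refl], rule sum.swap)
    also have "\<dots> = (\<Sum>w\<in>W. c w * (\<Sum>f\<in>A w. \<Sum>p\<in>stabilizer n f. cf p))"
      by (simp only: inner flip: sum_distrib_left)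
    finally show ?thesis .
  qed
  also have "\<dots> = (\<Sum>w\<in>W. if w = w0 then kappa else 0)"
  proof (rule sum.cong[OF refl])
    fix w assume w: "w \<in> W"
    show "c w * (\<Sum>f\<in>A w. \<Sum>p\<in>stabilizer n f. cf p) = (if w = w0 then kappa else 0)"
    proof (cases "w = w0")
      case True
      have "A w = {f. f \<in> colourings n k \<and> (\<forall>i<k. content n f i = row_len l i)}"
        using w0 by (auto simp: A_def True)
      then show ?thesis using sum_cf_stabilizer_kappa[OF k] W by (simp add: True)
    next
      case False
      then obtain t where t: "t \<le> k" "(\<Sum>i<t. \<alpha> w i) > (\<Sum>i<t. int (row_len l i))" using dom[OF w] by auto
      have "(\<Sum>p\<in>stabilizer n f. cf p) = 0" if f: "f \<in> A w" for f
      proof (rule sum_cf_stabilizer_zero[of t])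
        have "(\<Sum>i<t. \<alpha> w i) = (\<Sum>i<t. int (content n f i))"
          using f t(1) by (intro sum.cong refl) (auto simp: A_def)
        then have "int (\<Sum>i<t. row_len l i) < int (\<Sum>i<t. content n f i)" using t(2) by simp
        then show "(\<Sum>i<t. row_len l i) < (\<Sum>i<t. content n f i)" by linarith
      qed
      then show ?thesis using False by simp
    qed
  qed
  also have "\<dots> = kappa" using W by simp
  finally have "(\<Sum>p\<in>sym_group n. \<phi> p * cf (inv p)) = kappa" .
  moreover have "(\<Sum>p\<in>sym_group n. \<phi> p * specht_char l p) = fact n / kappa * (\<Sum>p\<in>sym_group n. \<phi> p * cf (inv p))"
    unfolding specht_char_def size_l[OF l] by (rule chi_pair) (rule cl)
  ultimately show ?thesis using kappa_nonzero by simp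
qed

end

section \<open>Orbit counting for colourings\<close>

lemma equal_content_conjugate:
  fixes F F' :: "nat \<Rightarrow> 'a"
  assumes F: "F \<in> {..<n} \<rightarrow>\<^sub>E X" "F' \<in> {..<n} \<rightarrow>\<^sub>E X" and eq: "\<And>x. x \<in> X \<Longrightarrow> content n F x = content n F' x"
  obtains g where "g \<in> sym_group n" "F = F' \<circ> g"
proof -
  have "image_mset F (mset_set {..<n}) = image_mset F' (mset_set {..<n})"
  proof (rule multiset_eqI)
    fix x
    have cnt: "count (image_mset G (mset_set {..<n})) x = content n G x" for G :: "nat \<Rightarrow> 'a"
      by (simp add: count_image_mset content_def) (rule arg_cong[where f = card], auto)
    have "content n G x = 0" if "x \<notin> X" "G \<in> {..<n} \<rightarrow>\<^sub>E X" for G :: "nat \<Rightarrow> 'a"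
      using that by (auto simp: content_def card_eq_0_iff)
    then show "count (image_mset F (mset_set {..<n})) x = count (image_mset F' (mset_set {..<n})) x"
      using F eq by (cases "x \<in> X") (auto simp: cnt)
  qed
  from image_mset_eq_implies_permutes[OF _ this] obtain g
    where g: "g permutes {..<n}" "\<forall>x\<in>{..<n}. F x = F' (g x)" by auto
  have "F = F' \<circ> g"
  proof
    fix x
    show "F x = (F' \<circ> g) x"
    proof (cases "x < n")
      case False
      then have "g x = x" using g(1) by (auto simp: permutes_def)
      then show ?thesis using False F by (auto simp: PiE_def extensional_def)
    qed (use g in auto)
  qed
  then show ?thesis using g(1) that by (auto simp: sym_group_def)
qed

lemma compose_colouring:
  assumes "F \<in> {..<n} \<rightarrow>\<^sub>E X" "g \<in> sym_group n"
  shows "F \<circ> g \<in> {..<n} \<rightarrow>\<^sub>E X"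
proof -
  have g: "g permutes {..<n}" using assms(2) by (simp add: sym_group_def)
  show ?thesis
    using assms(1) permutes_in_image[OF g] permutes_not_in[OF g]
    by (auto simp: PiE_def Pi_def extensional_def)
qed

text \<open>Frobenius reciprocity in counting form. The colourings with the contents of
  \<open>F0\<close> form one orbit under composition, each is reached by
  \<open>card (stabilizer n F0)\<close> permutations, and conjugate stabilizers give the same sum of
  a class function.\<close>

lemma sum_stabilizer_orbit:
  fixes Y :: "(nat \<Rightarrow> nat) \<Rightarrow> real"
  assumes X: "finite X" and F0: "F0 \<in> {..<n} \<rightarrow>\<^sub>E X"
    and Y: "\<And>g p. g \<in> sym_group n \<Longrightarrow> p \<in> sym_group n \<Longrightarrow> Y (g \<circ> p \<circ> inv g) = Y p"
  shows "(\<Sum>F | F \<in> {..<n} \<rightarrow>\<^sub>E X \<and> (\<forall>x\<in>X. content n F x = content n F0 x). \<Sum>p\<in>stabilizer n F. Y p) *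
      card (stabilizer n F0) = fact n * (\<Sum>p\<in>stabilizer n F0. Y p)"
proof -
  define O' where "O' = {F \<in> {..<n} \<rightarrow>\<^sub>E X. \<forall>x\<in>X. content n F x = content n F0 x}"
  have finO: "finite O'" using X by (simp add: O'_def finite_PiE)
  have in_O: "(\<lambda>g. F0 \<circ> g) ` sym_group n \<subseteq> O'"
    using compose_colouring[OF F0] content_comp[of _ n F0] by (auto simp: O'_def)
  have fibre: "card {g \<in> sym_group n. F0 \<circ> g = F} = card (stabilizer n F0)" if "F \<in> O'" for F
  proof -
    obtain h where h: "h \<in> sym_group n" "F = F0 \<circ> h"
      using equal_content_conjugate[of F n X F0] F0 \<open>F \<in> O'\<close> by (auto simp: O'_def)
    have "(\<lambda>r. r \<circ> h) ` stabilizer n F0 = {g \<in> sym_group n. F0 \<circ> g = F}"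
    proof (intro equalityI subsetI)
      fix g assume "g \<in> (\<lambda>r. r \<circ> h) ` stabilizer n F0"
      then show "g \<in> {g \<in> sym_group n. F0 \<circ> g = F}"
        using h by (auto simp: stabilizer_def simp flip: comp_assoc)
    next
      fix g assume g: "g \<in> {g \<in> sym_group n. F0 \<circ> g = F}"
      have "F0 \<circ> (g \<circ> inv h) = F0 \<circ> h \<circ> inv h" using g h by (simp flip: comp_assoc)
      then have "g \<circ> inv h \<in> stabilizer n F0"
        using g h by (auto simp: stabilizer_def comp_assoc sym_group_inv_o[OF h(1)])
      then show "g \<in> (\<lambda>r. r \<circ> h) ` stabilizer n F0"
        by (rule image_eqI[rotated]) (simp add: comp_assoc sym_group_inv_o[OF h(1)])
    qed
    moreover have "inj_on (\<lambda>r. r \<circ> h) (stabilizer n F0)"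
      using h(1) by (auto simp: inj_on_def sym_group_cancel(2)[of h n])
    ultimately show ?thesis by (metis card_image)
  qed
  have "(\<Sum>g\<in>sym_group n. \<Sum>p\<in>stabilizer n (F0 \<circ> g). Y p) =
      (\<Sum>F\<in>O'. \<Sum>g\<in>{g \<in> sym_group n. F0 \<circ> g = F}. \<Sum>p\<in>stabilizer n (F0 \<circ> g). Y p)"
    by (rule sum.group[OF _ finO in_O, symmetric]) simp
  also have "\<dots> = (\<Sum>F\<in>O'. \<Sum>g\<in>{g \<in> sym_group n. F0 \<circ> g = F}. \<Sum>p\<in>stabilizer n F. Y p)"
    by (intro sum.cong refl) auto
  also have "\<dots> = (\<Sum>F\<in>O'. \<Sum>p\<in>stabilizer n F. Y p) * card (stabilizer n F0)"
    unfolding sum_distrib_right[of _ O'] using fibre by (intro sum.cong refl) simp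
  finally have 1: "(\<Sum>g\<in>sym_group n. \<Sum>p\<in>stabilizer n (F0 \<circ> g). Y p) =
      (\<Sum>F\<in>O'. \<Sum>p\<in>stabilizer n F. Y p) * card (stabilizer n F0)" .
  have "(\<Sum>p\<in>stabilizer n (F0 \<circ> g). Y p) = (\<Sum>r\<in>stabilizer n F0. Y r)" if g: "g \<in> sym_group n" for g
  proof -
    have "inj_on (\<lambda>r. inv g \<circ> r \<circ> g) (stabilizer n F0)"
      using g by (auto simp: inj_on_def sym_group_cancel[of _ n] comp_assoc)
    then have "(\<Sum>p\<in>stabilizer n (F0 \<circ> g). Y p) = (\<Sum>r\<in>stabilizer n F0. Y (inv g \<circ> r \<circ> g))"
      by (simp add: stabilizer_comp[OF g] sum.reindex)
    also have "\<dots> = (\<Sum>r\<in>stabilizer n F0. Y r)"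
      using Y[of "inv g"] g by (intro sum.cong refl) (auto simp: stabilizer_def sym_group_inv_o[of _ n])
    finally show ?thesis .
  qed
  then show ?thesis using 1 by (simp add: card_sym_group O'_def)
qed

lemma exists_content:
  assumes "finite X" "(\<Sum>x\<in>X. m x) = n"
  obtains F where "F \<in> {..<n} \<rightarrow>\<^sub>E X" "\<And>x. x \<in> X \<Longrightarrow> content n F x = m x"
proof -
  define M where "M = (\<Sum>x\<in>X. replicate_mset (m x) x)"
  have count: "count M x = (if x \<in> X then m x else 0)" for x
    using assms(1) by (simp add: M_def count_sum)
  have size: "size M = n" using assms by (simp add: M_def size_multiset_sum)
  obtain xs where xs: "mset xs = M" using ex_mset by blast
  have len: "length xs = n" using size xs by (metis size_mset)
  have set: "set xs \<subseteq> X" using xs count by (metis count_eq_zero_iff set_mset_mset subsetI)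
  have cont: "content n (restrict (nth xs) {..<n}) x = m x" if "x \<in> X" for x
  proof -
    have "content n (restrict (nth xs) {..<n}) x = card {i. i < length xs \<and> xs ! i = x}"
      unfolding content_def by (rule arg_cong[where f = card]) (auto simp: len)
    also have "\<dots> = count (mset xs) x"
      by (simp add: count_mset count_list_eq_length_filter length_filter_conv_card eq_commute)
    finally show ?thesis using xs count that by simp
  qed
  show ?thesis
    by (rule that[of "restrict (nth xs) {..<n}"]) (use set cont len nth_mem in \<open>auto intro!: restrict_PiE\<close>)
qed

text \<open>The orbit lemma for the constant function 1: the stabilizer sizes along a single orbit
  add up to the group order.\<close>

lemma burnside_content:
  assumes X: "finite X" and m: "(\<Sum>x\<in>X. m x) = n"
  shows "(\<Sum>F | F \<in> {..<n} \<rightarrow>\<^sub>E X \<and> (\<forall>x\<in>X. content n F x = m x). real (card (stabilizer n F))) = fact n"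
proof -
  obtain F0 where F0: "F0 \<in> {..<n} \<rightarrow>\<^sub>E X" "\<And>x. x \<in> X \<Longrightarrow> content n F0 x = m x"
    using exists_content[OF X m] by blast
  have "card (stabilizer n F0) > 0"
    using perm_subgroupD(2,5)[OF perm_subgroup_stabilizer[of n F0]] by (auto simp: card_gt_0_iff)
  moreover have "{F. F \<in> {..<n} \<rightarrow>\<^sub>E X \<and> (\<forall>x\<in>X. content n F x = m x)} =
      {F. F \<in> {..<n} \<rightarrow>\<^sub>E X \<and> (\<forall>x\<in>X. content n F x = content n F0 x)}"
    using F0(2) by auto
  ultimately show ?thesis
    using sum_stabilizer_orbit[OF X F0(1), of "\<lambda>_. 1"] by simp
qed

section \<open>The determinantal characters\<close>

text \<open>
  The Frobenius formula: \<open>alternant k\<close> is the coefficient function of the Vandermonde alternant,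
  normalised so that the staircase is \<open>0, -1, -2, \<dots>\<close>, and \<open>det_char n k \<beta>\<close> is the coefficient of
  \<open>x\<^sup>\<beta>\<close> in the alternant times the power sum attached to a permutation.  A partition \<open>\<lambda>\<close> is
  encoded by \<open>\<beta>\<^sub>i = \<lambda>\<^sub>i - i\<close>.
\<close>

definition alternant :: "nat \<Rightarrow> (nat \<Rightarrow> int) \<Rightarrow> real" where
  "alternant k \<gamma> = (\<Sum>w\<in>sym_group k. if \<forall>i<k. \<gamma> i = - int (w i) then rsgn w else 0)"

definition det_char :: "nat \<Rightarrow> nat \<Rightarrow> (nat \<Rightarrow> int) \<Rightarrow> (nat \<Rightarrow> nat) \<Rightarrow> real" where
  "det_char n k \<beta> p =
     (\<Sum>f | f \<in> colourings n k \<and> f \<circ> p = f. alternant k (\<lambda>i. \<beta> i - int (content n f i)))"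

lemma alternant_cong: "(\<And>i. i < k \<Longrightarrow> \<gamma> i = \<gamma>' i) \<Longrightarrow> alternant k \<gamma> = alternant k \<gamma>'"
  by (simp add: alternant_def)

lemma det_char_cong: "(\<And>i. i < k \<Longrightarrow> \<beta> i = \<beta>' i) \<Longrightarrow> det_char n k \<beta> p = det_char n k \<beta>' p"
  unfolding det_char_def by (intro sum.cong refl alternant_cong) simp

lemma transpose_sym_group: "i < k \<Longrightarrow> j < k \<Longrightarrow> transpose i j \<in> sym_group k"
  by (auto simp: sym_group_def permutes_swap_id)

lemma transpose_less: "i < k \<Longrightarrow> j < k \<Longrightarrow> transpose i j m < k \<longleftrightarrow> m < k" for i j k :: nat
  by (auto simp: transpose_def)

lemma alternant_transpose:
  assumes "i < k" "j < k" "i \<noteq> j"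
  shows "alternant k (\<gamma> \<circ> transpose i j) = - alternant k \<gamma>"
proof -
  let ?t = "transpose i j"
  have t: "?t \<in> sym_group k" using assms by (simp add: transpose_sym_group)
  have iff: "(\<forall>m<k. (\<gamma> \<circ> ?t) m = - int ((w \<circ> ?t) m)) \<longleftrightarrow> (\<forall>m<k. \<gamma> m = - int (w m))" for w
    using transpose_less[OF assms(1,2)] by (auto simp: o_def) (metis transpose_involutory)
  have "alternant k (\<gamma> \<circ> ?t) =
      (\<Sum>w\<in>sym_group k. if \<forall>m<k. (\<gamma> \<circ> ?t) m = - int ((w \<circ> ?t) m) then rsgn (w \<circ> ?t) else 0)"
    unfolding alternant_def by (rule sum_sym_group(2)[OF t, symmetric])
  also have "\<dots> = (\<Sum>w\<in>sym_group k. - (if \<forall>m<k. \<gamma> m = - int (w m) then rsgn w else 0))"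
    unfolding iff using t assms(3) by (intro sum.cong refl) (simp add: rsgn_comp[of _ k] sign_swap_id)
  finally show ?thesis by (simp add: alternant_def sum_negf)
qed

lemma alternant_low:
  assumes "i < k" "\<gamma> i \<le> - int k" shows "alternant k \<gamma> = 0"
  unfolding alternant_def
proof (intro sum.neutral ballI)
  fix w assume "w \<in> sym_group k"
  then have "w i < k" using permutes_in_image[OF sym_groupD(1), of w k i] assms(1) by simp
  then have "\<gamma> i \<noteq> - int (w i)" using assms(2) by linarith
  then show "(if \<forall>i<k. \<gamma> i = - int (w i) then rsgn w else 0) = 0" using assms(1) by auto
qed

lemma alternant_nonzero:
  assumes "alternant k \<gamma> \<noteq> 0"
  obtains w where "w \<in> sym_group k" "\<And>i. i < k \<Longrightarrow> \<gamma> i = - int (w i)"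
proof -
  obtain w where "w \<in> sym_group k" "(if \<forall>i<k. \<gamma> i = - int (w i) then rsgn w else 0) \<noteq> 0"
    using assms unfolding alternant_def by (rule sum.not_neutral_contains_not_neutral)
  then show ?thesis using that by (metis (full_types))
qed

lemma sum_sym_group_values:
  assumes "w \<in> sym_group k" shows "(\<Sum>i<k. g (w i)) = (\<Sum>i<k. g i)"
  using sum.permute[OF sym_groupD(1)[OF assms], of g] unfolding o_def by (rule sym)

lemma alternant_sum:
  assumes "alternant k \<gamma> \<noteq> 0" shows "(\<Sum>i<k. \<gamma> i) = - (\<Sum>i<k. int i)"
proof -
  obtain w where "w \<in> sym_group k" "\<And>i. i < k \<Longrightarrow> \<gamma> i = - int (w i)"
    using alternant_nonzero[OF assms] by blast
  then show ?thesis using sum_sym_group_values[of w k int] by (simp add: sum_negf)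
qed

text \<open>Needed at the bottom of the diagram in the branching rules, where shortening an empty or
  too short row meets no later entry with which it could coincide.\<close>

lemma det_char_low:
  assumes "i < k" "\<beta> i \<le> - int k" shows "det_char n k \<beta> p = 0"
  unfolding det_char_def by (intro sum.neutral ballI alternant_low[of i]) (use assms in auto)

text \<open>Exchanging the two colours permutes the colourings fixed by \<open>p\<close> and
  exchanges the two contents, so the antisymmetry of the alternant passes to the coefficient. This
  is the straightening rule behind all vanishing and sign statements below.\<close>

lemma det_char_transpose:
  assumes ij: "i < k" "j < k" "i \<noteq> j" and p: "p \<in> sym_group n"
  shows "det_char n k (\<beta> \<circ> transpose i j) p = - det_char n k \<beta> p"
proof -
  let ?t = "transpose i j"
  let ?S = "{f. f \<in> colourings n k \<and> f \<circ> p = f}"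
  define \<Phi> where "\<Phi> f = restrict (?t \<circ> f) {..<n}" for f :: "nat \<Rightarrow> nat"
  have pn: "p x < n \<longleftrightarrow> x < n" for x using permutes_in_image[OF sym_groupD(1)[OF p], of x] by simp
  have maps: "\<Phi> f \<in> ?S" if "f \<in> ?S" for f
  proof -
    have f: "f \<in> colourings n k" "f \<circ> p = f" using that by auto
    have "\<Phi> f \<in> colourings n k" using f(1) transpose_less[OF ij(1,2)] by (auto simp: \<Phi>_def colourings_def)
    moreover have "\<Phi> f \<circ> p = \<Phi> f"
    proof
      fix x show "(\<Phi> f \<circ> p) x = \<Phi> f x"
        using fun_cong[OF f(2), of x] pn[of x] by (auto simp: \<Phi>_def)
    qed
    ultimately show ?thesis by simp
  qed
  have inv: "\<Phi> (\<Phi> f) = f" if "f \<in> ?S" for f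
  proof
    fix x show "\<Phi> (\<Phi> f) x = f x"
      using that by (auto simp: \<Phi>_def colourings_def PiE_def extensional_def)
  qed
  have bij: "bij_betw \<Phi> ?S ?S"
    by (rule bij_betw_byWitness[where f' = \<Phi>]) (use maps inv in auto)
  have cont: "content n (\<Phi> f) m = content n f (?t m)" for f m
    unfolding content_def by (rule arg_cong[where f = card]) (auto simp: \<Phi>_def transpose_def split: if_splits)
  have "det_char n k (\<beta> \<circ> ?t) p = (\<Sum>f\<in>?S. alternant k (\<lambda>m. (\<beta> \<circ> ?t) m - int (content n (\<Phi> f) m)))"
    unfolding det_char_def by (rule sum.reindex_bij_betw[OF bij, symmetric])
  also have "\<dots> = (\<Sum>f\<in>?S. alternant k ((\<lambda>m. \<beta> m - int (content n f m)) \<circ> ?t))"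
    by (simp add: cont o_def)
  also have "\<dots> = - det_char n k \<beta> p"
    by (simp add: alternant_transpose[OF ij] det_char_def sum_negf)
  finally show ?thesis .
qed

lemma det_char_repeated:
  assumes "i < k" "j < k" "i \<noteq> j" "\<beta> i = \<beta> j" "p \<in> sym_group n"
  shows "det_char n k \<beta> p = 0"
proof -
  have "\<beta> \<circ> transpose i j = \<beta>" using assms(4) by (auto simp: transpose_def)
  then show ?thesis using det_char_transpose[OF assms(1-3,5), of \<beta>] by simp
qed

lemma det_char_conj:
  assumes g: "g \<in> sym_group n" and p: "p \<in> sym_group n"
  shows "det_char n k \<beta> (g \<circ> p \<circ> inv g) = det_char n k \<beta> p"
proof -
  let ?S = "\<lambda>p. {f. f \<in> colourings n k \<and> f \<circ> p = f}"
  have 1: "f \<circ> g \<in> ?S p" if "f \<in> ?S (g \<circ> p \<circ> inv g)" for f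
  proof -
    have "f \<circ> g \<circ> p = f \<circ> (g \<circ> p \<circ> inv g) \<circ> g" by (simp add: comp_assoc sym_group_inv_o[OF g])
    also have "\<dots> = f \<circ> g" using that by simp
    finally show ?thesis using that g by (auto simp: colourings_def compose_colouring)
  qed
  have 2: "f \<circ> inv g \<in> ?S (g \<circ> p \<circ> inv g)" if "f \<in> ?S p" for f
  proof -
    have "f \<circ> inv g \<circ> (g \<circ> p \<circ> inv g) = f \<circ> p \<circ> inv g" by (simp add: comp_assoc sym_group_inv_o[OF g])
    then show ?thesis using that g by (auto simp: colourings_def compose_colouring)
  qed
  have bij: "bij_betw (\<lambda>f. f \<circ> g) (?S (g \<circ> p \<circ> inv g)) (?S p)"
    by (rule bij_betw_byWitness[where f' = "\<lambda>f. f \<circ> inv g"])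
       (use 1 2 in \<open>auto simp: comp_assoc sym_group_inv_o[OF g]\<close>)
  have "det_char n k \<beta> p = (\<Sum>f\<in>?S (g \<circ> p \<circ> inv g). alternant k (\<lambda>i. \<beta> i - int (content n (f \<circ> g) i)))"
    unfolding det_char_def by (rule sum.reindex_bij_betw[OF bij, symmetric])
  then show ?thesis by (simp add: content_comp[OF g] det_char_def)
qed

text \<open>The Jacobi-Trudi expansion, read on characters: each summand is, up to sign, the
  permutation character on words of one content.\<close>

lemma det_char_words:
  "det_char n k \<beta> p = (\<Sum>w\<in>sym_group k. rsgn w *
     card {f \<in> colourings n k. f \<circ> p = f \<and> (\<forall>i<k. int (content n f i) = \<beta> i + int (w i))})"
proof -
  have "det_char n k \<beta> p = (\<Sum>w\<in>sym_group k. \<Sum>f | f \<in> colourings n k \<and> f \<circ> p = f.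
      if \<forall>i<k. \<beta> i - int (content n f i) = - int (w i) then rsgn w else 0)"
    unfolding det_char_def alternant_def by (rule sum.swap)
  also have "\<dots> = (\<Sum>w\<in>sym_group k. rsgn w *
     card {f \<in> colourings n k. f \<circ> p = f \<and> (\<forall>i<k. int (content n f i) = \<beta> i + int (w i))})"
  proof (rule sum.cong[OF refl])
    fix w
    have "{f \<in> colourings n k. f \<circ> p = f \<and> (\<forall>i<k. int (content n f i) = \<beta> i + int (w i))} =
       {f \<in> {f. f \<in> colourings n k \<and> f \<circ> p = f}. \<forall>i<k. \<beta> i - int (content n f i) = - int (w i)}"
      by (auto simp: algebra_simps)
    then show "(\<Sum>f | f \<in> colourings n k \<and> f \<circ> p = f.
        if \<forall>i<k. \<beta> i - int (content n f i) = - int (w i) then rsgn w else 0) = rsgn w *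
       real (card {f \<in> colourings n k. f \<circ> p = f \<and> (\<forall>i<k. int (content n f i) = \<beta> i + int (w i))})"
      using sum.inter_filter[of "{f. f \<in> colourings n k \<and> f \<circ> p = f}" "\<lambda>_. rsgn w"
        "\<lambda>f. \<forall>i<k. \<beta> i - int (content n f i) = - int (w i)"] by (simp add: mult.commute)
  qed
  finally show ?thesis .
qed

section \<open>Orthonormality of the determinantal characters\<close>

text \<open>The total is an integer so that a negative one gives the empty set, in accordance with
  h_a = 0 for a < 0.\<close>

definition compositions :: "nat \<Rightarrow> int \<Rightarrow> (nat \<Rightarrow> nat) set" where
  "compositions k a = {c \<in> {..<k} \<rightarrow>\<^sub>E UNIV. int (\<Sum>i<k. c i) = a}"

text \<open>
  The coefficient of \<open>x\<^sup>\<beta>\<close> in the alternant times \<open>h\<^bsub>\<alpha>\<^sub>0\<^esub> \<dots> h\<^bsub>\<alpha>\<^sub>j\<^sub>-\<^sub>1\<^esub>\<close>.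
\<close>

primrec alt_h_coeff :: "nat \<Rightarrow> nat \<Rightarrow> (nat \<Rightarrow> int) \<Rightarrow> (nat \<Rightarrow> int) \<Rightarrow> real" where
  "alt_h_coeff k 0 \<alpha> \<beta> = alternant k \<beta>"
| "alt_h_coeff k (Suc j) \<alpha> \<beta> = (\<Sum>c\<in>compositions k (\<alpha> j). alt_h_coeff k j \<alpha> (\<lambda>i. \<beta> i - int (c i)))"

lemma finite_compositions [simp]: "finite (compositions k a)"
proof (rule finite_subset)
  show "compositions k a \<subseteq> {..<k} \<rightarrow>\<^sub>E {..nat a}"
  proof
    fix c assume c: "c \<in> compositions k a"
    have "c i \<le> (\<Sum>i<k. c i)" if "i < k" for i using that by (intro member_le_sum) auto
    moreover have "(\<Sum>i<k. c i) = nat a" using c unfolding compositions_def by (metis (mono_tags, lifting) mem_Collect_eq nat_int)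
    ultimately show "c \<in> {..<k} \<rightarrow>\<^sub>E {..nat a}" using c by (auto simp: compositions_def PiE_def Pi_def)
  qed
qed (simp add: finite_PiE)

lemma alt_h_coeff_cong: "(\<And>i. i < k \<Longrightarrow> \<beta> i = \<beta>' i) \<Longrightarrow> alt_h_coeff k j \<alpha> \<beta> = alt_h_coeff k j \<alpha> \<beta>'"
proof (induction j arbitrary: \<beta> \<beta>')
  case 0
  then show ?case by (auto intro: alternant_cong)
next
  case (Suc j)
  show ?case unfolding alt_h_coeff.simps by (intro sum.cong refl Suc.IH) (simp add: Suc.prems)
qed

lemma compositions_transpose:
  assumes "i < k" "j < k"
  shows "bij_betw (\<lambda>c. c \<circ> transpose i j) (compositions k a) (compositions k a)"
proof -
  have t: "transpose i j \<in> sym_group k" using assms by (rule transpose_sym_group)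
  have "c \<circ> transpose i j \<in> compositions k a" if "c \<in> compositions k a" for c
  proof -
    have "c \<circ> transpose i j \<in> {..<k} \<rightarrow>\<^sub>E UNIV"
      using that by (intro compose_colouring[OF _ t]) (simp add: compositions_def)
    moreover have "(\<Sum>m<k. (c \<circ> transpose i j) m) = (\<Sum>m<k. c m)"
      using sum_sym_group_values[OF t, of c] by (simp only: o_def)
    ultimately show ?thesis using that unfolding compositions_def mem_Collect_eq by (simp only:)
  qed
  then show ?thesis
    by (intro bij_betw_byWitness[where f' = "\<lambda>c. c \<circ> transpose i j"] ballI image_subsetI)
       (simp_all only: comp_assoc transpose_comp_involutory comp_id)
qed

lemma alt_h_coeff_transpose:
  assumes "i < k" "i' < k" "i \<noteq> i'"
  shows "alt_h_coeff k j \<alpha> (\<beta> \<circ> transpose i i') = - alt_h_coeff k j \<alpha> \<beta>"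
proof (induction j arbitrary: \<beta>)
  case 0
  then show ?case using alternant_transpose[OF assms, of \<beta>] by (simp only: alt_h_coeff.simps)
next
  case (Suc j)
  let ?t = "transpose i i'"
  have "alt_h_coeff k (Suc j) \<alpha> (\<beta> \<circ> ?t) =
      (\<Sum>c\<in>compositions k (\<alpha> j). alt_h_coeff k j \<alpha> (\<lambda>i. (\<beta> \<circ> ?t) i - int ((c \<circ> ?t) i)))"
    unfolding alt_h_coeff.simps by (rule sum.reindex_bij_betw[OF compositions_transpose[OF assms(1,2)], symmetric])
  also have "\<dots> = (\<Sum>c\<in>compositions k (\<alpha> j). alt_h_coeff k j \<alpha> ((\<lambda>i. \<beta> i - int (c i)) \<circ> ?t))"
    by (simp add: o_def)
  also have "\<dots> = - alt_h_coeff k (Suc j) \<alpha> \<beta>" by (simp add: Suc sum_negf)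
  finally show ?case .
qed

text \<open>
  Sign-reversing involution: at the first violation of interlacing, exchange the two adjacent entries
  of \<open>\<beta> - c\<close>.
\<close>

lemma pieri_cancellation:
  fixes H :: "(nat \<Rightarrow> int) \<Rightarrow> real" and d :: "nat \<Rightarrow> nat"
  assumes anti: "\<And>i \<gamma>. Suc i < k \<Longrightarrow> H (\<gamma> \<circ> transpose i (Suc i)) = - H \<gamma>"
    and cong: "\<And>\<gamma> \<gamma>'. (\<And>i. i < k \<Longrightarrow> \<gamma> i = \<gamma>' i) \<Longrightarrow> H \<gamma> = H \<gamma>'"
    and d: "\<And>i. Suc i < k \<Longrightarrow> \<beta> i - \<beta> (Suc i) = int (d i)"
  shows "(\<Sum>c\<in>compositions k a. H (\<lambda>i. \<beta> i - int (c i))) =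
    (\<Sum>c | c \<in> compositions k a \<and> (\<forall>i. Suc i < k \<longrightarrow> c i < d i). H (\<lambda>i. \<beta> i - int (c i)))"
proof -
  define bad where "bad c i \<longleftrightarrow> Suc i < k \<and> d i \<le> c i" for c :: "nat \<Rightarrow> nat" and i
  define B where "B = {c \<in> compositions k a. \<exists>i. bad c i}"
  define ix where "ix c = (LEAST i. bad c i)" for c
  \<comment> \<open>As \<open>d\<close> is the gap between consecutive entries of \<beta>, these
    values exchange the entries of \<beta> - c at the two positions. The violation
    \<open>d (ix c) \<le> c (ix c)\<close> keeps the second value from being truncated.\<close>
  define \<phi> where "\<phi> c = c(ix c := c (Suc (ix c)) + d (ix c), Suc (ix c) := c (ix c) - d (ix c))" for c
  have ix: "bad c (ix c)" if "c \<in> B" for c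
    using that unfolding B_def ix_def by (auto intro: LeastI)
  have least: "\<not> bad c i" if "i < ix c" for c i
    using that unfolding ix_def by (rule not_less_Least)
  have sum_upd: "(\<Sum>m<k. \<phi> c m) = (\<Sum>m<k. c m)" if "c \<in> B" for c
  proof -
    let ?i = "ix c"
    have i: "Suc ?i < k" "d ?i \<le> c ?i" using ix[OF that] by (auto simp: bad_def)
    have split: "(\<Sum>m<k. f m) = f ?i + f (Suc ?i) + (\<Sum>m\<in>{..<k} - {?i, Suc ?i}. f m)" for f :: "nat \<Rightarrow> nat"
    proof -
      have "(\<Sum>m<k. f m) = f ?i + (\<Sum>m\<in>{..<k} - {?i}. f m)" using i by (intro sum.remove) auto
      also have "(\<Sum>m\<in>{..<k} - {?i}. f m) = f (Suc ?i) + (\<Sum>m\<in>{..<k} - {?i} - {Suc ?i}. f m)"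
        using i by (intro sum.remove) auto
      also have "{..<k} - {?i} - {Suc ?i} = {..<k} - {?i, Suc ?i}" by auto
      finally show ?thesis by simp
    qed
    have "(\<Sum>m\<in>{..<k} - {?i, Suc ?i}. \<phi> c m) = (\<Sum>m\<in>{..<k} - {?i, Suc ?i}. c m)"
      by (intro sum.cong refl) (auto simp: \<phi>_def)
    then show ?thesis using split[of "\<phi> c"] split[of c] i by (simp add: \<phi>_def)
  qed
  have B1: "\<phi> c \<in> B" "ix (\<phi> c) = ix c" if "c \<in> B" for c
  proof -
    let ?i = "ix c"
    have i: "Suc ?i < k" "d ?i \<le> c ?i" using ix[OF that] by (auto simp: bad_def)
    have bi: "bad (\<phi> c) ?i" using i by (simp add: bad_def \<phi>_def)
    have "\<phi> c \<in> {..<k} \<rightarrow>\<^sub>E UNIV"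
      using that i by (auto simp: B_def compositions_def \<phi>_def PiE_def extensional_def)
    then have "\<phi> c \<in> compositions k a"
      using that sum_upd[OF that] unfolding B_def compositions_def mem_Collect_eq by (simp only:)
    then show "\<phi> c \<in> B" using bi unfolding B_def by blast
    \<comment> \<open>The entries before \<open>ix c\<close> are unchanged and the new entry there
      still is at least \<open>d\<close>, so the first violation stays where it was; this makes the
      map an involution.\<close>
    show "ix (\<phi> c) = ix c"
      unfolding ix_def[of "\<phi> c"]
    proof (rule Least_equality[of "bad (\<phi> c)" ?i])
      fix y assume y: "bad (\<phi> c) y"
      show "?i \<le> y"
      proof (rule ccontr)
        assume less: "\<not> ?i \<le> y"
        then have "\<phi> c y = c y" by (simp add: \<phi>_def)
        then have "bad c y" using y by (simp add: bad_def)
        then show False using least[of y c] less by simp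
      qed
    qed (rule bi)
  qed
  have B2: "\<phi> (\<phi> c) = c" if "c \<in> B" for c
  proof
    fix m
    have "d (ix c) \<le> c (ix c)" using ix[OF that] by (simp add: bad_def)
    then show "\<phi> (\<phi> c) m = c m"
      unfolding \<phi>_def[of "\<phi> c"] B1(2)[OF that] by (simp add: \<phi>_def)
  qed
  have bij: "bij_betw \<phi> B B"
    by (rule bij_betw_byWitness[where f' = \<phi>]) (use B1 B2 in auto)
  have flip: "H (\<lambda>m. \<beta> m - int (\<phi> c m)) = - H (\<lambda>m. \<beta> m - int (c m))" if "c \<in> B" for c
  proof -
    let ?i = "ix c"
    have i: "Suc ?i < k" "d ?i \<le> c ?i" using ix[OF that] by (auto simp: bad_def)
    have "H (\<lambda>m. \<beta> m - int (\<phi> c m)) = H ((\<lambda>m. \<beta> m - int (c m)) \<circ> transpose ?i (Suc ?i))"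
      using d[OF i(1)] i(2) by (intro cong) (auto simp: \<phi>_def transpose_def of_nat_diff)
    then show ?thesis using anti[OF i(1)] by simp
  qed
  have "(\<Sum>c\<in>B. H (\<lambda>i. \<beta> i - int (c i))) = (\<Sum>c\<in>B. H (\<lambda>i. \<beta> i - int (\<phi> c i)))"
    by (rule sum.reindex_bij_betw[OF bij, symmetric])
  also have "\<dots> = - (\<Sum>c\<in>B. H (\<lambda>i. \<beta> i - int (c i)))"
    by (simp add: flip sum_negf)
  finally have zero: "(\<Sum>c\<in>B. H (\<lambda>i. \<beta> i - int (c i))) = 0" by simp
  have split: "compositions k a - B = {c. c \<in> compositions k a \<and> (\<forall>i. Suc i < k \<longrightarrow> c i < d i)}"
    by (auto simp: B_def bad_def not_le)
  have "(\<Sum>c\<in>compositions k a. H (\<lambda>i. \<beta> i - int (c i))) =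
      (\<Sum>c\<in>compositions k a - B. H (\<lambda>i. \<beta> i - int (c i))) + (\<Sum>c\<in>B. H (\<lambda>i. \<beta> i - int (c i)))"
    by (rule sum.subset_diff) (auto simp: B_def)
  then show ?thesis using zero split by simp
qed

section \<open>The Pieri rule and triangularity of Kostka numbers\<close>

definition antitone_upto :: "nat \<Rightarrow> (nat \<Rightarrow> int) \<Rightarrow> bool" where
  "antitone_upto k \<nu> \<longleftrightarrow> (\<forall>i. Suc i < k \<longrightarrow> \<nu> (Suc i) \<le> \<nu> i)"

text \<open>After the cancellation only those \<open>c\<close> remain for which \<nu> - c interlaces
  \<nu>, that is, horizontal strips. The last entry of \<open>c\<close> is bounded only through its
  total, so \<nu> - c may become negative there; such terms vanish at the end of the
  recursion.\<close>

lemma alt_h_coeff_pieri: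
  assumes "antitone_upto k \<nu>"
  shows "alt_h_coeff k (Suc j) \<alpha> (\<lambda>i. \<nu> i - int i) =
    (\<Sum>c | c \<in> compositions k (\<alpha> j) \<and> (\<forall>i. Suc i < k \<longrightarrow> int (c i) \<le> \<nu> i - \<nu> (Suc i)).
       alt_h_coeff k j \<alpha> (\<lambda>i. (\<nu> i - int (c i)) - int i))"
proof -
  \<comment> \<open>The staircase subtracted from \<nu> adds 1 to each gap, which turns the strict
    bound of the cancellation lemma into a weak one.\<close>
  let ?d = "\<lambda>i. nat (\<nu> i - \<nu> (Suc i) + 1)"
  have "alt_h_coeff k (Suc j) \<alpha> (\<lambda>i. \<nu> i - int i) =
    (\<Sum>c | c \<in> compositions k (\<alpha> j) \<and> (\<forall>i. Suc i < k \<longrightarrow> c i < ?d i).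
       alt_h_coeff k j \<alpha> (\<lambda>i. (\<nu> i - int i) - int (c i)))"
    unfolding alt_h_coeff.simps
  proof (rule pieri_cancellation)
    show "alt_h_coeff k j \<alpha> (\<gamma> \<circ> transpose i (Suc i)) = - alt_h_coeff k j \<alpha> \<gamma>" if "Suc i < k" for i \<gamma>
      using alt_h_coeff_transpose[of i k "Suc i"] that by simp
    show "alt_h_coeff k j \<alpha> \<gamma> = alt_h_coeff k j \<alpha> \<gamma>'" if "\<And>i. i < k \<Longrightarrow> \<gamma> i = \<gamma>' i" for \<gamma> \<gamma>'
      by (rule alt_h_coeff_cong) (rule that)
    show "\<nu> i - int i - (\<nu> (Suc i) - int (Suc i)) = int (?d i)" if "Suc i < k" for i
      using assms that by (auto simp: antitone_upto_def dest!: spec[of _ i])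
  qed
  also have "{c. c \<in> compositions k (\<alpha> j) \<and> (\<forall>i. Suc i < k \<longrightarrow> c i < ?d i)} =
     {c. c \<in> compositions k (\<alpha> j) \<and> (\<forall>i. Suc i < k \<longrightarrow> int (c i) \<le> \<nu> i - \<nu> (Suc i))}"
    by (auto simp: zless_nat_eq_int_zless)
  also have "(\<lambda>c. alt_h_coeff k j \<alpha> (\<lambda>i. (\<nu> i - int i) - int (c i))) =
      (\<lambda>c. alt_h_coeff k j \<alpha> (\<lambda>i. (\<nu> i - int (c i)) - int i))"
    by (simp add: algebra_simps)
  finally show ?thesis .
qed

lemma alt_h_coeff_step:
  assumes anti: "antitone_upto k \<nu>" and nz: "alt_h_coeff k (Suc j) \<alpha> (\<lambda>i. \<nu> i - int i) \<noteq> 0"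
  obtains c where "c \<in> compositions k (\<alpha> j)" "\<And>i. Suc i < k \<Longrightarrow> int (c i) \<le> \<nu> i - \<nu> (Suc i)"
    "antitone_upto k (\<lambda>i. \<nu> i - int (c i))" "alt_h_coeff k j \<alpha> (\<lambda>i. (\<nu> i - int (c i)) - int i) \<noteq> 0"
proof -
  from nz obtain c where c: "c \<in> compositions k (\<alpha> j)" "\<And>i. Suc i < k \<Longrightarrow> int (c i) \<le> \<nu> i - \<nu> (Suc i)"
    "alt_h_coeff k j \<alpha> (\<lambda>i. (\<nu> i - int (c i)) - int i) \<noteq> 0"
    unfolding alt_h_coeff_pieri[OF anti] by (rule sum.not_neutral_contains_not_neutral) auto
  have "antitone_upto k (\<lambda>i. \<nu> i - int (c i))"
    unfolding antitone_upto_def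
  proof (intro allI impI)
    fix i assume "Suc i < k"
    then show "\<nu> (Suc i) - int (c (Suc i)) \<le> \<nu> i - int (c i)" using c(2)[of i] by linarith
  qed
  with c show ?thesis using that by blast
qed

lemma alt_h_coeff_total:
  assumes "alt_h_coeff k j \<alpha> \<beta> \<noteq> 0"
  shows "(\<Sum>i<k. \<beta> i + int i) = (\<Sum>i<j. \<alpha> i)"
  using assms
proof (induction j arbitrary: \<beta>)
  case 0
  then show ?case using alternant_sum[of k \<beta>] by (simp add: sum.distrib)
next
  case (Suc j)
  from Suc.prems obtain c where c: "c \<in> compositions k (\<alpha> j)" "alt_h_coeff k j \<alpha> (\<lambda>i. \<beta> i - int (c i)) \<noteq> 0"
    unfolding alt_h_coeff.simps by (rule sum.not_neutral_contains_not_neutral)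
  have "(\<Sum>i<k. int (c i)) = \<alpha> j" using c(1) by (simp add: compositions_def)
  then show ?case using Suc.IH[OF c(2)] by (simp add: sum.distrib sum_subtractf)
qed

text \<open>For antitone \<nu> the permutation with \<nu> i - i = -w(i) is strictly increasing on
  the first k numbers, hence at least the identity pointwise, and equality of the sums makes it the
  identity.\<close>

lemma alternant_antitone:
  assumes anti: "antitone_upto k \<nu>" and nz: "alternant k (\<lambda>i. \<nu> i - int i) \<noteq> 0" and i: "i < k"
  shows "\<nu> i = 0"
proof -
  obtain w where w: "w \<in> sym_group k" "\<And>i. i < k \<Longrightarrow> \<nu> i - int i = - int (w i)"
    using alternant_nonzero[OF nz] by blast
  have ge: "m \<le> w m" if "m < k" for m
    using that
  proof (induction m)
    case (Suc m)
    have "\<nu> (Suc m) \<le> \<nu> m" using anti Suc.prems by (simp add: antitone_upto_def)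
    then have "w m < w (Suc m)" using w(2)[of m] w(2)[of "Suc m"] Suc.prems by simp
    then show ?case using Suc by simp
  qed simp
  have "(\<Sum>i<k. int (w i)) = (\<Sum>i<k. int i)" using sum_sym_group_values[OF w(1), of int] .
  then have "int (w i) = int i"
    using sum_mono_inv[of "\<lambda>i. int i" "{..<k}" "\<lambda>i. int (w i)" i] ge i by auto
  then show ?thesis using w(2)[OF i] by simp
qed

text \<open>A horizontal strip reaches at most one row beyond the smaller shape, so \<open>j\<close>
  strips fill at most \<open>j\<close> rows.\<close>

lemma alt_h_coeff_length:
  assumes "antitone_upto k \<nu>" "alt_h_coeff k j \<alpha> (\<lambda>i. \<nu> i - int i) \<noteq> 0" "j \<le> i" "i < k"
  shows "\<nu> i = 0"
  using assms
proof (induction j arbitrary: \<nu> i)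
  case 0
  then show ?case using alternant_antitone by simp
next
  case (Suc j)
  obtain c where c: "\<And>i. Suc i < k \<Longrightarrow> int (c i) \<le> \<nu> i - \<nu> (Suc i)"
    "antitone_upto k (\<lambda>i. \<nu> i - int (c i))" "alt_h_coeff k j \<alpha> (\<lambda>i. (\<nu> i - int (c i)) - int i) \<noteq> 0"
    using alt_h_coeff_step[OF Suc.prems(1,2)] by metis
  obtain i' where i': "i = Suc i'" using Suc.prems(3) by (cases i) auto
  have "\<nu> i - int (c i) = 0" "\<nu> i' - int (c i') = 0"
    using Suc.IH[OF c(2,3), of i] Suc.IH[OF c(2,3), of i'] Suc.prems i' by auto
  then show ?case using c(1)[of i'] Suc.prems i' by simp
qed

text \<open>Removing the last strip only lowers \<nu>, which settles all t up to j by induction. For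
  t equal to the number of strips, the whole shape lies in the first t rows and the totals
  agree.\<close>

lemma alt_h_coeff_dominance:
  assumes "antitone_upto k \<nu>" "alt_h_coeff k j \<alpha> (\<lambda>i. \<nu> i - int i) \<noteq> 0" "t \<le> j" "j \<le> k"
  shows "(\<Sum>i<t. \<alpha> i) \<le> (\<Sum>i<t. \<nu> i)"
  using assms
proof (induction j arbitrary: \<nu>)
  case (Suc j)
  show ?case
  proof (cases "t = Suc j")
    case True
    have "(\<Sum>i<t. \<alpha> i) = (\<Sum>i<k. \<nu> i)"
      using alt_h_coeff_total[OF Suc.prems(2)] True by simp
    also have "\<dots> = (\<Sum>i<t. \<nu> i)"
      using alt_h_coeff_length[OF Suc.prems(1,2)] True Suc.prems(4)
      by (intro sum.mono_neutral_right) auto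
    finally show ?thesis by simp
  next
    case False
    obtain c where c: "antitone_upto k (\<lambda>i. \<nu> i - int (c i))" "alt_h_coeff k j \<alpha> (\<lambda>i. (\<nu> i - int (c i)) - int i) \<noteq> 0"
      using alt_h_coeff_step[OF Suc.prems(1,2)] by metis
    have "(\<Sum>i<t. \<alpha> i) \<le> (\<Sum>i<t. \<nu> i - int (c i))"
      using Suc.IH[OF c] Suc.prems False by simp
    also have "\<dots> \<le> (\<Sum>i<t. \<nu> i)" by (intro sum_mono) simp
    finally show ?thesis .
  qed
qed simp

lemma alternant_staircase: "alternant k (\<lambda>i. - int i) = 1"
proof -
  have "(if \<forall>i<k. - int i = - int (w i) then rsgn w else 0) = (if w = id then 1 else 0)"
    if "w \<in> sym_group k" for w
  proof -
    have "(\<forall>i<k. i = w i) \<longleftrightarrow> w = id"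
      using sym_groupD(1)[OF that] by (auto simp: permutes_def fun_eq_iff)
    then show ?thesis by auto
  qed
  then have "alternant k (\<lambda>i. - int i) = (\<Sum>w\<in>sym_group k. if w = id then 1 else 0)"
    unfolding alternant_def by (intro sum.cong refl)
  then show ?thesis using sum.delta[of "sym_group k" id "\<lambda>_. 1::real"] by simp
qed

text \<open>The diagonal Kostka number is 1 because the last strip is forced to be the whole last
  row: dominance leaves it no room in the earlier rows, and the length bound makes it exhaust the
  last one.\<close>

lemma alt_h_coeff_diagonal:
  assumes "antitone_upto k \<nu>" "\<And>i. i < k \<Longrightarrow> 0 \<le> \<nu> i" "\<And>i. j \<le> i \<Longrightarrow> i < k \<Longrightarrow> \<nu> i = 0" "j \<le> k"
    and "\<And>i. i < j \<Longrightarrow> \<alpha> i = \<nu> i"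
  shows "alt_h_coeff k j \<alpha> (\<lambda>i. \<nu> i - int i) = 1"
  using assms
proof (induction j arbitrary: \<nu>)
  case 0
  then have "alternant k (\<lambda>i. \<nu> i - int i) = alternant k (\<lambda>i. - int i)"
    by (intro alternant_cong) auto
  then show ?case by (simp add: alternant_staircase)
next
  case (Suc j)
  define e where "e = (\<lambda>i\<in>{..<k}. if i = j then nat (\<nu> j) else 0)"
  define \<mu> where "\<mu> i = \<nu> i - int (e i)" for i
  have jk: "j < k" using Suc.prems by simp
  have "(\<Sum>i<k. e i) = nat (\<nu> j)" using jk by (simp add: e_def)
  then have "int (\<Sum>i<k. e i) = \<alpha> j"
    using Suc.prems(2)[OF jk] Suc.prems(5)[of j] by (simp del: of_nat_sum)
  moreover have "e \<in> {..<k} \<rightarrow>\<^sub>E UNIV" by (simp add: e_def)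
  ultimately have e: "e \<in> compositions k (\<alpha> j)" by (simp add: compositions_def del: of_nat_sum)
  have IHe: "alt_h_coeff k j \<alpha> (\<lambda>i. \<mu> i - int i) = 1"
  proof (rule Suc.IH)
    show "antitone_upto k \<mu>"
      unfolding antitone_upto_def
    proof (intro allI impI)
      fix i assume i: "Suc i < k"
      have "\<nu> (Suc i) \<le> \<nu> i" using Suc.prems(1) i by (simp add: antitone_upto_def)
      moreover have "\<nu> (Suc i) = 0" if "i = j" using Suc.prems(3)[of "Suc i"] that i by simp
      moreover have "0 \<le> \<nu> i" "0 \<le> \<nu> (Suc i)" using Suc.prems(2) i by auto
      ultimately show "\<mu> (Suc i) \<le> \<mu> i" using i by (auto simp: \<mu>_def e_def)
    qed
    show "0 \<le> \<mu> i" if "i < k" for i using Suc.prems(2)[OF that] that by (auto simp: \<mu>_def e_def)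
    show "\<mu> i = 0" if "j \<le> i" "i < k" for i
      using Suc.prems(2)[of i] Suc.prems(3)[of i] that by (cases "i = j") (auto simp: \<mu>_def e_def)
    show "\<alpha> i = \<mu> i" if "i < j" for i using Suc.prems(4,5) that by (auto simp: \<mu>_def e_def)
  qed (use Suc.prems in simp)
  have only: "c = e" if c: "c \<in> compositions k (\<alpha> j)" "\<And>i. Suc i < k \<Longrightarrow> int (c i) \<le> \<nu> i - \<nu> (Suc i)"
     "alt_h_coeff k j \<alpha> (\<lambda>i. (\<nu> i - int (c i)) - int i) \<noteq> 0" for c
  proof
    have anti: "antitone_upto k (\<lambda>i. \<nu> i - int (c i))"
      unfolding antitone_upto_def
    proof (intro allI impI)
      fix i assume "Suc i < k"
      then show "\<nu> (Suc i) - int (c (Suc i)) \<le> \<nu> i - int (c i)" using c(2)[of i] by linarith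
    qed
    fix i
    consider "i < j" | "j \<le> i" "i < k" | "\<not> i < k" by linarith
    then show "c i = e i"
    proof cases
      case 1
      have "(\<Sum>m<Suc i. \<alpha> m) \<le> (\<Sum>m<Suc i. \<nu> m - int (c m))"
        using alt_h_coeff_dominance[OF anti c(3), of "Suc i"] 1 jk by simp
      moreover have "(\<Sum>m<Suc i. \<alpha> m) = (\<Sum>m<Suc i. \<nu> m)"
        using Suc.prems(5) 1 by (intro sum.cong) auto
      ultimately have "(\<Sum>m<Suc i. int (c m)) \<le> 0" by (simp add: sum_subtractf)
      then have "int (\<Sum>m<Suc i. c m) \<le> 0" by simp
      then have "(\<Sum>m<Suc i. c m) = 0" by linarith
      then have "c i = 0" by simp
      then show ?thesis using 1 jk by (simp add: e_def)
    next
      case 2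
      have "\<nu> i - int (c i) = 0" using alt_h_coeff_length[OF anti c(3) 2] .
      then show ?thesis using 2 Suc.prems(3)[of i] by (cases "i = j") (auto simp: e_def)
    next
      case 3
      then show ?thesis using c(1) by (auto simp: compositions_def e_def PiE_def extensional_def)
    qed
  qed
  have int_e: "int (e i) \<le> \<nu> i - \<nu> (Suc i)" if i: "Suc i < k" for i
  proof -
    have "\<nu> (Suc i) \<le> \<nu> i" using Suc.prems(1) i by (simp add: antitone_upto_def)
    moreover have "\<nu> (Suc i) = 0" if "i = j" using Suc.prems(3)[of "Suc i"] that i by simp
    moreover have "0 \<le> \<nu> i" using Suc.prems(2) i by auto
    ultimately show ?thesis using i by (auto simp: e_def)
  qed
  have "alt_h_coeff k (Suc j) \<alpha> (\<lambda>i. \<nu> i - int i) =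
      (\<Sum>c\<in>{e}. alt_h_coeff k j \<alpha> (\<lambda>i. (\<nu> i - int (c i)) - int i))"
    unfolding alt_h_coeff_pieri[OF Suc.prems(1)]
  proof (rule sum.mono_neutral_right)
    show "{e} \<subseteq> {c. c \<in> compositions k (\<alpha> j) \<and> (\<forall>i. Suc i < k \<longrightarrow> int (c i) \<le> \<nu> i - \<nu> (Suc i))}"
      using e int_e by simp
    show "\<forall>c\<in>{c. c \<in> compositions k (\<alpha> j) \<and> (\<forall>i. Suc i < k \<longrightarrow> int (c i) \<le> \<nu> i - \<nu> (Suc i))} - {e}.
        alt_h_coeff k j \<alpha> (\<lambda>i. (\<nu> i - int (c i)) - int i) = 0"
      using only by blast
  qed simp
  also have "\<dots> = 1" using IHe by (simp add: \<mu>_def)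
  finally show ?case .
qed

text \<open>Unfolding the recursion turns the strips into the columns of a nonnegative integer
  matrix; such matrices reappear as the joint contents of two words.\<close>

lemma alt_h_coeff_matrices:
  "alt_h_coeff k j \<alpha> \<beta> =
    (\<Sum>c\<in>PiE {..<j} (\<lambda>t. compositions k (\<alpha> t)). alternant k (\<lambda>i. \<beta> i - (\<Sum>t<j. int (c t i))))"
proof (induction j arbitrary: \<beta>)
  case 0
  then show ?case by simp
next
  case (Suc j)
  let ?P = "\<lambda>j. PiE {..<j} (\<lambda>t. compositions k (\<alpha> t))"
  have eq: "?P (Suc j) = (\<lambda>(y, g). g(j := y)) ` (compositions k (\<alpha> j) \<times> ?P j)"
    by (simp add: lessThan_Suc PiE_insert_eq)
  have inj: "inj_on (\<lambda>(y, g). g(j := y)) (compositions k (\<alpha> j) \<times> ?P j)"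
    by (rule inj_combinator) simp
  have "(\<Sum>c\<in>?P (Suc j). alternant k (\<lambda>i. \<beta> i - (\<Sum>t<Suc j. int (c t i)))) =
     (\<Sum>(y, g)\<in>compositions k (\<alpha> j) \<times> ?P j. alternant k (\<lambda>i. \<beta> i - (\<Sum>t<Suc j. int ((g(j := y)) t i))))"
    unfolding eq by (subst sum.reindex[OF inj]) (simp add: case_prod_unfold)
  also have "\<dots> = (\<Sum>y\<in>compositions k (\<alpha> j). \<Sum>g\<in>?P j. alternant k (\<lambda>i. \<beta> i - (\<Sum>t<Suc j. int ((g(j := y)) t i))))"
    by (rule sum.cartesian_product[symmetric])
  also have "\<dots> = (\<Sum>y\<in>compositions k (\<alpha> j). \<Sum>g\<in>?P j. alternant k (\<lambda>i. (\<beta> i - int (y i)) - (\<Sum>t<j. int (g t i))))"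
    by (intro sum.cong refl alternant_cong) (simp add: algebra_simps)
  also have "\<dots> = alt_h_coeff k (Suc j) \<alpha> \<beta>" by (simp add: Suc)
  finally show ?case by simp
qed

section \<open>Pairs of words and nonnegative integer matrices\<close>

lemma content_fst:
  fixes k k' :: nat
  assumes "F \<in> {..<n} \<rightarrow>\<^sub>E ({..<k} \<times> {..<k'})"
  shows "content n (fst \<circ> F) i = (\<Sum>j<k'. content n F (i, j))"
proof -
  have "{x. x < n \<and> (fst \<circ> F) x = i} = (\<Union>j\<in>{..<k'}. {x. x < n \<and> F x = (i, j)})"
  proof -
    have "snd (F x) < k'" if "x < n" for x using PiE_mem[OF assms, of x] that by (auto simp: mem_Times_iff)
    then show ?thesis by (auto simp: prod_eq_iff)
  qed
  then have "content n (fst \<circ> F) i = card (\<Union>j\<in>{..<k'}. {x. x < n \<and> F x = (i, j)})"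
    unfolding content_def by (rule arg_cong)
  also have "\<dots> = (\<Sum>j<k'. content n F (i, j))"
    unfolding content_def by (rule card_UN_disjoint) auto
  finally show ?thesis .
qed

lemma content_snd:
  fixes k k' :: nat
  assumes "F \<in> {..<n} \<rightarrow>\<^sub>E ({..<k} \<times> {..<k'})"
  shows "content n (snd \<circ> F) j = (\<Sum>i<k. content n F (i, j))"
proof -
  have "{x. x < n \<and> (snd \<circ> F) x = j} = (\<Union>i\<in>{..<k}. {x. x < n \<and> F x = (i, j)})"
  proof -
    have "fst (F x) < k" if "x < n" for x using PiE_mem[OF assms, of x] that by (auto simp: mem_Times_iff)
    then show ?thesis by (auto simp: prod_eq_iff)
  qed
  then have "content n (snd \<circ> F) j = card (\<Union>i\<in>{..<k}. {x. x < n \<and> F x = (i, j)})"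
    unfolding content_def by (rule arg_cong)
  also have "\<dots> = (\<Sum>i<k. content n F (i, j))"
    unfolding content_def by (rule card_UN_disjoint) auto
  finally show ?thesis .
qed

text \<open>The contents of a word over pairs form a matrix whose row sums are the contents of the
  first coordinate and whose column sums are those of the second. Words with a given matrix form one
  orbit, so their stabilizers contribute exactly \<open>fact n\<close>.\<close>

lemma word_matrix_sum:
  fixes \<alpha> :: "nat \<Rightarrow> int"
  assumes total: "(\<Sum>j<k. \<alpha> j) = int n"
  defines "X \<equiv> {..<k} \<times> {..<k}"
  shows "(\<Sum>F | F \<in> {..<n} \<rightarrow>\<^sub>E X \<and> (\<forall>j<k. int (content n (snd \<circ> F) j) = \<alpha> j).
      alternant k (\<lambda>i. \<beta> i - int (content n (fst \<circ> F) i)) * card (stabilizer n F)) =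
      fact n * alt_h_coeff k k \<alpha> \<beta>"
proof -
  define S where "S = {F. F \<in> {..<n} \<rightarrow>\<^sub>E X \<and> (\<forall>j<k. int (content n (snd \<circ> F) j) = \<alpha> j)}"
  define T where "T = PiE {..<k} (\<lambda>t. compositions k (\<alpha> t))"
  define g where "g F = (\<lambda>j\<in>{..<k}. \<lambda>i\<in>{..<k}. content n F (i, j))" for F
  have "finite X" by (simp add: X_def)
  then have finS: "finite S" by (simp add: S_def finite_PiE)
  have finT: "finite T" by (simp add: T_def finite_PiE)
  have gS: "g ` S \<subseteq> T"
  proof
    fix c assume "c \<in> g ` S"
    then obtain F where F: "F \<in> S" "c = g F" by auto
    have Fp: "F \<in> {..<n} \<rightarrow>\<^sub>E ({..<k} \<times> {..<k})" using F(1) by (simp add: S_def X_def)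
    have "int (\<Sum>i<k. content n F (i, j)) = \<alpha> j" if "j < k" for j
      using F(1) that unfolding content_snd[OF Fp, symmetric] by (simp add: S_def)
    then show "c \<in> T" by (simp add: F(2) g_def T_def compositions_def)
  qed
  have "(\<Sum>F\<in>S. alternant k (\<lambda>i. \<beta> i - int (content n (fst \<circ> F) i)) * card (stabilizer n F)) =
    (\<Sum>c\<in>T. \<Sum>F\<in>{F \<in> S. g F = c}. alternant k (\<lambda>i. \<beta> i - int (content n (fst \<circ> F) i)) * card (stabilizer n F))"
    by (rule sum.group[OF finS finT gS, symmetric])
  also have "\<dots> = (\<Sum>c\<in>T. alternant k (\<lambda>i. \<beta> i - (\<Sum>t<k. int (c t i))) * fact n)"
  proof (rule sum.cong[OF refl])
    fix c assume c: "c \<in> T"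
    have c': "c t \<in> compositions k (\<alpha> t)" if "t < k" for t using c that by (auto simp: T_def)
    have ext: "c = g F \<longleftrightarrow> (\<forall>i<k. \<forall>j<k. content n F (i, j) = c j i)" for F
    proof
      assume *: "\<forall>i<k. \<forall>j<k. content n F (i, j) = c j i"
      show "c = g F"
      proof
        fix j show "c j = g F j"
        proof (cases "j < k")
          case True
          show ?thesis
          proof
            fix i show "c j i = g F j i"
              using True * c'[OF True] by (cases "i < k") (auto simp: g_def compositions_def PiE_def extensional_def)
          qed
        next
          case False
          then show ?thesis using c by (auto simp: T_def g_def PiE_def extensional_def)
        qed
      qed
    qed (simp add: g_def)
    have fib: "{F \<in> S. g F = c} = {F. F \<in> {..<n} \<rightarrow>\<^sub>E X \<and> (\<forall>x\<in>X. content n F x = (\<lambda>(i, j). c j i) x)}"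
    proof (intro equalityI subsetI)
      fix F assume "F \<in> {F \<in> S. g F = c}"
      then show "F \<in> {F. F \<in> {..<n} \<rightarrow>\<^sub>E X \<and> (\<forall>x\<in>X. content n F x = (\<lambda>(i, j). c j i) x)}"
        using ext[of F] by (auto simp: S_def X_def)
    next
      fix F assume F: "F \<in> {F. F \<in> {..<n} \<rightarrow>\<^sub>E X \<and> (\<forall>x\<in>X. content n F x = (\<lambda>(i, j). c j i) x)}"
      then have Fp: "F \<in> {..<n} \<rightarrow>\<^sub>E ({..<k} \<times> {..<k})" and Fc: "\<forall>i<k. \<forall>j<k. content n F (i, j) = c j i"
        by (auto simp: X_def)
      have "int (content n (snd \<circ> F) j) = \<alpha> j" if "j < k" for j
        using c'[OF that] Fc that by (simp add: content_snd[OF Fp] compositions_def)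
      then show "F \<in> {F \<in> S. g F = c}" using F ext[of F] Fc by (auto simp: S_def)
    qed
    have "alternant k (\<lambda>i. \<beta> i - int (content n (fst \<circ> F) i)) = alternant k (\<lambda>i. \<beta> i - (\<Sum>t<k. int (c t i)))"
      if F: "F \<in> {F \<in> S. g F = c}" for F
    proof (rule alternant_cong)
      fix i assume i: "i < k"
      have Fp: "F \<in> {..<n} \<rightarrow>\<^sub>E ({..<k} \<times> {..<k})" using F by (simp add: S_def X_def)
      have "content n F (i, j) = c j i" if "j < k" for j using ext[of F] F i that by auto
      then show "\<beta> i - int (content n (fst \<circ> F) i) = \<beta> i - (\<Sum>t<k. int (c t i))"
        by (simp add: content_fst[OF Fp])
    qed
    then have "(\<Sum>F\<in>{F \<in> S. g F = c}. alternant k (\<lambda>i. \<beta> i - int (content n (fst \<circ> F) i)) * card (stabilizer n F)) =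
      alternant k (\<lambda>i. \<beta> i - (\<Sum>t<k. int (c t i))) * (\<Sum>F\<in>{F \<in> S. g F = c}. real (card (stabilizer n F)))"
      by (simp add: sum_distrib_left)
    also have "(\<Sum>F\<in>{F \<in> S. g F = c}. real (card (stabilizer n F))) = fact n"
      unfolding fib
    proof (rule burnside_content)
      have "int (\<Sum>x\<in>X. (\<lambda>(i, j). c j i) x) = int (\<Sum>j<k. \<Sum>i<k. c j i)"
        unfolding X_def sum.cartesian_product[symmetric] by (subst sum.swap) (rule refl)
      also have "\<dots> = (\<Sum>j<k. \<alpha> j)"
        using c' unfolding of_nat_sum[of _ "{..<k}"] by (intro sum.cong refl) (simp add: compositions_def)
      finally show "(\<Sum>x\<in>X. (\<lambda>(i, j). c j i) x) = n" using total by linarith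
    qed (simp add: X_def)
    finally show "(\<Sum>F\<in>{F \<in> S. g F = c}. alternant k (\<lambda>i. \<beta> i - int (content n (fst \<circ> F) i)) * card (stabilizer n F)) =
        alternant k (\<lambda>i. \<beta> i - (\<Sum>t<k. int (c t i))) * fact n" .
  qed
  also have "\<dots> = fact n * alt_h_coeff k k \<alpha> \<beta>"
    by (simp add: alt_h_coeff_matrices T_def sum_distrib_left mult.commute)
  finally show ?thesis by (simp add: S_def)
qed

text \<open>After expanding both factors and exchanging the sums, each pair of words counts the
  permutations fixing both. Reading the pair as a single word over pairs of colours identifies this
  common stabilizer with the stabilizer of one word.\<close>

lemma word_pair_sum:
  fixes \<alpha> :: "nat \<Rightarrow> int"
  assumes total: "(\<Sum>j<k. \<alpha> j) = int n"
  shows "(\<Sum>p\<in>sym_group n. det_char n k \<beta> p *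
      card {h \<in> colourings n k. h \<circ> p = h \<and> (\<forall>j<k. int (content n h j) = \<alpha> j)}) =
    fact n * alt_h_coeff k k \<alpha> \<beta>"
proof -
  let ?A = "{h \<in> colourings n k. \<forall>j<k. int (content n h j) = \<alpha> j}"
  let ?a = "\<lambda>f. alternant k (\<lambda>i. \<beta> i - int (content n f i))"
  let ?S = "{F. F \<in> {..<n} \<rightarrow>\<^sub>E ({..<k} \<times> {..<k}) \<and> (\<forall>j<k. int (content n (snd \<circ> F) j) = \<alpha> j)}"
  have ind: "(\<Sum>p\<in>sym_group n. if f \<circ> p = f \<and> h \<circ> p = h then x else 0) = x * card (stabilizer n f \<inter> stabilizer n h)"
    for f h :: "nat \<Rightarrow> nat" and x :: real
  proof -
    have "stabilizer n f \<inter> stabilizer n h = {p \<in> sym_group n. f \<circ> p = f \<and> h \<circ> p = h}"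
      by (auto simp: stabilizer_def)
    then show ?thesis by (simp add: sum.inter_filter[symmetric])
  qed
  have exp: "det_char n k \<beta> p * card {h \<in> colourings n k. h \<circ> p = h \<and> (\<forall>j<k. int (content n h j) = \<alpha> j)} =
      (\<Sum>f\<in>colourings n k. \<Sum>h\<in>?A. if f \<circ> p = f \<and> h \<circ> p = h then ?a f else 0)" for p
  proof -
    have 1: "real (card {h \<in> colourings n k. h \<circ> p = h \<and> (\<forall>j<k. int (content n h j) = \<alpha> j)}) =
        (\<Sum>h\<in>?A. if h \<circ> p = h then 1 else 0)"
    proof -
      have "{h \<in> colourings n k. h \<circ> p = h \<and> (\<forall>j<k. int (content n h j) = \<alpha> j)} = {h \<in> ?A. h \<circ> p = h}" by auto
      moreover have "finite ?A" by simp
      ultimately show ?thesis by (simp only: sum.inter_filter[symmetric]) simp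
    qed
    have 2: "det_char n k \<beta> p = (\<Sum>f\<in>colourings n k. if f \<circ> p = f then ?a f else 0)"
      unfolding det_char_def by (rule sum.inter_filter) simp
    show ?thesis unfolding 1 2 sum_product by (intro sum.cong refl) auto
  qed
  have "(\<Sum>p\<in>sym_group n. det_char n k \<beta> p *
      card {h \<in> colourings n k. h \<circ> p = h \<and> (\<forall>j<k. int (content n h j) = \<alpha> j)}) =
    (\<Sum>p\<in>sym_group n. \<Sum>(f, h)\<in>colourings n k \<times> ?A. if f \<circ> p = f \<and> h \<circ> p = h then ?a f else 0)"
    unfolding exp sum.cartesian_product ..
  also have "\<dots> = (\<Sum>(f, h)\<in>colourings n k \<times> ?A. ?a f * card (stabilizer n f \<inter> stabilizer n h))"
    by (subst sum.swap) (simp add: case_prod_unfold ind)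
  also have "\<dots> = (\<Sum>F\<in>?S. ?a (fst \<circ> F) * card (stabilizer n F))"
  proof (rule sum.reindex_bij_witness[where i = "\<lambda>F. (restrict (fst \<circ> F) {..<n}, restrict (snd \<circ> F) {..<n})"
        and j = "\<lambda>(f, h). restrict (\<lambda>x. (f x, h x)) {..<n}"])
    have cont2: "content n (snd \<circ> restrict (\<lambda>x. (f x, h x)) {..<n}) = content n h"
      "content n (fst \<circ> restrict (\<lambda>x. (f x, h x)) {..<n}) = content n f" for f h :: "nat \<Rightarrow> nat"
    proof -
      show "content n (snd \<circ> restrict (\<lambda>x. (f x, h x)) {..<n}) = content n h"
      proof
        fix i show "content n (snd \<circ> restrict (\<lambda>x. (f x, h x)) {..<n}) i = content n h i"
          unfolding content_def by (rule arg_cong[where f = card]) auto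
      qed
      show "content n (fst \<circ> restrict (\<lambda>x. (f x, h x)) {..<n}) = content n f"
      proof
        fix i show "content n (fst \<circ> restrict (\<lambda>x. (f x, h x)) {..<n}) i = content n f i"
          unfolding content_def by (rule arg_cong[where f = card]) auto
      qed
    qed
    fix fh assume fh: "fh \<in> colourings n k \<times> ?A"
    obtain f h where e: "fh = (f, h)" by (cases fh)
    have f: "f \<in> {..<n} \<rightarrow>\<^sub>E {..<k}" and h: "h \<in> {..<n} \<rightarrow>\<^sub>E {..<k}" using fh e by (auto simp: colourings_def)
    have "restrict (fst \<circ> restrict (\<lambda>x. (f x, h x)) {..<n}) {..<n} = f"
      "restrict (snd \<circ> restrict (\<lambda>x. (f x, h x)) {..<n}) {..<n} = h"
      using f h by (auto simp: fun_eq_iff PiE_def extensional_def)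
    then show "(restrict (fst \<circ> (case fh of (f, h) \<Rightarrow> restrict (\<lambda>x. (f x, h x)) {..<n})) {..<n},
      restrict (snd \<circ> (case fh of (f, h) \<Rightarrow> restrict (\<lambda>x. (f x, h x)) {..<n})) {..<n}) = fh"
      by (simp add: e)
    show "(case fh of (f, h) \<Rightarrow> restrict (\<lambda>x. (f x, h x)) {..<n}) \<in> ?S"
      using f h fh by (auto simp: e cont2)
    have "stabilizer n (restrict (\<lambda>x. (f x, h x)) {..<n}) = stabilizer n (\<lambda>x. (f x, h x))"
      by (rule stabilizer_cong) simp
    also have "\<dots> = stabilizer n f \<inter> stabilizer n h"
      by (auto simp: stabilizer_def fun_eq_iff)
    finally show "?a (fst \<circ> (case fh of (f, h) \<Rightarrow> restrict (\<lambda>x. (f x, h x)) {..<n})) *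
        real (card (stabilizer n (case fh of (f, h) \<Rightarrow> restrict (\<lambda>x. (f x, h x)) {..<n}))) =
      (case fh of (f, h) \<Rightarrow> ?a f * real (card (stabilizer n f \<inter> stabilizer n h)))"
      by (simp add: e cont2)
  next
    have cont: "content n (restrict f {..<n}) = content n f" for f :: "nat \<Rightarrow> nat"
    proof
      fix i show "content n (restrict f {..<n}) i = content n f i"
        unfolding content_def by (rule arg_cong[where f = card]) auto
    qed
    fix F assume F: "F \<in> ?S"
    show "(case (restrict (fst \<circ> F) {..<n}, restrict (snd \<circ> F) {..<n}) of (f, h) \<Rightarrow> restrict (\<lambda>x. (f x, h x)) {..<n}) = F"
      using F by (auto simp: fun_eq_iff PiE_def extensional_def)
    have "fst (F x) < k" "snd (F x) < k" if "x < n" for x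
      using F that PiE_mem[of F "{..<n}" "\<lambda>_. {..<k} \<times> {..<k}" x] by (auto simp: mem_Times_iff)
    then show "(restrict (fst \<circ> F) {..<n}, restrict (snd \<circ> F) {..<n}) \<in> colourings n k \<times> ?A"
      using F by (auto simp: colourings_def cont)
  qed
  also have "\<dots> = fact n * alt_h_coeff k k \<alpha> \<beta>"
    by (rule word_matrix_sum[OF total])
  finally show ?thesis .
qed

text \<open>Only the second factor is expanded by Jacobi-Trudi; the pairing of the first one with
  each word character is a coefficient of the alternant times complete symmetric functions.\<close>

lemma det_char_pair:
  assumes "(\<Sum>i<k. \<gamma> i + int i) = int n"
  shows "(\<Sum>p\<in>sym_group n. det_char n k \<beta> p * det_char n k \<gamma> p) =
    fact n * (\<Sum>w\<in>sym_group k. rsgn w * alt_h_coeff k k (\<lambda>j. \<gamma> j + int (w j)) \<beta>)"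
proof -
  let ?N = "\<lambda>w p. real (card {f \<in> colourings n k. f \<circ> p = f \<and> (\<forall>i<k. int (content n f i) = \<gamma> i + int (w i))})"
  have "(\<Sum>p\<in>sym_group n. det_char n k \<beta> p * det_char n k \<gamma> p) =
      (\<Sum>p\<in>sym_group n. \<Sum>w\<in>sym_group k. rsgn w * (det_char n k \<beta> p * ?N w p))"
    unfolding det_char_words[of n k \<gamma>] by (simp add: sum_distrib_left mult.left_commute)
  also have "\<dots> = (\<Sum>w\<in>sym_group k. rsgn w * (\<Sum>p\<in>sym_group n. det_char n k \<beta> p * ?N w p))"
    by (subst sum.swap) (simp add: sum_distrib_left)
  also have "\<dots> = (\<Sum>w\<in>sym_group k. rsgn w * (fact n * alt_h_coeff k k (\<lambda>j. \<gamma> j + int (w j)) \<beta>))"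
  proof (intro sum.cong refl arg_cong2[where f = "(*)"])
    fix w assume "w \<in> sym_group k"
    then have "(\<Sum>j<k. \<gamma> j + int (w j)) = int n"
      using assms sum_sym_group_values[of w k int] by (simp add: sum.distrib)
    then show "(\<Sum>p\<in>sym_group n. det_char n k \<beta> p * ?N w p) = fact n * alt_h_coeff k k (\<lambda>j. \<gamma> j + int (w j)) \<beta>"
      by (rule word_pair_sum)
  qed
  finally show ?thesis by (simp add: sum_distrib_left mult.left_commute)
qed

section \<open>Partial sums of permutations and the orthonormality relations\<close>

lemma sum_initial_le_sum: "finite A \<Longrightarrow> (\<Sum>i<card A. i) \<le> \<Sum>A" for A :: "nat set"
proof (induction "card A" arbitrary: A)
  case (Suc c)
  define m where "m = Max A"
  have m: "m \<in> A" "\<And>x. x \<in> A \<Longrightarrow> x \<le> m" using Suc.prems Suc.hyps(2) by (auto simp: m_def intro!: Max_in)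
  have "A \<subseteq> {..m}" using m(2) by auto
  then have "card A \<le> Suc m" using card_mono[of "{..m}" A] by simp
  then have "c \<le> m" using Suc.hyps(2) by simp
  moreover have "(\<Sum>i<c. i) \<le> \<Sum>(A - {m})"
  proof -
    have "c = card (A - {m})" using Suc.hyps(2) Suc.prems m(1) by simp
    then show ?thesis using Suc.hyps(1)[of "A - {m}"] Suc.prems by simp
  qed
  moreover have "\<Sum>A = m + \<Sum>(A - {m})" using Suc.prems m(1) by (simp add: sum.remove)
  ultimately show ?case by (simp flip: Suc.hyps(2))
qed simp

lemma sym_group_partial_sum:
  assumes w: "w \<in> sym_group k"
  shows "(\<Sum>i<t. int i) \<le> (\<Sum>i<t. int (w i))"
proof -
  have inj: "inj_on w {..<t}" using sym_groupD(4)[OF w] by (rule inj_on_subset) simp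
  have "(\<Sum>i<t. i) \<le> (\<Sum>i<t. w i)"
    using sum_initial_le_sum[of "w ` {..<t}"] by (simp add: card_image[OF inj] sum.reindex[OF inj])
  then have "int (\<Sum>i<t. i) \<le> int (\<Sum>i<t. w i)" by (simp only: of_nat_le_iff)
  then show ?thesis by simp
qed

lemma sym_group_partial_sum_strict:
  assumes w: "w \<in> sym_group k" and "w \<noteq> id"
  obtains t where "t \<le> k" "(\<Sum>i<t. int i) < (\<Sum>i<t. int (w i))"
proof -
  have "\<exists>t\<le>k. (\<Sum>i<t. int i) < (\<Sum>i<t. int (w i))"
  proof (rule ccontr)
    assume "\<not> (\<exists>t\<le>k. (\<Sum>i<t. int i) < (\<Sum>i<t. int (w i)))"
    then have eq: "(\<Sum>i<t. int (w i)) = (\<Sum>i<t. int i)" if "t \<le> k" for t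
    proof -
      have "\<not> (\<Sum>i<t. int i) < (\<Sum>i<t. int (w i))"
        using \<open>\<not> (\<exists>t\<le>k. (\<Sum>i<t. int i) < (\<Sum>i<t. int (w i)))\<close> that by blast
      then show ?thesis using sym_group_partial_sum[OF w, of t] by linarith
    qed
    have "w i = i" for i
    proof (cases "i < k")
      case True
      then show ?thesis using eq[of "Suc i"] eq[of i] by simp
    next
      case False
      then show ?thesis using sym_groupD(1)[OF w] by (auto simp: permutes_def)
    qed
    then show False using assms(2) by auto
  qed
  then show ?thesis using that by blast
qed

text \<open>A nonzero summand for \<open>w\<close> bounds the partial sums of \<mu> by those of
  \<nu> minus a correction that is never negative, and strictly positive somewhere unless
  \<open>w = id\<close>. Hence a partial sum in which \<mu> exceeds \<nu> kills everything; the
  opposite case follows by exchanging the factors, and for equal shapes only \<open>w = id\<close>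
  contributes.\<close>

theorem det_char_orthonormal:
  assumes anti: "antitone_upto k \<nu>" "antitone_upto k \<mu>"
    and nonneg: "\<And>i. i < k \<Longrightarrow> 0 \<le> \<nu> i" "\<And>i. i < k \<Longrightarrow> 0 \<le> \<mu> i"
    and total: "(\<Sum>i<k. \<nu> i) = int n" "(\<Sum>i<k. \<mu> i) = int n"
  shows "(\<Sum>p\<in>sym_group n. det_char n k (\<lambda>i. \<nu> i - int i) p * det_char n k (\<lambda>i. \<mu> i - int i) p) =
    (if \<forall>i<k. \<nu> i = \<mu> i then fact n else 0)"
proof -
  have pair: "(\<Sum>p\<in>sym_group n. det_char n k (\<lambda>i. \<nu> i - int i) p * det_char n k (\<lambda>i. \<mu> i - int i) p) =
     fact n * (\<Sum>w\<in>sym_group k. rsgn w * alt_h_coeff k k (\<lambda>j. \<mu> j - int j + int (w j)) (\<lambda>i. \<nu> i - int i))"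
    if "(\<Sum>i<k. \<mu> i) = int n" for \<nu> \<mu>
    by (rule det_char_pair) (simp add: that)
  have dom: "(\<Sum>i<t. \<mu> i) \<le> (\<Sum>i<t. \<nu> i) - ((\<Sum>i<t. int (w i)) - (\<Sum>i<t. int i))"
    if "antitone_upto k \<nu>" "alt_h_coeff k k (\<lambda>j. \<mu> j - int j + int (w j)) (\<lambda>i. \<nu> i - int i) \<noteq> 0" "t \<le> k" for \<nu> \<mu> w t
    using alt_h_coeff_dominance[OF that(1,2,3)] by (simp add: sum.distrib sum_subtractf)
  have zero: "(\<Sum>p\<in>sym_group n. det_char n k (\<lambda>i. \<nu> i - int i) p * det_char n k (\<lambda>i. \<mu> i - int i) p) = 0"
    if "antitone_upto k \<nu>" "(\<Sum>i<k. \<mu> i) = int n" "t \<le> k" "(\<Sum>i<t. \<nu> i) < (\<Sum>i<t. \<mu> i)" for \<nu> \<mu> t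
  proof -
    have "rsgn w * alt_h_coeff k k (\<lambda>j. \<mu> j - int j + int (w j)) (\<lambda>i. \<nu> i - int i) = 0" if "w \<in> sym_group k" for w
      using dom[OF \<open>antitone_upto k \<nu>\<close>, of \<mu> w t] sym_group_partial_sum[OF that, of t] \<open>t \<le> k\<close> \<open>(\<Sum>i<t. \<nu> i) < (\<Sum>i<t. \<mu> i)\<close>
      by fastforce
    then have "(\<Sum>w\<in>sym_group k. rsgn w * alt_h_coeff k k (\<lambda>j. \<mu> j - int j + int (w j)) (\<lambda>i. \<nu> i - int i)) = 0"
      by (rule sum.neutral[OF ballI])
    then show ?thesis unfolding pair[OF that(2)] by (simp only: mult_zero_right)
  qed
  show ?thesis
  proof (cases "\<forall>i<k. \<nu> i = \<mu> i")
    case True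
    have "rsgn w * alt_h_coeff k k (\<lambda>j. \<mu> j - int j + int (w j)) (\<lambda>i. \<nu> i - int i) = (if w = id then 1 else 0)"
      if w: "w \<in> sym_group k" for w
    proof (cases "w = id")
      case True
      have "alt_h_coeff k k (\<lambda>j. \<mu> j - int j + int (w j)) (\<lambda>i. \<nu> i - int i) = 1"
        using anti nonneg \<open>\<forall>i<k. \<nu> i = \<mu> i\<close> True by (intro alt_h_coeff_diagonal) auto
      then show ?thesis using True by simp
    next
      case False
      obtain t where t: "t \<le> k" "(\<Sum>i<t. int i) < (\<Sum>i<t. int (w i))"
        using sym_group_partial_sum_strict[OF w False] by blast
      have "(\<Sum>i<t. \<nu> i) = (\<Sum>i<t. \<mu> i)" using True t(1) by (intro sum.cong) auto
      then show ?thesis using dom[OF anti(1), of \<mu> w t] t False by fastforce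
    qed
    then have "(\<Sum>w\<in>sym_group k. rsgn w * alt_h_coeff k k (\<lambda>j. \<mu> j - int j + int (w j)) (\<lambda>i. \<nu> i - int i)) =
        (\<Sum>w\<in>sym_group k. if w = id then 1 else 0)"
      by (rule sum.cong[OF refl])
    then show ?thesis
      unfolding pair[OF total(2)] using True sum.delta[of "sym_group k" id "\<lambda>_. 1::real"] by simp
  next
    case False
    have "\<exists>t\<le>k. (\<Sum>i<t. \<nu> i) \<noteq> (\<Sum>i<t. \<mu> i)"
    proof (rule ccontr)
      assume "\<not> (\<exists>t\<le>k. (\<Sum>i<t. \<nu> i) \<noteq> (\<Sum>i<t. \<mu> i))"
      then have *: "(\<Sum>i<t. \<nu> i) = (\<Sum>i<t. \<mu> i)" if "t \<le> k" for t using that by blast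
      have "\<nu> i = \<mu> i" if "i < k" for i using *[of "Suc i"] *[of i] that by simp
      then show False using False by blast
    qed
    then obtain t where t: "t \<le> k" "(\<Sum>i<t. \<nu> i) \<noteq> (\<Sum>i<t. \<mu> i)" by blast
    then show ?thesis
      using zero[OF anti(1) total(2) t(1)] zero[OF anti(2) total(1) t(1)] False
      by (cases "(\<Sum>i<t. \<nu> i) < (\<Sum>i<t. \<mu> i)") (auto simp: mult.commute)
  qed
qed

section \<open>The Frobenius formula for Specht characters\<close>

lemma antitone_row_len: "l \<in> partitions_of n \<Longrightarrow> antitone_upto k (\<lambda>i. int (row_len l i))"
  by (simp add: antitone_upto_def row_len_antimono[of l n])

lemma length_partition_le:
  assumes "l \<in> partitions_of n" shows "length l \<le> n"
proof -
  have "0 \<notin> set l \<Longrightarrow> length l \<le> sum_list l" by (induction l) auto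
  then show ?thesis using assms by (simp add: partitions_of_def)
qed

theorem specht_char_frobenius:
  assumes l: "l \<in> partitions_of n" and k: "length l \<le> k" and p: "p \<in> sym_group n"
  shows "specht_char l p = det_char n k (\<lambda>i. int (row_len l i) - int i) p"
proof -
  let ?\<psi> = "det_char n k (\<lambda>i. int (row_len l i) - int i)"
  have tot: "(\<Sum>i<k. int (row_len l i)) = int n"
    using sum_row_len_total[OF k] size_l[OF l] by (simp flip: of_nat_sum)
  have psi: "(\<Sum>p\<in>sym_group n. ?\<psi> p * ?\<psi> p) = fact n"
    using det_char_orthonormal[OF antitone_row_len[OF l, of k] antitone_row_len[OF l, of k] _ _ tot tot] by simp
  \<comment> \<open>For w other than the identity some partial sum of w is larger than that of the
    identity, so the content \<lambda>_i - i + w(i) overshoots \<lambda> there and its word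
    character is annihilated.\<close>
  have cross: "(\<Sum>p\<in>sym_group n. ?\<psi> p * specht_char l p) = fact n"
    unfolding det_char_words
  proof (rule specht_char_pair_words[OF l k, where ?w0.0 = id])
    fix w assume w: "w \<in> sym_group k" "w \<noteq> id"
    obtain t where t: "t \<le> k" "(\<Sum>i<t. int i) < (\<Sum>i<t. int (w i))"
      using sym_group_partial_sum_strict[OF w] by blast
    then show "\<exists>t\<le>k. (\<Sum>i<t. int (row_len l i)) < (\<Sum>i<t. int (row_len l i) - int i + int (w i))"
      by (intro exI[of _ t]) (simp add: sum.distrib sum_subtractf)
  next
    fix g p assume "g \<in> sym_group n" "p \<in> sym_group n"
    then show "(\<Sum>w\<in>sym_group k. rsgn w * real (card {f \<in> colourings n k. f \<circ> (g \<circ> p \<circ> inv g) = f \<and>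
          (\<forall>i<k. int (content n f i) = int (row_len l i) - int i + int (w i))})) =
       (\<Sum>w\<in>sym_group k. rsgn w * real (card {f \<in> colourings n k. f \<circ> p = f \<and>
          (\<forall>i<k. int (content n f i) = int (row_len l i) - int i + int (w i))}))"
      using det_char_conj[of g n p k "\<lambda>i. int (row_len l i) - int i"] by (simp only: det_char_words)
  qed auto
  \<comment> \<open>Equality in Cauchy-Schwarz: the squared distance of the two real functions is n!
    + n! - 2 n! = 0, so each summand vanishes.\<close>
  have "(\<Sum>p\<in>sym_group n. (?\<psi> p - specht_char l p)\<^sup>2) =
     (\<Sum>p\<in>sym_group n. ?\<psi> p * ?\<psi> p) + (\<Sum>p\<in>sym_group n. specht_char l p * specht_char l p)
       - 2 * (\<Sum>p\<in>sym_group n. ?\<psi> p * specht_char l p)"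
    by (simp add: power2_eq_square algebra_simps sum.distrib sum_subtractf sum_distrib_left)
  also have "\<dots> = 0" using psi cross specht_char_norm[OF l] by simp
  finally have "(?\<psi> p - specht_char l p)\<^sup>2 = 0"
    using p by (subst (asm) sum_nonneg_eq_0_iff) auto
  then show ?thesis by simp
qed

section \<open>Branching rules\<close>

lemma colourings_Suc: "colourings (Suc n) k = (\<lambda>(i, g). g(n := i)) ` ({..<k} \<times> colourings n k)"
  by (simp add: colourings_def lessThan_Suc PiE_insert_eq)

lemma inj_colourings_Suc: "inj_on (\<lambda>(i, g). g(n := i)) ({..<k} \<times> colourings n k)"
  unfolding colourings_def by (rule inj_combinator) simp

lemma content_fun_upd_new:
  "content (Suc n) (g(n := i)) m = content n g m + (if m = i then 1 else 0)"
proof -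
  have "{x. x < Suc n \<and> (g(n := i)) x = m} = {x. x < n \<and> g x = m} \<union> (if m = i then {n} else {})"
    by (auto simp: less_Suc_eq)
  then show ?thesis by (simp add: content_def card_Un_disjoint)
qed

text \<open>The fixed point \<open>n\<close> may take any colour, and colour \<open>i\<close> uses
  up one unit of the exponent at \<open>i\<close>: multiplication by the power sum p_1.\<close>

lemma det_char_Suc:
  assumes p: "p \<in> sym_group n"
  shows "det_char (Suc n) k \<beta> p = (\<Sum>i<k. det_char n k (\<beta>(i := \<beta> i - 1)) p)"
proof -
  have pn: "p x = n \<longleftrightarrow> x = n" "p n = n" for x
  proof -
    show "p n = n" using sym_groupD(1)[OF p] by (auto simp: permutes_def)
    then show "p x = n \<longleftrightarrow> x = n" using sym_groupD(4)[OF p] by (metis injD)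
  qed
  have fix_iff: "g(n := i) \<circ> p = g(n := i) \<longleftrightarrow> g \<circ> p = g" if "g \<in> colourings n k" for g i
  proof
    assume *: "g(n := i) \<circ> p = g(n := i)"
    show "g \<circ> p = g"
    proof
      fix x show "(g \<circ> p) x = g x"
      proof (cases "x = n")
        case True
        then show ?thesis by (simp only: o_def pn(2))
      next
        case False
        then show ?thesis using fun_cong[OF *, of x] pn(1)[of x] by simp
      qed
    qed
  next
    assume *: "g \<circ> p = g"
    show "g(n := i) \<circ> p = g(n := i)"
    proof
      fix x show "(g(n := i) \<circ> p) x = (g(n := i)) x"
        using fun_cong[OF *, of x] pn(1)[of x] by simp
    qed
  qed
  have "det_char (Suc n) k \<beta> p = (\<Sum>f\<in>colourings (Suc n) k. if f \<circ> p = f then alternant k (\<lambda>m. \<beta> m - int (content (Suc n) f m)) else 0)"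
    unfolding det_char_def by (rule sum.inter_filter) simp
  also have "\<dots> = (\<Sum>(i, g)\<in>{..<k} \<times> colourings n k. if g(n := i) \<circ> p = g(n := i) then alternant k (\<lambda>m. \<beta> m - int (content (Suc n) (g(n := i)) m)) else 0)"
    unfolding colourings_Suc by (subst sum.reindex[OF inj_colourings_Suc]) (simp add: case_prod_unfold)
  also have "\<dots> = (\<Sum>(i, g)\<in>{..<k} \<times> colourings n k. if g \<circ> p = g then alternant k (\<lambda>m. (\<beta>(i := \<beta> i - 1)) m - int (content n g m)) else 0)"
  proof (intro sum.cong refl, clarify)
    fix i g assume "g \<in> colourings n k"
    have "(\<lambda>m. \<beta> m - int (content (Suc n) (g(n := i)) m)) = (\<lambda>m. (\<beta>(i := \<beta> i - 1)) m - int (content n g m))"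
      by (auto simp: content_fun_upd_new)
    then show "(if g(n := i) \<circ> p = g(n := i) then alternant k (\<lambda>m. \<beta> m - int (content (Suc n) (g(n := i)) m)) else 0) =
      (if g \<circ> p = g then alternant k (\<lambda>m. (\<beta>(i := \<beta> i - 1)) m - int (content n g m)) else 0)"
      by (simp only: fix_iff[OF \<open>g \<in> colourings n k\<close>])
  qed
  also have "\<dots> = (\<Sum>i<k. \<Sum>g\<in>colourings n k. if g \<circ> p = g then alternant k (\<lambda>m. (\<beta>(i := \<beta> i - 1)) m - int (content n g m)) else 0)"
    by (rule sum.cartesian_product[symmetric])
  also have "\<dots> = (\<Sum>i<k. det_char n k (\<beta>(i := \<beta> i - 1)) p)"
    unfolding det_char_def by (intro sum.cong refl sum.inter_filter[symmetric]) simp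
  finally show ?thesis .
qed

text \<open>The two points of the extra cycle must share a colour, which uses up two units of one
  exponent: multiplication by the power sum p_2.\<close>

lemma det_char_transposition:
  assumes p: "p \<in> sym_group n"
  defines "\<tau> \<equiv> transpose n (Suc n)"
  shows "det_char (Suc (Suc n)) k \<beta> (p \<circ> \<tau>) = (\<Sum>i<k. det_char n k (\<beta>(i := \<beta> i - 2)) p)"
proof -
  define ex where "ex = (\<lambda>(i, g :: nat \<Rightarrow> nat). g(n := i, Suc n := i))"
  have pn: "p n = n" "p (Suc n) = Suc n" using sym_groupD(1)[OF p] by (auto simp: permutes_def)
  have pne: "p x = n \<longleftrightarrow> x = n" "p x = Suc n \<longleftrightarrow> x = Suc n" for x
    using pn sym_groupD(4)[OF p] by (metis injD)+
  have \<tau>: "\<tau> n = Suc n" "\<tau> (Suc n) = n" "\<And>x. x \<noteq> n \<Longrightarrow> x \<noteq> Suc n \<Longrightarrow> \<tau> x = x"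
    by (auto simp: \<tau>_def)
  have inj: "inj_on ex ({..<k} \<times> {g \<in> colourings n k. g \<circ> p = g})"
  proof (rule inj_onI, clarify)
    fix i g i' g' assume g: "g \<in> colourings n k" "g' \<in> colourings n k" and eq: "ex (i, g) = ex (i', g')"
    have "i = i'" using fun_cong[OF eq, of n] by (simp add: ex_def)
    moreover have "g x = g' x" for x
    proof (cases "x < n")
      case True
      then show ?thesis using fun_cong[OF eq, of x] by (simp add: ex_def)
    qed (use g in \<open>auto simp: colourings_def PiE_def extensional_def\<close>)
    ultimately show "i = i' \<and> g = g'" by auto
  qed
  have img: "{f. f \<in> colourings (Suc (Suc n)) k \<and> f \<circ> (p \<circ> \<tau>) = f} = ex ` ({..<k} \<times> {g \<in> colourings n k. g \<circ> p = g})"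
  proof (intro equalityI subsetI)
    fix f assume "f \<in> {f. f \<in> colourings (Suc (Suc n)) k \<and> f \<circ> (p \<circ> \<tau>) = f}"
    then have f: "f \<in> {..<Suc (Suc n)} \<rightarrow>\<^sub>E {..<k}" and fp: "\<And>x. f (p (\<tau> x)) = f x"
      by (auto simp: colourings_def o_def fun_eq_iff)
    have fn: "f (Suc n) = f n" using fp[of n] \<tau> pn by simp
    define g where "g = restrict f {..<n}"
    have fg: "f = ex (f n, g)"
    proof
      fix x
      consider "x < n" | "x = n" | "x = Suc n" | "Suc n < x" by linarith
      then show "f x = ex (f n, g) x"
      proof cases
        case 4
        then have "f x = undefined" using f by (auto simp: PiE_def extensional_def)
        then show ?thesis using 4 by (simp add: ex_def g_def)
      next
        case 3
        then show ?thesis using fn by (simp add: ex_def)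
      qed (simp_all add: ex_def g_def)
    qed
    have "f x < k" if "x < Suc (Suc n)" for x using PiE_mem[OF f, of x] that by simp
    then have gc: "g \<in> colourings n k" and fk: "f n < k" by (simp_all add: g_def colourings_def)
    moreover have "g \<circ> p = g"
    proof
      fix x
      have "p x < n \<longleftrightarrow> x < n" using permutes_in_image[OF sym_groupD(1)[OF p], of x] by simp
      then show "(g \<circ> p) x = g x" using fp[of x] \<tau>(3)[of x] by (cases "x < n") (simp_all add: g_def)
    qed
    ultimately show "f \<in> ex ` ({..<k} \<times> {g \<in> colourings n k. g \<circ> p = g})"
      using fk by (intro image_eqI[of f ex "(f n, g)"] fg) simp
  next
    fix f assume "f \<in> ex ` ({..<k} \<times> {g \<in> colourings n k. g \<circ> p = g})"
    then obtain i g where ig: "i < k" "g \<in> {..<n} \<rightarrow>\<^sub>E {..<k}" "\<And>x. g (p x) = g x" "f = g(n := i, Suc n := i)"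
      by (auto simp: ex_def colourings_def o_def fun_eq_iff)
    have "f \<in> colourings (Suc (Suc n)) k"
      using ig(1,2) unfolding ig(4) colourings_def lessThan_Suc
      by (auto simp: PiE_def Pi_def extensional_def)
    moreover have "f (p (\<tau> x)) = f x" for x
    proof -
      consider "x = n" | "x = Suc n" | "x \<noteq> n" "x \<noteq> Suc n" by blast
      then show ?thesis using \<tau> pn pne[of x] ig(3)[of x] by cases (auto simp: ig(4))
    qed
    ultimately show "f \<in> {f. f \<in> colourings (Suc (Suc n)) k \<and> f \<circ> (p \<circ> \<tau>) = f}"
      by (auto simp: fun_eq_iff)
  qed
  have cont: "content (Suc (Suc n)) (ex (i, g)) m = content n g m + (if m = i then 2 else 0)" for i g m
    by (simp add: ex_def content_fun_upd_new)
  have "det_char (Suc (Suc n)) k \<beta> (p \<circ> \<tau>) =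
     (\<Sum>ig\<in>{..<k} \<times> {g \<in> colourings n k. g \<circ> p = g}. alternant k (\<lambda>m. \<beta> m - int (content (Suc (Suc n)) (ex ig) m)))"
    unfolding det_char_def img by (subst sum.reindex[OF inj]) simp
  also have "\<dots> = (\<Sum>(i, g)\<in>{..<k} \<times> {g \<in> colourings n k. g \<circ> p = g}. alternant k (\<lambda>m. (\<beta>(i := \<beta> i - 2)) m - int (content n g m)))"
  proof (intro sum.cong refl, clarify)
    fix i g
    have "(\<lambda>m. \<beta> m - int (content (Suc (Suc n)) (ex (i, g)) m)) = (\<lambda>m. (\<beta>(i := \<beta> i - 2)) m - int (content n g m))"
      by (auto simp: cont)
    then show "alternant k (\<lambda>m. \<beta> m - int (content (Suc (Suc n)) (ex (i, g)) m)) =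
        alternant k (\<lambda>m. (\<beta>(i := \<beta> i - 2)) m - int (content n g m))"
      by (rule arg_cong)
  qed
  also have "\<dots> = (\<Sum>i<k. det_char n k (\<beta>(i := \<beta> i - 2)) p)"
    unfolding det_char_def sum.cartesian_product[symmetric] by simp
  finally show ?thesis .
qed

section \<open>Young diagrams as sets of boxes\<close>

definition down_closed :: "(nat \<times> nat) set \<Rightarrow> bool" where
  "down_closed D \<longleftrightarrow> (\<forall>i j i' j'. (i, j) \<in> D \<longrightarrow> i' \<le> i \<longrightarrow> j' \<le> j \<longrightarrow> (i', j') \<in> D)"

definition ferrers :: "nat \<Rightarrow> (nat \<times> nat) set set" where
  "ferrers n = {D. finite D \<and> down_closed D \<and> card D = n}"

definition rows :: "(nat \<times> nat) set \<Rightarrow> nat \<Rightarrow> nat" where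
  "rows D i = card {j. (i, j) \<in> D}"

text \<open>The number \<open>k\<close> of variables is kept apart from the size \<open>n\<close>,
  so that restriction to smaller symmetric groups lowers \<open>n\<close> while the exponents keep
  the same length.\<close>

definition diagram_char :: "nat \<Rightarrow> nat \<Rightarrow> (nat \<times> nat) set \<Rightarrow> (nat \<Rightarrow> nat) \<Rightarrow> real" where
  "diagram_char n k D = det_char n k (\<lambda>i. int (rows D i) - int i)"

lemma down_closedD: "down_closed D \<Longrightarrow> (i, j) \<in> D \<Longrightarrow> i' \<le> i \<Longrightarrow> j' \<le> j \<Longrightarrow> (i', j') \<in> D"
  by (auto simp: down_closed_def)

lemma ferrersD:
  assumes "D \<in> ferrers n"
  shows "finite D" "down_closed D" "card D = n"
  using assms by (auto simp: ferrers_def)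

lemma rows_iff:
  assumes "finite D" "down_closed D"
  shows "(i, j) \<in> D \<longleftrightarrow> j < rows D i"
proof -
  have "{j. (i, j) \<in> D} \<subseteq> snd ` D" by force
  then have fin: "finite {j. (i, j) \<in> D}" using assms(1) by (auto intro: finite_subset)
  show ?thesis
  proof
    assume "(i, j) \<in> D"
    then have "{..j} \<subseteq> {j. (i, j) \<in> D}" using down_closedD[OF assms(2)] by auto
    then have "card {..j} \<le> rows D i" unfolding rows_def by (rule card_mono[OF fin])
    then show "j < rows D i" by simp
  next
    assume j: "j < rows D i"
    show "(i, j) \<in> D"
    proof (rule ccontr)
      assume "(i, j) \<notin> D"
      then have "{j. (i, j) \<in> D} \<subseteq> {..<j}"
        using down_closedD[OF assms(2), of i _ i j] by (auto simp: not_less[symmetric])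
      then have "rows D i \<le> j" unfolding rows_def using card_mono[of "{..<j}"] by fastforce
      then show False using j by simp
    qed
  qed
qed

lemma ferrers_iff: "D \<in> ferrers n \<Longrightarrow> (i, j) \<in> D \<longleftrightarrow> j < rows D i"
  by (rule rows_iff) (auto dest: ferrersD)

lemma rows_antimono:
  assumes "D \<in> ferrers n" "i \<le> i'" shows "rows D i' \<le> rows D i"
proof (rule ccontr)
  assume "\<not> rows D i' \<le> rows D i"
  then have "(i', rows D i) \<in> D" using ferrers_iff[OF assms(1)] by simp
  then have "(i, rows D i) \<in> D" using down_closedD[OF ferrersD(2)[OF assms(1)]] assms(2) by blast
  then show False using ferrers_iff[OF assms(1)] by simp
qed

lemma rows_zero:
  assumes D: "D \<in> ferrers n" and "n \<le> i" shows "rows D i = 0"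
proof (rule ccontr)
  assume "rows D i \<noteq> 0"
  then have "(i, 0) \<in> D" using ferrers_iff[OF D] by simp
  then have "(\<lambda>m. (m, 0)) ` {..i} \<subseteq> D" using down_closedD[OF ferrersD(2)[OF D]] by auto
  then have "card ((\<lambda>m. (m, 0 :: nat)) ` {..i}) \<le> n" using card_mono ferrersD[OF D] by metis
  moreover have "card ((\<lambda>m. (m, 0 :: nat)) ` {..i}) = Suc i" by (subst card_image) (auto simp: inj_on_def)
  ultimately show False using assms(2) by simp
qed

lemma ferrers_Sigma:
  assumes D: "D \<in> ferrers n" and "n \<le> k" shows "D = (SIGMA i:{..<k}. {..<rows D i})"
proof -
  have "i < k" if "(i, j) \<in> D" for i j
    using that rows_zero[OF D, of i] ferrers_iff[OF D, of i j] assms(2) by (cases "i < k") auto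
  then show ?thesis using ferrers_iff[OF D] by auto
qed

lemma sum_rows: 
  assumes D: "D \<in> ferrers n" and "n \<le> k" shows "(\<Sum>i<k. rows D i) = n"
proof -
  have "card D = card (SIGMA i:{..<k}. {..<rows D i})" using ferrers_Sigma[OF assms] by (rule arg_cong)
  then show ?thesis using ferrersD(3)[OF D] by simp
qed

lemma ferrers_eqI:
  assumes "D \<in> ferrers n" "E \<in> ferrers m" "\<And>i. rows D i = rows E i" shows "D = E"
  using ferrers_iff[OF assms(1)] ferrers_iff[OF assms(2)] assms(3) by auto

lemma finite_ferrers [simp]: "finite (ferrers n)"
proof (rule finite_subset)
  show "ferrers n \<subseteq> Pow ({..<n} \<times> {..<n})"
  proof
    fix D assume D: "D \<in> ferrers n"
    have "rows D i \<le> n" if "i < n" for i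
      using sum_rows[OF D, of n] member_le_sum[of i "{..<n}" "rows D"] that by simp
    then have "(SIGMA i:{..<n}. {..<rows D i}) \<subseteq> {..<n} \<times> {..<n}" by force
    then show "D \<in> Pow ({..<n} \<times> {..<n})"
      using ferrers_Sigma[OF D, of n] by simp
  qed
qed simp

lemma rows_young_diagram: "rows (young_diagram l) i = row_len l i"
proof -
  have "{j. (i, j) \<in> young_diagram l} = {..<row_len l i}" by (auto simp: young_diagram_row_len)
  then show ?thesis by (simp add: rows_def)
qed

lemma young_diagram_ferrers: "l \<in> partitions_of n \<Longrightarrow> young_diagram l \<in> ferrers n"
  using young_diagram_down[of l n] by (auto simp: ferrers_def down_closed_def card_young_diagram size_l)

lemma young_diagram_inj:
  assumes "l \<in> partitions_of n" "l' \<in> partitions_of m" "young_diagram l = young_diagram l'"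
  shows "l = l'"
proof -
  have r: "row_len l i = row_len l' i" for i using assms(3) rows_young_diagram by metis
  have pos: "i < length l \<longleftrightarrow> 0 < row_len l i" if "l \<in> partitions_of n" for l n i
  proof -
    have "0 \<notin> set l" using that by (simp add: partitions_of_def)
    then show ?thesis by (auto simp: row_len_def in_set_conv_nth)
  qed
  have "length l = length l'"
    using pos[OF assms(1)] pos[OF assms(2)] r by (metis linorder_neqE_nat less_irrefl)
  then show ?thesis
  proof (rule nth_equalityI)
    fix i assume "i < length l"
    then show "l ! i = l' ! i" using r[of i] \<open>length l = length l'\<close> by (simp add: row_len_def)
  qed
qed

lemma young_diagram_surj:
  assumes D: "D \<in> ferrers n"
  obtains l where "l \<in> partitions_of n" "young_diagram l = D"
proof -
  define r where "r = (LEAST i. rows D i = 0)"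
  have r0: "rows D r = 0" unfolding r_def by (rule LeastI[of _ n]) (simp add: rows_zero[OF D])
  have pos: "0 < rows D i" if "i < r" for i using not_less_Least[of i "\<lambda>i. rows D i = 0"] that by (simp add: r_def)
  have zero: "rows D i = 0" if "r \<le> i" for i using rows_antimono[OF D that] r0 by simp
  define l where "l = map (rows D) [0..<r]"
  have "young_diagram l = D"
  proof -
    have "(i, j) \<in> young_diagram l \<longleftrightarrow> (i, j) \<in> D" for i j
      using zero[of i] by (cases "i < r") (auto simp: young_diagram_def l_def ferrers_iff[OF D])
    then show ?thesis by auto
  qed
  moreover have "l \<in> partitions_of n"
  proof -
    have "sum_list l = n" using card_young_diagram[of l] calculation ferrersD(3)[OF D] by simp
    moreover have "sorted_wrt (\<ge>) l" by (auto simp: l_def sorted_wrt_iff_nth_less rows_antimono[OF D])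
    moreover have "0 \<notin> set l" by (auto simp: l_def) (metis pos less_irrefl)
    ultimately show ?thesis by (simp add: partitions_of_def)
  qed
  ultimately show ?thesis using that by blast
qed

lemma antitone_rows: "D \<in> ferrers n \<Longrightarrow> antitone_upto k (\<lambda>i. int (rows D i))"
  by (simp add: antitone_upto_def rows_antimono[of D n])

lemma diagram_char_orthonormal:
  assumes "D \<in> ferrers n" "E \<in> ferrers n" "n \<le> k"
  shows "(\<Sum>p\<in>sym_group n. diagram_char n k D p * diagram_char n k E p) = (if D = E then fact n else 0)"
proof -
  have "(\<forall>i<k. int (rows D i) = int (rows E i)) \<longleftrightarrow> D = E"
  proof
    assume *: "\<forall>i<k. int (rows D i) = int (rows E i)"
    have "rows D i = rows E i" for i
      using * rows_zero[OF assms(1), of i] rows_zero[OF assms(2), of i] assms(3) by (cases "i < k") auto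
    then show "D = E" by (rule ferrers_eqI[OF assms(1,2)])
  qed simp
  moreover have "(\<Sum>i<k. int (rows D i)) = int n" "(\<Sum>i<k. int (rows E i)) = int n"
    using sum_rows[OF assms(1,3)] sum_rows[OF assms(2,3)] by (simp_all flip: of_nat_sum)
  ultimately show ?thesis
    using det_char_orthonormal[OF antitone_rows[OF assms(1), of k] antitone_rows[OF assms(2), of k], of n]
    by (simp add: diagram_char_def)
qed

lemma rows_insert:
  assumes "finite E" "(a, b) \<notin> E"
  shows "rows (insert (a, b) E) = (rows E)(a := Suc (rows E a))"
proof
  fix i
  have "{j. (i, j) \<in> E} \<subseteq> snd ` E" by force
  then have fin: "finite {j. (i, j) \<in> E}" using assms(1) by (auto intro: finite_subset)
  show "rows (insert (a, b) E) i = ((rows E)(a := Suc (rows E a))) i"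
  proof (cases "i = a")
    case True
    then have "{j. (i, j) \<in> insert (a, b) E} = insert b {j. (i, j) \<in> E}" by auto
    then show ?thesis using True fin assms(2) by (simp add: rows_def)
  next
    case False
    then have "{j. (i, j) \<in> insert (a, b) E} = {j. (i, j) \<in> E}" by auto
    then show ?thesis using False by (simp add: rows_def)
  qed
qed

lemma down_closed_of_rows:
  fixes r :: "nat \<Rightarrow> nat"
  assumes "\<And>i. r (Suc i) \<le> r i" shows "down_closed {(i, j). j < r i}"
  unfolding down_closed_def
proof (intro allI impI)
  fix i j i' j' assume "(i, j) \<in> {(i, j). j < r i}" "i' \<le> i" "j' \<le> j"
  moreover have "r i \<le> r i'" using lift_Suc_antimono_le[of r] assms \<open>i' \<le> i\<close> by blast
  ultimately show "(i', j') \<in> {(i, j). j < r i}" by simp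
qed

lemma ferrers_remove:
  fixes r :: "nat \<Rightarrow> nat"
  assumes D: "D \<in> ferrers n" and r: "\<And>i. r (Suc i) \<le> r i" "\<And>i. r i \<le> rows D i"
    and diff: "D - {(i, j). j < r i} = X" "card X + m = n"
  shows "{(i, j). j < r i} \<in> ferrers m" "{(i, j). j < r i} \<subseteq> D" "rows {(i, j). j < r i} = r"
proof -
  show sub: "{(i, j). j < r i} \<subseteq> D"
    using r(2) ferrers_iff[OF D] by (auto intro: less_le_trans)
  have fin: "finite {(i, j). j < r i}" using sub ferrersD(1)[OF D] by (rule finite_subset)
  have "card D = card {(i, j). j < r i} + card X"
    using card_Diff_subset[OF fin sub] card_mono[OF ferrersD(1)[OF D] sub] diff(1) by simp
  then have "card {(i, j). j < r i} = m" using diff(2) ferrersD(3)[OF D] by simp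
  then show "{(i, j). j < r i} \<in> ferrers m"
    using fin down_closed_of_rows[of r] r(1) by (simp add: ferrers_def)
  show "rows {(i, j). j < r i} = r" by (auto simp: rows_def)
qed

lemma rows_Suc_le: "D \<in> ferrers n \<Longrightarrow> rows D (Suc i) \<le> rows D i"
  by (simp add: rows_antimono[of D n])

section \<open>Removing one and two boxes\<close>

definition subdiagrams :: "nat \<Rightarrow> (nat \<times> nat) set \<Rightarrow> (nat \<times> nat) set set" where
  "subdiagrams n D = {E \<in> ferrers n. E \<subseteq> D}"

definition hstrips :: "nat \<Rightarrow> (nat \<times> nat) set \<Rightarrow> (nat \<times> nat) set set" where
  "hstrips n D = {E \<in> ferrers n. E \<subseteq> D \<and> inj_on snd (D - E)}"

definition vstrips :: "nat \<Rightarrow> (nat \<times> nat) set \<Rightarrow> (nat \<times> nat) set set" where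
  "vstrips n D = {E \<in> ferrers n. E \<subseteq> D \<and> inj_on fst (D - E)}"

lemma finite_strips [simp]: "finite (subdiagrams n D)" "finite (hstrips n D)" "finite (vstrips n D)"
  by (simp_all add: subdiagrams_def hstrips_def vstrips_def)

text \<open>Lowering an exponent by 1 removes the last box of a row if the next row is shorter.
  Otherwise it makes two neighbouring exponents equal, or reaches -k in the last row, and the term
  vanishes.\<close>

lemma diagram_char_branching:
  assumes D: "D \<in> ferrers (Suc n)" and k: "Suc n \<le> k" and p: "p \<in> sym_group n"
  shows "diagram_char (Suc n) k D p = (\<Sum>E\<in>subdiagrams n D. diagram_char n k E p)"
proof -
  let ?\<beta> = "\<lambda>i. int (rows D i) - int i"
  define r where "r i = (rows D)(i := rows D i - 1)" for i
  define e where "e i = {(a, b). b < r i a}" for i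
  define I where "I = {i. rows D (Suc i) < rows D i}"
  have Ik: "i < k" if "i \<in> I" for i
    using that rows_zero[OF D, of i] k by (cases "i < k") (auto simp: I_def)
  have e: "e i \<in> ferrers n" "e i \<subseteq> D" "rows (e i) = r i" if "i \<in> I" for i
  proof -
    have 1: "r i (Suc m) \<le> r i m" for m
      using that rows_Suc_le[OF D, of m] by (auto simp: r_def I_def)
    have 2: "r i m \<le> rows D m" for m by (simp add: r_def)
    have 3: "D - {(a, b). b < r i a} = {(i, rows D i - 1)}"
      using that by (auto simp: r_def I_def ferrers_iff[OF D] split: if_splits)
    show "e i \<in> ferrers n" "e i \<subseteq> D" "rows (e i) = r i"
      unfolding e_def by (rule ferrers_remove[OF D 1 2 3]; simp)+
  qed
  have summand: "det_char n k (?\<beta>(i := ?\<beta> i - 1)) p = (if i \<in> I then diagram_char n k (e i) p else 0)" if i: "i < k" for i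
  proof (cases "i \<in> I")
    case True
    have "det_char n k (?\<beta>(i := ?\<beta> i - 1)) p = diagram_char n k (e i) p"
      unfolding diagram_char_def e(3)[OF True] using True by (intro det_char_cong) (auto simp: r_def I_def)
    then show ?thesis using True by simp
  next
    case False
    then have eq: "rows D (Suc i) = rows D i" using rows_Suc_le[OF D, of i] by (simp add: I_def)
    have "det_char n k (?\<beta>(i := ?\<beta> i - 1)) p = 0"
    proof (cases "Suc i < k")
      case True
      then show ?thesis using eq p by (intro det_char_repeated[of i k "Suc i"]) auto
    next
      case False
      then have "rows D i = 0" using eq rows_zero[OF D, of "Suc i"] k i by simp
      then show ?thesis using False i by (intro det_char_low[of i]) auto
    qed
    then show ?thesis using False by simp
  qed
  have inj: "inj_on e I"
  proof (rule inj_onI)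
    fix i i' assume *: "i \<in> I" "i' \<in> I" "e i = e i'"
    then have "r i i = r i' i" using e(3) by metis
    then show "i = i'" using * by (auto simp: r_def I_def split: if_splits)
  qed
  have img: "e ` I = subdiagrams n D"
  proof (intro equalityI subsetI)
    fix E assume "E \<in> subdiagrams n D"
    then have E: "E \<in> ferrers n" "E \<subseteq> D" by (auto simp: subdiagrams_def)
    have "card (D - E) = 1" using card_Diff_subset[OF ferrersD(1)[OF E(1)] E(2)] ferrersD(3)[OF D] ferrersD(3)[OF E(1)] by simp
    then obtain a b where ab: "D - E = {(a, b)}" by (metis card_1_singletonE surj_pair)
    then have De: "D = insert (a, b) E" "(a, b) \<notin> E" using E(2) by auto
    have rD: "rows D = (rows E)(a := Suc (rows E a))" unfolding De(1) by (rule rows_insert[OF ferrersD(1)[OF E(1)] De(2)])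
    then have aI: "a \<in> I" using rows_Suc_le[OF E(1), of a] by (simp add: I_def)
    have "rows E = r a" by (simp add: r_def rD)
    then have "E = e a" using ferrers_eqI[OF E(1) e(1)[OF aI]] e(3)[OF aI] by simp
    then show "E \<in> e ` I" using aI by simp
  qed (use e in \<open>auto simp: subdiagrams_def\<close>)
  have "diagram_char (Suc n) k D p = (\<Sum>i<k. if i \<in> I then diagram_char n k (e i) p else 0)"
    unfolding diagram_char_def[of "Suc n"] det_char_Suc[OF p] by (intro sum.cong refl summand) simp
  also have "\<dots> = (\<Sum>i\<in>I. diagram_char n k (e i) p)"
    using Ik by (intro sum.mono_neutral_cong_right) auto
  also have "\<dots> = (\<Sum>E\<in>subdiagrams n D. diagram_char n k E p)"
    unfolding img[symmetric] by (simp add: sum.reindex[OF inj])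
  finally show ?thesis .
qed

lemma diff_two:
  assumes D: "D \<in> ferrers (Suc (Suc n))" and E: "E \<in> ferrers n" "E \<subseteq> D"
  obtains x y where "D - E = {x, y}" "x \<noteq> y" "D = insert x (insert y E)" "x \<notin> E" "y \<notin> E"
proof -
  have "card (D - E) = 2" using card_Diff_subset[OF ferrersD(1)[OF E(1)] E(2)] ferrersD(3)[OF D] ferrersD(3)[OF E(1)] by simp
  then obtain x y where xy: "D - E = {x, y}" "x \<noteq> y" by (auto simp: card_2_iff)
  then have "D = insert x (insert y E)" "x \<notin> E" "y \<notin> E" using E(2) by blast+
  with xy that show ?thesis by blast
qed

text \<open>These are the horizontal dominoes: a pair of removed boxes fails to be a vertical strip
  exactly when both lie in one row, and then they end a row that exceeds the next by at least
  two.\<close>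

lemma hstrips_minus_vstrips:
  assumes D: "D \<in> ferrers (Suc (Suc n))"
  defines "r \<equiv> \<lambda>i. (rows D)(i := rows D i - 2)"
  defines "e \<equiv> \<lambda>i. {(a, b). b < r i a}"
  defines "I \<equiv> {i. rows D (Suc i) + 2 \<le> rows D i}"
  shows "i \<in> I \<Longrightarrow> rows (e i) = r i" "inj_on e I" "e ` I = hstrips n D - vstrips n D"
proof -
  have e: "e i \<in> ferrers n" "e i \<subseteq> D" "rows (e i) = r i" "D - e i = {(i, rows D i - 1), (i, rows D i - 2)}" if "i \<in> I" for i
  proof -
    have 1: "r i (Suc m) \<le> r i m" for m
      using that rows_Suc_le[OF D, of m] by (auto simp: r_def I_def)
    have 2: "r i m \<le> rows D m" for m by (simp add: r_def)
    show 3: "D - e i = {(i, rows D i - 1), (i, rows D i - 2)}"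
      using that by (auto simp: e_def r_def I_def ferrers_iff[OF D] split: if_splits)
    have "card {(i, rows D i - 1), (i, rows D i - 2)} + n = Suc (Suc n)" using that by (auto simp: I_def card_insert_if)
    then show "e i \<in> ferrers n" "e i \<subseteq> D" "rows (e i) = r i"
      using ferrers_remove[OF D 1 2 3[unfolded e_def], of n] unfolding e_def by auto
  qed
  show "rows (e i) = r i" if "i \<in> I" using e(3)[OF that] .
  show "inj_on e I"
  proof (rule inj_onI)
    fix i i' assume *: "i \<in> I" "i' \<in> I" "e i = e i'"
    then have "r i i = r i' i" using e(3) by metis
    then show "i = i'" using * by (auto simp: r_def I_def split: if_splits)
  qed
  show "e ` I = hstrips n D - vstrips n D"
  proof (intro equalityI subsetI)
    fix E assume "E \<in> e ` I"
    then obtain i where i: "i \<in> I" "E = e i" by auto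
    then have "rows D i - 1 \<noteq> rows D i - 2" by (auto simp: I_def)
    then have "inj_on snd (D - E)" "\<not> inj_on fst (D - E)"
      unfolding i(2) e(4)[OF i(1)] by (auto simp: inj_on_def)
    then show "E \<in> hstrips n D - vstrips n D" using e[OF i(1)] i(2) by (auto simp: hstrips_def vstrips_def)
  next
    fix E assume "E \<in> hstrips n D - vstrips n D"
    then have E: "E \<in> ferrers n" "E \<subseteq> D" "\<not> inj_on fst (D - E)" by (auto simp: hstrips_def vstrips_def)
    obtain x y where xy: "D - E = {x, y}" "x \<noteq> y" "D = insert x (insert y E)" "x \<notin> E" "y \<notin> E"
      using diff_two[OF D E(1,2)] by blast
    have "fst x = fst y" using E(3) unfolding xy(1) by (auto simp: inj_on_def)
    then obtain a b c where ab: "x = (a, b)" "y = (a, c)" by (metis prod.collapse)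
    have "rows D = (rows (insert (a, c) E))(a := Suc (rows (insert (a, c) E) a))"
      unfolding xy(3) ab using xy ab ferrersD(1)[OF E(1)] by (intro rows_insert) auto
    moreover have "rows (insert (a, c) E) = (rows E)(a := Suc (rows E a))"
      using xy ab ferrersD(1)[OF E(1)] by (intro rows_insert) auto
    ultimately have rD: "rows D = (rows E)(a := Suc (Suc (rows E a)))" by simp
    then have aI: "a \<in> I" using rows_Suc_le[OF E(1), of a] by (simp add: I_def)
    have "rows E = r a" by (simp add: r_def rD)
    then have "E = e a" using ferrers_eqI[OF E(1) e(1)[OF aI]] e(3)[OF aI] by simp
    then show "E \<in> e ` I" using aI by simp
  qed
qed

text \<open>The vertical dominoes, indexed by the upper of their two rows. They end two equal rows
  that are longer than the row below.\<close>

lemma vstrips_minus_hstrips: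
  assumes D: "D \<in> ferrers (Suc (Suc n))"
  defines "r \<equiv> \<lambda>i. (rows D)(i := rows D i - 1, Suc i := rows D (Suc i) - 1)"
  defines "e \<equiv> \<lambda>i. {(a, b). b < r i a}"
  defines "I \<equiv> {i. rows D (Suc i) = rows D i \<and> rows D (Suc (Suc i)) < rows D i}"
  shows "i \<in> I \<Longrightarrow> rows (e i) = r i" "inj_on e I" "e ` I = vstrips n D - hstrips n D"
proof -
  have e: "e i \<in> ferrers n" "e i \<subseteq> D" "rows (e i) = r i" "D - e i = {(i, rows D i - 1), (Suc i, rows D i - 1)}" if "i \<in> I" for i
  proof -
    have 1: "r i (Suc m) \<le> r i m" for m
      using that rows_Suc_le[OF D, of m] by (auto simp: r_def I_def)
    have 2: "r i m \<le> rows D m" for m by (simp add: r_def)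
    show 3: "D - e i = {(i, rows D i - 1), (Suc i, rows D i - 1)}"
      using that by (auto simp: e_def r_def I_def ferrers_iff[OF D] split: if_splits)
    have "card {(i, rows D i - 1), (Suc i, rows D i - 1)} + n = Suc (Suc n)" by (auto simp: card_insert_if)
    then show "e i \<in> ferrers n" "e i \<subseteq> D" "rows (e i) = r i"
      using ferrers_remove[OF D 1 2 3[unfolded e_def], of n] unfolding e_def by auto
  qed
  show "rows (e i) = r i" if "i \<in> I" using e(3)[OF that] .
  show "inj_on e I"
  proof (rule inj_onI)
    fix i i' assume *: "i \<in> I" "i' \<in> I" "e i = e i'"
    then have "D - e i = D - e i'" by simp
    then have "{(i, rows D i - 1), (Suc i, rows D i - 1)} = {(i', rows D i' - 1), (Suc i', rows D i' - 1)}"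
      using e(4)[OF *(1)] e(4)[OF *(2)] *(3) by metis
    then have "{i, Suc i} = {i', Suc i'}" by (auto simp: doubleton_eq_iff)
    then show "i = i'" by (auto simp: doubleton_eq_iff)
  qed
  show "e ` I = vstrips n D - hstrips n D"
  proof (intro equalityI subsetI)
    fix E assume "E \<in> e ` I"
    then obtain i where i: "i \<in> I" "E = e i" by auto
    have "inj_on fst (D - E)" "\<not> inj_on snd (D - E)"
      unfolding i(2) e(4)[OF i(1)] by (auto simp: inj_on_def)
    then show "E \<in> vstrips n D - hstrips n D" using e[OF i(1)] i(2) by (auto simp: hstrips_def vstrips_def)
  next
    fix E assume "E \<in> vstrips n D - hstrips n D"
    then have E: "E \<in> ferrers n" "E \<subseteq> D" "\<not> inj_on snd (D - E)" by (auto simp: hstrips_def vstrips_def)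
    obtain x y where xy: "D - E = {x, y}" "x \<noteq> y" "D = insert x (insert y E)" "x \<notin> E" "y \<notin> E"
      using diff_two[OF D E(1,2)] by blast
    have "snd x = snd y" using E(3) unfolding xy(1) by (auto simp: inj_on_def)
    then obtain a b j where ab: "D = insert (a, j) (insert (b, j) E)" "(a, j) \<notin> E" "(b, j) \<notin> E" "a < b"
    proof (cases "fst x < fst y")
      case True
      then show ?thesis using that[of "fst x" "snd x" "fst y"] xy \<open>snd x = snd y\<close> by (cases x; cases y) auto
    next
      case False
      then have "fst y < fst x" using xy(2) \<open>snd x = snd y\<close> by (auto simp: prod_eq_iff)
      then show ?thesis using that[of "fst y" "snd x" "fst x"] xy \<open>snd x = snd y\<close> by (cases x; cases y) auto
    qed
    have "rows D = (rows (insert (b, j) E))(a := Suc (rows (insert (b, j) E) a))"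
      unfolding ab(1) using ab(2-4) ferrersD(1)[OF E(1)] by (intro rows_insert) auto
    moreover have "rows (insert (b, j) E) = (rows E)(b := Suc (rows E b))"
      using ab ferrersD(1)[OF E(1)] by (intro rows_insert) auto
    ultimately have rD: "rows D = (rows E)(b := Suc (rows E b), a := Suc (rows E a))" using ab(4) by simp
    have ja: "rows E a = j"
      using ab(1,2,4) ferrers_iff[OF E(1), of a j] ferrers_iff[OF D, of a j] rD by simp
    have jb: "rows E b = j"
      using ab(1,3,4) ferrers_iff[OF E(1), of b j] ferrers_iff[OF D, of b j] rD by simp
    \<comment> \<open>A row strictly between \<open>a\<close> and \<open>b\<close> would have length
      at least \<open>j + 1\<close> in \<open>D\<close>, yet it is untouched and has length at most
      \<open>j\<close> in \<open>E\<close>.\<close>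
    have b: "b = Suc a"
    proof (rule ccontr)
      assume "b \<noteq> Suc a"
      then have "Suc a < b" using ab(4) by simp
      then have "rows D b \<le> rows D (Suc a)" "rows D (Suc a) = rows E (Suc a)"
        using rows_antimono[OF D, of "Suc a" b] ab(4) by (simp_all add: rD)
      moreover have "rows E (Suc a) \<le> rows E a" by (rule rows_Suc_le[OF E(1)])
      ultimately show False using ja jb ab(4) by (simp add: rD)
    qed
    have aI: "a \<in> I" using rows_Suc_le[OF E(1), of "Suc a"] ja jb b by (simp add: I_def rD)
    have "rows E = r a" using ja jb b by (auto simp: r_def rD)
    then have "E = e a" using ferrers_eqI[OF E(1) e(1)[OF aI]] e(3)[OF aI] by simp
    then show "E \<in> e ` I" using aI by simp
  qed
qed

text \<open>The Murnaghan-Nakayama rule for a 2-cycle. Lowering an exponent by 2 removes a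
  horizontal domino if the next row is shorter by at least 2, and collides with the next exponent if
  it is shorter by 1. For two equal rows the result is out of order by one swap, giving a vertical
  domino with a minus sign, unless a third equal row causes a collision.\<close>

lemma diagram_char_transposition:
  assumes D: "D \<in> ferrers (Suc (Suc n))" and k: "Suc (Suc n) \<le> k" and p: "p \<in> sym_group n"
  shows "diagram_char (Suc (Suc n)) k D (p \<circ> transpose n (Suc n)) =
    (\<Sum>E\<in>hstrips n D - vstrips n D. diagram_char n k E p) - (\<Sum>E\<in>vstrips n D - hstrips n D. diagram_char n k E p)"
proof -
  let ?\<beta> = "\<lambda>i. int (rows D i) - int i"
  define rh where "rh i = (rows D)(i := rows D i - 2)" for i
  define eh where "eh i = {(a, b). b < rh i a}" for i
  define Ih where "Ih = {i. rows D (Suc i) + 2 \<le> rows D i}"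
  define rv where "rv i = (rows D)(i := rows D i - 1, Suc i := rows D (Suc i) - 1)" for i
  define ev where "ev i = {(a, b). b < rv i a}" for i
  define Iv where "Iv = {i. rows D (Suc i) = rows D i \<and> rows D (Suc (Suc i)) < rows D i}"
  note h = hstrips_minus_vstrips[OF D, folded rh_def, folded eh_def Ih_def]
  note v = vstrips_minus_hstrips[OF D, folded rv_def, folded ev_def Iv_def]
  have hk: "i < k" if "i \<in> Ih" for i
    using that rows_zero[OF D, of i] k by (cases "i < k") (auto simp: Ih_def)
  have vk: "Suc i < k" if "i \<in> Iv" for i
    using that rows_zero[OF D, of "Suc i"] k by (cases "Suc i < k") (auto simp: Iv_def)
  have summand: "det_char n k (?\<beta>(i := ?\<beta> i - 2)) p =
     (if i \<in> Ih then diagram_char n k (eh i) p else 0) - (if i \<in> Iv then diagram_char n k (ev i) p else 0)"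
    if i: "i < k" for i
  proof -
    have le: "rows D (Suc i) \<le> rows D i" "rows D (Suc (Suc i)) \<le> rows D (Suc i)" using rows_Suc_le[OF D] by auto
    consider "i \<in> Ih" | "rows D i = rows D (Suc i) + 1" | "i \<in> Iv"
      | "rows D (Suc i) = rows D i" "rows D (Suc (Suc i)) = rows D i"
      using le by (auto simp: Ih_def Iv_def) linarith
    then show ?thesis
    proof cases
      case 1
      then have "i \<notin> Iv" by (auto simp: Ih_def Iv_def)
      moreover have "det_char n k (?\<beta>(i := ?\<beta> i - 2)) p = diagram_char n k (eh i) p"
        unfolding diagram_char_def h(1)[OF 1] using 1 by (intro det_char_cong) (auto simp: rh_def Ih_def)
      ultimately show ?thesis using 1 by simp
    next
      case 2
      then have "i \<notin> Iv" "i \<notin> Ih" by (auto simp: Ih_def Iv_def)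
      moreover have "det_char n k (?\<beta>(i := ?\<beta> i - 2)) p = 0"
      proof (cases "Suc i < k")
        case True
        then show ?thesis using 2 p i by (intro det_char_repeated[of i k "Suc i"]) auto
      next
        case False
        then have "rows D i = 1" using 2 rows_zero[OF D, of "Suc i"] k by simp
        then show ?thesis using False i by (intro det_char_low[of i]) auto
      qed
      ultimately show ?thesis by simp
    next
      case 3
      then have "i \<notin> Ih" by (auto simp: Ih_def Iv_def)
      moreover have "det_char n k (?\<beta>(i := ?\<beta> i - 2)) p = - diagram_char n k (ev i) p"
      proof -
        have "diagram_char n k (ev i) p = det_char n k ((?\<beta>(i := ?\<beta> i - 2)) \<circ> transpose i (Suc i)) p"
          unfolding diagram_char_def v(1)[OF 3] using 3
          by (intro det_char_cong) (auto simp: rv_def Iv_def transpose_def of_nat_diff)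
        then show ?thesis using det_char_transpose[of i k "Suc i" p n "?\<beta>(i := ?\<beta> i - 2)"] i vk[OF 3] p by simp
      qed
      ultimately show ?thesis using 3 by simp
    next
      case 4
      then have "i \<notin> Iv" "i \<notin> Ih" by (auto simp: Ih_def Iv_def)
      moreover have "det_char n k (?\<beta>(i := ?\<beta> i - 2)) p = 0"
      proof (cases "Suc (Suc i) < k")
        case True
        then show ?thesis using 4 p by (intro det_char_repeated[of i k "Suc (Suc i)"]) auto
      next
        case False
        then have "rows D i = 0" using 4 rows_zero[OF D, of "Suc (Suc i)"] k by simp
        then show ?thesis using False i by (intro det_char_low[of i]) auto
      qed
      ultimately show ?thesis by simp
    qed
  qed
  have "diagram_char (Suc (Suc n)) k D (p \<circ> transpose n (Suc n)) =
     (\<Sum>i<k. (if i \<in> Ih then diagram_char n k (eh i) p else 0) - (if i \<in> Iv then diagram_char n k (ev i) p else 0))"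
    unfolding diagram_char_def[of "Suc (Suc n)"] det_char_transposition[OF p] by (intro sum.cong refl summand) simp
  also have "\<dots> = (\<Sum>i<k. if i \<in> Ih then diagram_char n k (eh i) p else 0) - (\<Sum>i<k. if i \<in> Iv then diagram_char n k (ev i) p else 0)"
    by (rule sum_subtractf)
  also have "(\<Sum>i<k. if i \<in> Ih then diagram_char n k (eh i) p else 0) = (\<Sum>i\<in>Ih. diagram_char n k (eh i) p)"
    using hk by (intro sum.mono_neutral_cong_right) auto
  also have "\<dots> = (\<Sum>E\<in>hstrips n D - vstrips n D. diagram_char n k E p)"
    unfolding h(3)[symmetric] by (simp add: sum.reindex[OF h(2)])
  also have "(\<Sum>i<k. if i \<in> Iv then diagram_char n k (ev i) p else 0) = (\<Sum>i\<in>Iv. diagram_char n k (ev i) p)"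
    using vk by (intro sum.mono_neutral_cong_right) (auto dest: Suc_lessD)
  also have "\<dots> = (\<Sum>E\<in>vstrips n D - hstrips n D. diagram_char n k E p)"
    unfolding v(3)[symmetric] by (simp add: sum.reindex[OF v(2)])
  finally show ?thesis .
qed

text \<open>The intermediate diagrams are the orders in which the two boxes can be removed: one
  order for a domino, which is a strip of one kind only, and two orders otherwise, when the boxes
  form a strip of both kinds.\<close>

lemma card_between:
  assumes D: "D \<in> ferrers (Suc (Suc n))" and E: "E \<in> ferrers n" "E \<subseteq> D"
  shows "card {M \<in> ferrers (Suc n). E \<subseteq> M \<and> M \<subseteq> D} =
    (if E \<in> hstrips n D then 1 else 0) + (if E \<in> vstrips n D then 1 else 0)"
proof -
  obtain x y where xy: "D - E = {x, y}" "x \<noteq> y" "D = insert x (insert y E)" "x \<notin> E" "y \<notin> E"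
    using diff_two[OF D E] by blast
  have xy3: "D = insert y (insert x E)" using xy(3) by auto
  define le where "le u w \<longleftrightarrow> fst u \<le> fst w \<and> snd u \<le> snd w" for u w :: "nat \<times> nat"
  have dc: "down_closed (insert u E) \<longleftrightarrow> \<not> le w u"
    if uw: "D = insert u (insert w E)" "u \<noteq> w" "u \<notin> E" "w \<notin> E" for u w
  proof
    assume a: "down_closed (insert u E)"
    show "\<not> le w u"
    proof
      assume "le w u"
      then have "w \<in> insert u E" using down_closedD[OF a, of "fst u" "snd u" "fst w" "snd w"] by (simp add: le_def)
      then show False using uw by auto
    qed
  next
    assume nle: "\<not> le w u"
    show "down_closed (insert u E)"
      unfolding down_closed_def
    proof (intro allI impI)
      fix i j i' j' assume ij: "(i, j) \<in> insert u E" "i' \<le> i" "j' \<le> j"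
      show "(i', j') \<in> insert u E"
      proof (cases "(i, j) = u")
        case True
        have "(i, j) \<in> D" using uw(1) True by simp
        then have "(i', j') \<in> D" using ij(2,3) by (rule down_closedD[OF ferrersD(2)[OF D]])
        moreover have "(i', j') \<noteq> w" using nle ij(2,3) True by (auto simp: le_def)
        ultimately show ?thesis using uw(1) by auto
      next
        case False
        then show ?thesis using ij down_closedD[OF ferrersD(2)[OF E(1)]] by blast
      qed
    qed
  qed
  have in_F: "insert u E \<in> ferrers (Suc n) \<longleftrightarrow> down_closed (insert u E)" if "u \<notin> E" for u
    using that ferrersD[OF E(1)] by (simp add: ferrers_def)
  have M: "{M \<in> ferrers (Suc n). E \<subseteq> M \<and> M \<subseteq> D} =
     (if le y x then {} else {insert x E}) \<union> (if le x y then {} else {insert y E})"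
  proof (intro equalityI subsetI)
    fix M assume "M \<in> {M \<in> ferrers (Suc n). E \<subseteq> M \<and> M \<subseteq> D}"
    then have M: "M \<in> ferrers (Suc n)" "E \<subseteq> M" "M \<subseteq> D" by auto
    have "card (M - E) = 1" using card_Diff_subset[OF ferrersD(1)[OF E(1)] M(2)] ferrersD(3)[OF M(1)] ferrersD(3)[OF E(1)] by simp
    then obtain z where z: "M - E = {z}" by (rule card_1_singletonE)
    then have "M = insert z E" "z \<in> {x, y}" using M xy(1) by auto
    then show "M \<in> (if le y x then {} else {insert x E}) \<union> (if le x y then {} else {insert y E})"
      using dc[OF xy(3,2,4,5)] dc[OF xy3 xy(2)[symmetric] xy(5,4)] ferrersD(2)[OF M(1)] by auto
  next
    fix M assume "M \<in> (if le y x then {} else {insert x E}) \<union> (if le x y then {} else {insert y E})"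
    then consider "\<not> le y x" "M = insert x E" | "\<not> le x y" "M = insert y E" by (auto split: if_splits)
    then show "M \<in> {M \<in> ferrers (Suc n). E \<subseteq> M \<and> M \<subseteq> D}"
    proof cases
      case 1
      then show ?thesis using dc[OF xy(3,2,4,5)] in_F[OF xy(4)] xy(3) by auto
    next
      case 2
      then show ?thesis using dc[OF xy3 xy(2)[symmetric] xy(5,4)] in_F[OF xy(5)] xy(3) by auto
    qed
  qed
  have ne: "insert x E \<noteq> insert y E" using xy by auto
  \<comment> \<open>Two removed boxes cannot lie strictly south-east of each other: the box in the
    row of the first and the column of the second would remain in \<open>E\<close> and force the
    first one into \<open>E\<close>.\<close>
  have strict: False if "fst u < fst w" "snd u < snd w" "D = insert u (insert w E)" "u \<notin> E" for u w
  proof -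
    have "(fst w, snd w) \<in> D" using that(3) by simp
    then have "(fst u, snd w) \<in> D"
      by (rule down_closedD[OF ferrersD(2)[OF D]]) (use that(1) in simp_all)
    moreover have "(fst u, snd w) \<noteq> u" "(fst u, snd w) \<noteq> w" using that(1,2) by (auto simp: prod_eq_iff)
    ultimately have "(fst u, snd w) \<in> E" using that(3) by auto
    then have "u \<in> E" using down_closedD[OF ferrersD(2)[OF E(1)], of "fst u" "snd w" "fst u" "snd u"] that(2) by simp
    then show False using that(4) by simp
  qed
  have H: "E \<in> hstrips n D \<longleftrightarrow> snd x \<noteq> snd y" "E \<in> vstrips n D \<longleftrightarrow> fst x \<noteq> fst y"
  proof -
    have "inj_on snd (D - E) \<longleftrightarrow> snd x \<noteq> snd y" "inj_on fst (D - E) \<longleftrightarrow> fst x \<noteq> fst y"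
      unfolding xy(1) using xy(2) by (auto simp: inj_on_def)
    then show "E \<in> hstrips n D \<longleftrightarrow> snd x \<noteq> snd y" "E \<in> vstrips n D \<longleftrightarrow> fst x \<noteq> fst y"
      using E by (simp_all add: hstrips_def vstrips_def)
  qed
  have s1: "\<not> (fst x < fst y \<and> snd x < snd y)" using strict[of x y] xy(3,4) by blast
  have s2: "\<not> (fst y < fst x \<and> snd y < snd x)" using strict[of y x] xy3 xy(5) by blast
  have "fst x \<noteq> fst y \<or> snd x \<noteq> snd y" using xy(2) by (auto simp: prod_eq_iff)
  then consider "fst x = fst y" "snd x \<noteq> snd y" | "fst x \<noteq> fst y" "snd x = snd y" | "fst x \<noteq> fst y" "snd x \<noteq> snd y"
    by blast
  then show ?thesis
  proof cases
    case 1
    then have "le x y \<noteq> le y x" by (auto simp: le_def)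
    then show ?thesis unfolding M using 1 H by auto
  next
    case 2
    then have "le x y \<noteq> le y x" by (auto simp: le_def)
    then show ?thesis unfolding M using 2 H by auto
  next
    case 3
    then have "\<not> le x y" "\<not> le y x" using s1 s2 by (auto simp: le_def)
    then show ?thesis unfolding M using 3 H ne by auto
  qed
qed

text \<open>Branching twice weights each \<open>E\<close> by the number of chains from
  \<open>E\<close> to \<open>D\<close>, and this number splits into one unit for each kind of strip
  that \<open>E\<close> is.\<close>

lemma diagram_char_branching_two:
  assumes D: "D \<in> ferrers (Suc (Suc n))" and k: "Suc (Suc n) \<le> k" and p: "p \<in> sym_group n"
  shows "diagram_char (Suc (Suc n)) k D p =
    (\<Sum>E\<in>hstrips n D. diagram_char n k E p) + (\<Sum>E\<in>vstrips n D. diagram_char n k E p)"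
proof -
  have p': "p \<in> sym_group (Suc n)" using p by (auto simp: sym_group_def intro: permutes_subset)
  have "diagram_char (Suc (Suc n)) k D p = (\<Sum>M\<in>subdiagrams (Suc n) D. diagram_char (Suc n) k M p)"
    by (rule diagram_char_branching[OF D k p'])
  also have "\<dots> = (\<Sum>M\<in>subdiagrams (Suc n) D. \<Sum>E\<in>subdiagrams n M. diagram_char n k E p)"
    using k p by (intro sum.cong refl diagram_char_branching) (auto simp: subdiagrams_def)
  also have "\<dots> = (\<Sum>M\<in>subdiagrams (Suc n) D. \<Sum>E\<in>subdiagrams n D. if E \<subseteq> M then diagram_char n k E p else 0)"
  proof (rule sum.cong[OF refl])
    fix M assume "M \<in> subdiagrams (Suc n) D"
    then have "subdiagrams n M = {E \<in> subdiagrams n D. E \<subseteq> M}" by (auto simp: subdiagrams_def)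
    then show "(\<Sum>E\<in>subdiagrams n M. diagram_char n k E p) = (\<Sum>E\<in>subdiagrams n D. if E \<subseteq> M then diagram_char n k E p else 0)"
      by (simp only: sum.inter_filter finite_strips)
  qed
  also have "\<dots> = (\<Sum>E\<in>subdiagrams n D. \<Sum>M\<in>subdiagrams (Suc n) D. if E \<subseteq> M then diagram_char n k E p else 0)"
    by (rule sum.swap)
  also have "\<dots> = (\<Sum>E\<in>subdiagrams n D. (if E \<in> hstrips n D then diagram_char n k E p else 0) + (if E \<in> vstrips n D then diagram_char n k E p else 0))"
  proof (rule sum.cong[OF refl])
    fix E assume E: "E \<in> subdiagrams n D"
    have "(\<Sum>M\<in>subdiagrams (Suc n) D. if E \<subseteq> M then diagram_char n k E p else 0) =
       (\<Sum>M\<in>{M \<in> subdiagrams (Suc n) D. E \<subseteq> M}. diagram_char n k E p)"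
      by (rule sum.inter_filter[symmetric]) simp
    also have "{M \<in> subdiagrams (Suc n) D. E \<subseteq> M} = {M \<in> ferrers (Suc n). E \<subseteq> M \<and> M \<subseteq> D}"
      by (auto simp: subdiagrams_def)
    also have "(\<Sum>M\<in>\<dots>. diagram_char n k E p) =
      (if E \<in> hstrips n D then diagram_char n k E p else 0) + (if E \<in> vstrips n D then diagram_char n k E p else 0)"
      using card_between[OF D, of E] E by (simp add: subdiagrams_def)
    finally show "(\<Sum>M\<in>subdiagrams (Suc n) D. if E \<subseteq> M then diagram_char n k E p else 0) =
      (if E \<in> hstrips n D then diagram_char n k E p else 0) + (if E \<in> vstrips n D then diagram_char n k E p else 0)" .
  qed
  also have "\<dots> = (\<Sum>E\<in>hstrips n D. diagram_char n k E p) + (\<Sum>E\<in>vstrips n D. diagram_char n k E p)"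
  proof -
    have "(\<Sum>E\<in>subdiagrams n D. if E \<in> S then diagram_char n k E p else 0) = (\<Sum>E\<in>S. diagram_char n k E p)"
      if "S \<subseteq> subdiagrams n D" for S
      using that by (intro sum.mono_neutral_cong_right) auto
    moreover have "hstrips n D \<subseteq> subdiagrams n D" "vstrips n D \<subseteq> subdiagrams n D"
      by (auto simp: hstrips_def vstrips_def subdiagrams_def)
    ultimately show ?thesis by (simp add: sum.distrib)
  qed
  finally show ?thesis .
qed

section \<open>A combinatorial formula for the Kronecker coefficients\<close>

text \<open>Reciprocity again: pairing a class function with the permutation character on words of
  one content amounts to averaging it over the stabilizer of one such word.\<close>

lemma word_class_sum:
  fixes Y :: "(nat \<Rightarrow> nat) \<Rightarrow> real"
  assumes f0: "f0 \<in> colourings N k" "\<And>i. i < k \<Longrightarrow> int (content N f0 i) = \<alpha> i"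
    and Y: "\<And>g p. g \<in> sym_group N \<Longrightarrow> p \<in> sym_group N \<Longrightarrow> Y (g \<circ> p \<circ> inv g) = Y p"
  shows "(\<Sum>p\<in>sym_group N. card {f \<in> colourings N k. f \<circ> p = f \<and> (\<forall>i<k. int (content N f i) = \<alpha> i)} * Y p) *
      card (stabilizer N f0) = fact N * (\<Sum>p\<in>stabilizer N f0. Y p)"
proof -
  define A where "A = {f \<in> colourings N k. \<forall>i<k. int (content N f i) = \<alpha> i}"
  have finA: "finite A" by (simp add: A_def)
  have "(\<Sum>p\<in>sym_group N. card {f \<in> colourings N k. f \<circ> p = f \<and> (\<forall>i<k. int (content N f i) = \<alpha> i)} * Y p) =
    (\<Sum>p\<in>sym_group N. \<Sum>f\<in>A. if f \<circ> p = f then Y p else 0)"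
  proof (rule sum.cong[OF refl])
    fix p
    have "{f \<in> colourings N k. f \<circ> p = f \<and> (\<forall>i<k. int (content N f i) = \<alpha> i)} = {f \<in> A. f \<circ> p = f}"
      by (auto simp: A_def)
    then show "real (card {f \<in> colourings N k. f \<circ> p = f \<and> (\<forall>i<k. int (content N f i) = \<alpha> i)}) * Y p =
       (\<Sum>f\<in>A. if f \<circ> p = f then Y p else 0)"
      using sum.inter_filter[OF finA, of "\<lambda>_. Y p" "\<lambda>f. f \<circ> p = f"] by simp
  qed
  also have "\<dots> = (\<Sum>f\<in>A. \<Sum>p\<in>sym_group N. if f \<circ> p = f then Y p else 0)"
    by (rule sum.swap)
  also have "\<dots> = (\<Sum>f\<in>A. \<Sum>p\<in>stabilizer N f. Y p)"
    unfolding stabilizer_def by (intro sum.cong refl sum.inter_filter[symmetric]) simp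
  also have "A = {f. f \<in> {..<N} \<rightarrow>\<^sub>E {..<k} \<and> (\<forall>x\<in>{..<k}. content N f x = content N f0 x)}"
    by (auto simp: A_def colourings_def f0(2)[symmetric])
  finally have e: "(\<Sum>p\<in>sym_group N. card {f \<in> colourings N k. f \<circ> p = f \<and> (\<forall>i<k. int (content N f i) = \<alpha> i)} * Y p) =
    (\<Sum>f | f \<in> {..<N} \<rightarrow>\<^sub>E {..<k} \<and> (\<forall>x\<in>{..<k}. content N f x = content N f0 x). \<Sum>p\<in>stabilizer N f. Y p)" .
  show ?thesis unfolding e
    by (rule sum_stabilizer_orbit) (use f0(1) Y in \<open>simp_all add: colourings_def\<close>)
qed

lemma stabilizer_last_one:
  "stabilizer (Suc m) (\<lambda>x\<in>{..<Suc m}. if x < m then 0 else 1 :: nat) = sym_group m"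
proof (intro equalityI subsetI)
  let ?f = "\<lambda>x\<in>{..<Suc m}. if x < m then 0 else 1 :: nat"
  fix p assume stab: "p \<in> stabilizer (Suc m) ?f"
  then have p: "p \<in> sym_group (Suc m)" by (simp add: stabilizer_def)
  have "?f (p m) = ?f m" using stab stabilizer_iff[OF p, of ?f] by blast
  moreover have "p m < Suc m" using permutes_in_image[OF sym_groupD(1)[OF p], of m] by simp
  ultimately have "p m = m" by (cases "p m < m") simp_all
  then show "p \<in> sym_group m"
    using permutes_superset[OF sym_groupD(1)[OF p], of "{..<m}"] by (auto simp: sym_group_def less_Suc_eq)
next
  fix p assume p: "p \<in> sym_group m"
  have p': "p \<in> sym_group (Suc m)" using p by (auto simp: sym_group_def intro: permutes_subset)
  have "p x < m \<longleftrightarrow> x < m" "p x < Suc m \<longleftrightarrow> x < Suc m" for x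
    using permutes_in_image[OF sym_groupD(1)[OF p], of x] permutes_in_image[OF sym_groupD(1)[OF p'], of x] by auto
  then show "p \<in> stabilizer (Suc m) (\<lambda>x\<in>{..<Suc m}. if x < m then 0 else 1 :: nat)"
    using p' by (simp add: stabilizer_iff)
qed

text \<open>The Young subgroup of type (n,2), written as S_n together with its coset by the
  transposition of the last two points, so that sums over it can be evaluated on permutations fixing
  both points.\<close>

lemma stabilizer_last_two:
  fixes n :: nat
  defines "\<tau> \<equiv> transpose n (Suc n)"
  defines "f0 \<equiv> (\<lambda>x\<in>{..<Suc (Suc n)}. if x < n then 0 else 1 :: nat)"
  shows "stabilizer (Suc (Suc n)) f0 = sym_group n \<union> (\<lambda>p. p \<circ> \<tau>) ` sym_group n"
    "sym_group n \<inter> (\<lambda>p. p \<circ> \<tau>) ` sym_group n = {}"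
    "inj_on (\<lambda>p. p \<circ> \<tau>) (sym_group n)"
proof -
  let ?N = "Suc (Suc n)"
  have \<tau>G: "\<tau> \<in> sym_group ?N" by (auto simp: \<tau>_def intro: transpose_sym_group)
  have \<tau>\<tau>: "\<tau> \<circ> \<tau> = id" by (simp add: \<tau>_def)
  have fixn: "p n = n" "p (Suc n) = Suc n" if "p \<in> sym_group n" for p
    using sym_groupD(1)[OF that] by (auto simp: permutes_def)
  show "inj_on (\<lambda>p. p \<circ> \<tau>) (sym_group n)"
    by (auto simp: inj_on_def sym_group_cancel(2)[OF \<tau>G])
  show "sym_group n \<inter> (\<lambda>p. p \<circ> \<tau>) ` sym_group n = {}"
  proof (rule ccontr)
    assume "sym_group n \<inter> (\<lambda>p. p \<circ> \<tau>) ` sym_group n \<noteq> {}"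
    then obtain p where "p \<in> sym_group n" "p \<circ> \<tau> \<in> sym_group n" by auto
    then have "(p \<circ> \<tau>) n = n" "p (Suc n) = Suc n" using fixn by blast+
    then show False by (simp add: \<tau>_def)
  qed
  have lift: "p \<in> sym_group ?N" if "p \<in> sym_group n" for p
    using that by (auto simp: sym_group_def intro: permutes_subset)
  have in_stab: "p \<in> stabilizer ?N f0" if p: "p \<in> sym_group n" for p
  proof -
    have "p x < n \<longleftrightarrow> x < n" "p x < ?N \<longleftrightarrow> x < ?N" for x
      using permutes_in_image[OF sym_groupD(1)[OF p], of x] permutes_in_image[OF sym_groupD(1)[OF lift[OF p]], of x] by auto
    then show ?thesis using lift[OF p] by (simp add: stabilizer_iff f0_def)
  qed
  have small: "q \<in> sym_group n" if q: "q \<in> sym_group ?N" "q n = n" "q (Suc n) = Suc n" for q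
  proof -
    have "q x = x" if "x \<in> {..<?N} - {..<n}" for x
    proof -
      have "x = n \<or> x = Suc n" using that by auto
      then show ?thesis using q(2,3) by auto
    qed
    then show ?thesis
      using permutes_superset[OF sym_groupD(1)[OF q(1)], of "{..<n}"] by (simp add: sym_group_def)
  qed
  have \<tau>S: "\<tau> \<in> stabilizer ?N f0"
    using \<tau>G by (auto simp: stabilizer_iff f0_def \<tau>_def transpose_def)
  show "stabilizer ?N f0 = sym_group n \<union> (\<lambda>p. p \<circ> \<tau>) ` sym_group n"
  proof (intro equalityI subsetI)
    fix p assume p: "p \<in> stabilizer ?N f0"
    then have pG: "p \<in> sym_group ?N" by (simp add: stabilizer_def)
    have f: "f0 (p x) = f0 x" if "x < ?N" for x using stabilizer_iff[OF pG, of f0] p that by blast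
    have lt: "p n < ?N" "p (Suc n) < ?N"
      using permutes_in_image[OF sym_groupD(1)[OF pG], of n] permutes_in_image[OF sym_groupD(1)[OF pG], of "Suc n"] by simp_all
    have v: "p n = n \<or> p n = Suc n" "p (Suc n) = n \<or> p (Suc n) = Suc n"
    proof -
      have 1: "f0 y = 1 \<longleftrightarrow> y = n \<or> y = Suc n" if "y < ?N" for y
        using that by (cases "y < n") (auto simp: f0_def)
      show "p n = n \<or> p n = Suc n" "p (Suc n) = n \<or> p (Suc n) = Suc n"
        using 1[OF lt(1)] 1[OF lt(2)] f[of n] f[of "Suc n"] 1[of n] 1[of "Suc n"] by simp_all
    qed
    have "p n \<noteq> p (Suc n)" using inj_eq[OF sym_groupD(4)[OF pG], of n "Suc n"] by simp
    with v consider "p n = n" "p (Suc n) = Suc n" | "p n = Suc n" "p (Suc n) = n" by auto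
    then show "p \<in> sym_group n \<union> (\<lambda>p. p \<circ> \<tau>) ` sym_group n"
    proof cases
      case 1
      then show ?thesis using small[OF pG] by simp
    next
      case 2
      have "p \<circ> \<tau> \<in> sym_group ?N" using pG \<tau>G by blast
      then have "p \<circ> \<tau> \<in> sym_group n"
        by (rule small) (simp_all add: \<tau>_def 2)
      moreover have "p = (p \<circ> \<tau>) \<circ> \<tau>" by (simp add: comp_assoc \<tau>\<tau>)
      ultimately show ?thesis by blast
    qed
  next
    fix p assume "p \<in> sym_group n \<union> (\<lambda>p. p \<circ> \<tau>) ` sym_group n"
    then show "p \<in> stabilizer ?N f0"
      using in_stab perm_subgroupD(3)[OF perm_subgroup_stabilizer _ \<tau>S] by auto
  qed
qed

lemma sym_group_2: "sym_group 2 = {id, transpose 0 1}"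
proof -
  have "{id, transpose 0 1} \<subseteq> sym_group 2" by (auto intro: transpose_sym_group)
  moreover have "(id :: nat \<Rightarrow> nat) \<noteq> transpose 0 1" by (auto simp: fun_eq_iff transpose_def)
  then have "card {id, transpose 0 1 :: nat \<Rightarrow> nat} = 2" by simp
  ultimately show ?thesis
    using card_subset_eq[of "sym_group 2" "{id, transpose 0 1}"] card_sym_group[of 2] by (simp add: fact_2)
qed

text \<open>\<open>s\<^bsub>(n,2)\<^esub> = h\<^bsub>(n,2)\<^esub> - h\<^bsub>(n+1,1)\<^esub>\<close>.\<close>

lemma specht_char_two_rows:
  assumes n: "2 \<le> n" and p: "p \<in> sym_group (Suc (Suc n))"
  defines "fixed \<equiv> \<lambda>\<alpha>. real (card {f \<in> colourings (Suc (Suc n)) 2. f \<circ> p = f \<and> (\<forall>i<2. int (content (Suc (Suc n)) f i) = \<alpha> i)})"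
  shows "specht_char [n, 2] p = fixed (\<lambda>i. if i = 0 then int n else 2) - fixed (\<lambda>i. if i = 0 then int n + 1 else 1)"
proof -
  have l: "[n, 2] \<in> partitions_of (Suc (Suc n))" using n by (simp add: partitions_of_def)
  have "specht_char [n, 2] p = det_char (Suc (Suc n)) 2 (\<lambda>i. int (row_len [n, 2] i) - int i) p"
    by (rule specht_char_frobenius[OF l _ p]) simp
  also have "\<dots> = fixed (\<lambda>i. int (row_len [n, 2] i) - int i + int (id i))
      - fixed (\<lambda>i. int (row_len [n, 2] i) - int i + int (transpose 0 1 i))"
  proof -
    have ne: "(id :: nat \<Rightarrow> nat) \<noteq> transpose 0 1" by (auto simp: fun_eq_iff transpose_def)
    have "sign (transpose 0 (1::nat)) = -1" by (simp add: sign_swap_id)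
    then show ?thesis unfolding det_char_words sym_group_2 fixed_def using ne by simp
  qed
  also have "fixed (\<lambda>i. int (row_len [n, 2] i) - int i + int (id i)) = fixed (\<lambda>i. if i = 0 then int n else 2)"
  proof -
    have "int (row_len [n, 2] i) - int i + int (id i) = (if i = 0 then int n else 2)" if "i < 2" for i
      using that by (auto simp: row_len_def less_2_cases_iff)
    then show ?thesis unfolding fixed_def by (simp cong: conj_cong)
  qed
  also have "fixed (\<lambda>i. int (row_len [n, 2] i) - int i + int (transpose 0 1 i)) = fixed (\<lambda>i. if i = 0 then int n + 1 else 1)"
  proof -
    have "int (row_len [n, 2] i) - int i + int (transpose 0 1 i) = (if i = 0 then int n + 1 else 1)" if "i < 2" for i
      using that by (auto simp: row_len_def less_2_cases_iff)
    then show ?thesis unfolding fixed_def by (simp cong: conj_cong)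
  qed
  finally show ?thesis .
qed

lemma content_two_block:
  assumes "m \<le> N"
  shows "content N (\<lambda>x\<in>{..<N}. if x < m then 0 else 1 :: nat) 0 = m"
    "content N (\<lambda>x\<in>{..<N}. if x < m then 0 else 1 :: nat) 1 = N - m"
proof -
  have "{x. x < N \<and> (\<lambda>x\<in>{..<N}. if x < m then 0 else 1 :: nat) x = 0} = {..<m}"
    "{x. x < N \<and> (\<lambda>x\<in>{..<N}. if x < m then 0 else 1 :: nat) x = 1} = {m..<N}"
    using assms by (auto split: if_splits)
  then show "content N (\<lambda>x\<in>{..<N}. if x < m then 0 else 1 :: nat) 0 = m"
    "content N (\<lambda>x\<in>{..<N}. if x < m then 0 else 1 :: nat) 1 = N - m"
    unfolding content_def by simp_all
qed

lemma diagram_char_sums_product: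
  assumes "A \<subseteq> ferrers m" "A' \<subseteq> ferrers m" "m \<le> k"
  shows "(\<Sum>p\<in>sym_group m. (\<Sum>E\<in>A. diagram_char m k E p) * (\<Sum>E\<in>A'. diagram_char m k E p)) =
    fact m * real (card (A \<inter> A'))"
proof -
  have fin: "finite A" "finite A'" using assms(1,2) finite_ferrers finite_subset by blast+
  have "(\<Sum>p\<in>sym_group m. (\<Sum>E\<in>A. diagram_char m k E p) * (\<Sum>E\<in>A'. diagram_char m k E p)) =
     (\<Sum>p\<in>sym_group m. \<Sum>E\<in>A. \<Sum>E'\<in>A'. diagram_char m k E p * diagram_char m k E' p)"
    by (simp add: sum_product)
  also have "\<dots> = (\<Sum>E\<in>A. \<Sum>E'\<in>A'. \<Sum>p\<in>sym_group m. diagram_char m k E p * diagram_char m k E' p)"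
    by (subst sum.swap, rule sum.cong[OF refl], rule sum.swap)
  also have "\<dots> = (\<Sum>E\<in>A. \<Sum>E'\<in>A'. if E = E' then fact m else 0)"
    using assms by (intro sum.cong refl diagram_char_orthonormal) auto
  also have "\<dots> = (\<Sum>E\<in>A. if E \<in> A' then fact m else 0)"
    using fin by (simp add: sum.delta')
  also have "\<dots> = (\<Sum>E\<in>A \<inter> A'. fact m)"
    by (rule sum.inter_restrict[OF fin(1), symmetric])
  finally show ?thesis by simp
qed

text \<open>
  The coefficient of \<open>s\<^sub>\<nu>\<close> in \<open>s\<^bsub>\<lambda>/(2)\<^esub> h\<^sub>2 + s\<^bsub>\<lambda>/(1,1)\<^esub> e\<^sub>2 - s\<^bsub>\<lambda>/(1)\<^esub> h\<^sub>1\<close> for the diagrams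
  \<open>D\<close> of \<open>\<lambda>\<close> and \<open>D'\<close> of \<open>\<nu>\<close>.
\<close>

definition kron_count :: "nat \<Rightarrow> (nat \<times> nat) set \<Rightarrow> (nat \<times> nat) set \<Rightarrow> int" where
  "kron_count n D D' = int (card (hstrips n D \<inter> hstrips n D')) + int (card (vstrips n D \<inter> vstrips n D'))
     - int (card (subdiagrams (Suc n) D \<inter> subdiagrams (Suc n) D'))"

text \<open>With the (n,2) character written as a difference of two word characters, reciprocity
  expresses the coefficient by averages of the product of the other two characters over the Young
  subgroups of types (n,2) and (n+1,1). Orthonormality turns both averages into numbers of common
  subdiagrams.\<close>

theorem kronecker_coeff_count:
  assumes n: "2 \<le> n" and l: "l \<in> partitions_of (Suc (Suc n))" and v: "v \<in> partitions_of (Suc (Suc n))"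
  shows "kronecker_coeff [n, 2] l v = of_int (kron_count n (young_diagram l) (young_diagram v))"
proof -
  let ?N = "Suc (Suc n)"
  define D D' where "D = young_diagram l" and "D' = young_diagram v"
  have D: "D \<in> ferrers ?N" "D' \<in> ferrers ?N" unfolding D_def D'_def by (rule young_diagram_ferrers; fact)+
  define X where "X = diagram_char ?N ?N"
  have spX: "specht_char l p = X D p" "specht_char v p = X D' p" if "p \<in> sym_group ?N" for p
    using specht_char_frobenius[OF l length_partition_le[OF l] that] specht_char_frobenius[OF v length_partition_le[OF v] that]
    by (simp_all add: X_def diagram_char_def D_def D'_def rows_young_diagram)
  define Y where "Y p = X D p * X D' p" for p
  have Y: "Y (g \<circ> p \<circ> inv g) = Y p" if "g \<in> sym_group ?N" "p \<in> sym_group ?N" for g p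
    using det_char_conj[OF that] by (simp add: Y_def X_def diagram_char_def)
  define fixed where "fixed p \<alpha> = real (card {f \<in> colourings ?N 2. f \<circ> p = f \<and> (\<forall>i<2. int (content ?N f i) = \<alpha> i)})"
    for p :: "nat \<Rightarrow> nat" and \<alpha> :: "nat \<Rightarrow> int"
  let ?\<tau> = "transpose n (Suc n)"
  define H V H' V' where "H = hstrips n D" and "V = vstrips n D" and "H' = hstrips n D'" and "V' = vstrips n D'"
  have sub: "H \<subseteq> ferrers n" "V \<subseteq> ferrers n" "H' \<subseteq> ferrers n" "V' \<subseteq> ferrers n"
    by (auto simp: H_def V_def H'_def V'_def hstrips_def vstrips_def)
  let ?s = "\<lambda>A p. \<Sum>E\<in>A. diagram_char n ?N E p"
  have Yn: "Y p = (?s H p + ?s V p) * (?s H' p + ?s V' p)" if "p \<in> sym_group n" for p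
    unfolding Y_def X_def H_def V_def H'_def V'_def
    by (simp only: diagram_char_branching_two[OF D(1) order_refl that] diagram_char_branching_two[OF D(2) order_refl that])
  \<comment> \<open>Diagrams that are strips of both kinds cancel in the difference, so the sums
    over dominoes may be replaced by sums over all strips.\<close>
  have minus: "?s (A - B) p - ?s (B - A) p = ?s A p - ?s B p" if "finite A" "finite B" for A B p
    using sum.Int_Diff[OF that(1), of "\<lambda>E. diagram_char n ?N E p" B] sum.Int_Diff[OF that(2), of "\<lambda>E. diagram_char n ?N E p" A]
    by (simp add: Int_commute)
  have Yt: "Y (p \<circ> ?\<tau>) = (?s H p - ?s V p) * (?s H' p - ?s V' p)" if "p \<in> sym_group n" for p
    unfolding Y_def X_def H_def V_def H'_def V'_def
    by (simp only: diagram_char_transposition[OF D(1) order_refl that] diagram_char_transposition[OF D(2) order_refl that]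
        minus finite_strips)
  \<comment> \<open>With H, V and H', V' for the strip sums of the two diagrams, (H + V)(H' + V') +
    (H - V)(H' - V') = 2 H H' + 2 V V', so the mixed products disappear.\<close>
  have "(\<Sum>p\<in>sym_group n. Y p) + (\<Sum>p\<in>sym_group n. Y (p \<circ> ?\<tau>)) =
      (\<Sum>p\<in>sym_group n. 2 * (?s H p * ?s H' p) + 2 * (?s V p * ?s V' p))"
    unfolding sum.distrib[symmetric] by (intro sum.cong refl) (simp add: Yn Yt algebra_simps)
  also have "\<dots> = 2 * (fact n * card (H \<inter> H')) + 2 * (fact n * card (V \<inter> V'))"
    using diagram_char_sums_product[OF sub(1,3), of ?N] diagram_char_sums_product[OF sub(2,4), of ?N]
    by (simp add: sum.distrib sum_distrib_left[symmetric])
  finally have sum2: "(\<Sum>p\<in>sym_group n. Y p) + (\<Sum>p\<in>sym_group n. Y (p \<circ> ?\<tau>)) =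
     2 * fact n * (real (card (H \<inter> H')) + real (card (V \<inter> V')))" by (simp add: algebra_simps)
  have sum1: "(\<Sum>p\<in>sym_group (Suc n). Y p) = fact (Suc n) * real (card (subdiagrams (Suc n) D \<inter> subdiagrams (Suc n) D'))"
  proof -
    have "(\<Sum>p\<in>sym_group (Suc n). Y p) = (\<Sum>p\<in>sym_group (Suc n).
        (\<Sum>E\<in>subdiagrams (Suc n) D. diagram_char (Suc n) ?N E p) * (\<Sum>E\<in>subdiagrams (Suc n) D'. diagram_char (Suc n) ?N E p))"
      unfolding Y_def X_def by (intro sum.cong refl) (simp add: diagram_char_branching[OF D(1)] diagram_char_branching[OF D(2)])
    also have "\<dots> = fact (Suc n) * real (card (subdiagrams (Suc n) D \<inter> subdiagrams (Suc n) D'))"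
      by (rule diagram_char_sums_product) (auto simp: subdiagrams_def)
    finally show ?thesis .
  qed
  let ?f1 = "\<lambda>x\<in>{..<?N}. if x < Suc n then 0 else 1 :: nat"
  let ?f2 = "\<lambda>x\<in>{..<?N}. if x < n then 0 else 1 :: nat"
  have w1: "(\<Sum>p\<in>sym_group ?N. fixed p (\<lambda>i. if i = 0 then int n + 1 else 1) * Y p) * fact (Suc n) =
      fact ?N * (\<Sum>p\<in>sym_group (Suc n). Y p)"
  proof -
    have "?f1 \<in> colourings ?N 2" by (auto simp: colourings_def)
    moreover have "int (content ?N ?f1 i) = (if i = 0 then int n + 1 else 1)" if "i < 2" for i
      using that content_two_block[of "Suc n" ?N] by (auto simp: less_2_cases_iff)
    ultimately have "(\<Sum>p\<in>sym_group ?N. fixed p (\<lambda>i. if i = 0 then int n + 1 else 1) * Y p) * card (stabilizer ?N ?f1) =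
        fact ?N * (\<Sum>p\<in>stabilizer ?N ?f1. Y p)"
      unfolding fixed_def using Y by (rule word_class_sum)
    then show ?thesis by (simp only: stabilizer_last_one card_sym_group of_nat_fact)
  qed
  have w2: "(\<Sum>p\<in>sym_group ?N. fixed p (\<lambda>i. if i = 0 then int n else 2) * Y p) * (2 * fact n) =
      fact ?N * ((\<Sum>p\<in>sym_group n. Y p) + (\<Sum>p\<in>sym_group n. Y (p \<circ> ?\<tau>)))"
  proof -
    have "?f2 \<in> colourings ?N 2" by (auto simp: colourings_def)
    moreover have "int (content ?N ?f2 i) = (if i = 0 then int n else 2)" if "i < 2" for i
      using that content_two_block[of n ?N] by (auto simp: less_2_cases_iff)
    ultimately have 1: "(\<Sum>p\<in>sym_group ?N. fixed p (\<lambda>i. if i = 0 then int n else 2) * Y p) * card (stabilizer ?N ?f2) =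
        fact ?N * (\<Sum>p\<in>stabilizer ?N ?f2. Y p)"
      unfolding fixed_def using Y by (rule word_class_sum)
    have "card (stabilizer ?N ?f2) = 2 * fact n"
      unfolding stabilizer_last_two(1)
      by (subst card_Un_disjoint) (simp_all add: stabilizer_last_two(2) card_image[OF stabilizer_last_two(3)] card_sym_group)
    then have c: "real (card (stabilizer ?N ?f2)) = 2 * fact n" by simp
    have s: "(\<Sum>p\<in>stabilizer ?N ?f2. Y p) = (\<Sum>p\<in>sym_group n. Y p) + (\<Sum>p\<in>sym_group n. Y (p \<circ> ?\<tau>))"
      unfolding stabilizer_last_two(1)
      by (subst sum.union_disjoint) (simp_all add: stabilizer_last_two(2) sum.reindex[OF stabilizer_last_two(3)])
    show ?thesis using 1 unfolding c s .
  qed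
  have "(\<Sum>p\<in>sym_group ?N. specht_char [n, 2] p * specht_char l p * specht_char v p) =
     (\<Sum>p\<in>sym_group ?N. fixed p (\<lambda>i. if i = 0 then int n else 2) * Y p) -
     (\<Sum>p\<in>sym_group ?N. fixed p (\<lambda>i. if i = 0 then int n + 1 else 1) * Y p)"
    unfolding sum_subtractf[symmetric]
    by (intro sum.cong refl)
       (simp add: specht_char_two_rows[OF n] spX Y_def fixed_def[symmetric] algebra_simps)
  also have "\<dots> = fact ?N * (real (card (H \<inter> H')) + real (card (V \<inter> V'))) -
      fact ?N * real (card (subdiagrams (Suc n) D \<inter> subdiagrams (Suc n) D'))"
  proof -
    have "(\<Sum>p\<in>sym_group ?N. fixed p (\<lambda>i. if i = 0 then int n else 2) * Y p) * (2 * fact n) =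
       (fact ?N * (real (card (H \<inter> H')) + real (card (V \<inter> V')))) * (2 * fact n)"
      using w2 unfolding sum2 by (simp only: mult.commute mult.left_commute mult.assoc)
    moreover have "(2 * fact n :: real) \<noteq> 0" by simp
    ultimately have 2: "(\<Sum>p\<in>sym_group ?N. fixed p (\<lambda>i. if i = 0 then int n else 2) * Y p) =
       fact ?N * (real (card (H \<inter> H')) + real (card (V \<inter> V')))"
      using mult_right_cancel by blast
    have "(\<Sum>p\<in>sym_group ?N. fixed p (\<lambda>i. if i = 0 then int n + 1 else 1) * Y p) * fact (Suc n) =
       (fact ?N * real (card (subdiagrams (Suc n) D \<inter> subdiagrams (Suc n) D'))) * fact (Suc n)"
      using w1 unfolding sum1 by (simp only: mult.commute mult.left_commute mult.assoc)
    moreover have "(fact (Suc n) :: real) \<noteq> 0" by (rule fact_nonzero)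
    ultimately have 1: "(\<Sum>p\<in>sym_group ?N. fixed p (\<lambda>i. if i = 0 then int n + 1 else 1) * Y p) =
       fact ?N * real (card (subdiagrams (Suc n) D \<inter> subdiagrams (Suc n) D'))"
      using mult_right_cancel by blast
    show ?thesis unfolding 1 2 ..
  qed
  also have "\<dots> = fact ?N * real_of_int (kron_count n D D')"
    by (simp add: kron_count_def H_def V_def H'_def V'_def algebra_simps del: fact_Suc)
  finally have key: "(\<Sum>p\<in>sym_group ?N. specht_char [n, 2] p * specht_char l p * specht_char v p) = fact ?N * real_of_int (kron_count n D D')" .
  have l2: "[n, 2] \<in> partitions_of ?N" using n by (simp add: partitions_of_def)
  have "kronecker_coeff [n, 2] l v = (\<Sum>p\<in>sym_group ?N. irr_char [n, 2] p * irr_char l p * cnj (irr_char v p)) / fact ?N"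
    by (simp add: kronecker_coeff_def char_inner_def del: fact_Suc)
  also have "(\<Sum>p\<in>sym_group ?N. irr_char [n, 2] p * irr_char l p * cnj (irr_char v p)) =
      of_real (\<Sum>p\<in>sym_group ?N. specht_char [n, 2] p * specht_char l p * specht_char v p)"
    unfolding of_real_sum by (intro sum.cong refl) (simp add: irr_char_specht[OF l2] irr_char_specht[OF l] irr_char_specht[OF v])
  also have "\<dots> / fact ?N = of_int (kron_count n D D')"
    unfolding key by (simp del: fact_Suc)
  finally show ?thesis by (simp add: D_def D'_def)
qed

section \<open>Which diagrams give coefficients 0 and 1\<close>

definition boxes_le :: "nat \<times> nat \<Rightarrow> nat \<times> nat \<Rightarrow> bool" where
  "boxes_le x y \<longleftrightarrow> fst x \<le> fst y \<and> snd x \<le> snd y"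

definition corners :: "(nat \<times> nat) set \<Rightarrow> (nat \<times> nat) set" where
  "corners D = {(i, j) \<in> D. (Suc i, j) \<notin> D \<and> (i, Suc j) \<notin> D}"

lemma down_closed_le: "down_closed D \<Longrightarrow> y \<in> D \<Longrightarrow> boxes_le x y \<Longrightarrow> x \<in> D"
  using down_closedD[of D "fst y" "snd y" "fst x" "snd x"] by (simp add: boxes_le_def)

lemma down_closedI: "(\<And>x y. y \<in> D \<Longrightarrow> boxes_le x y \<Longrightarrow> x \<in> D) \<Longrightarrow> down_closed D"
  unfolding down_closed_def boxes_le_def by (metis fst_conv snd_conv)

lemma corner_maximal:
  assumes D: "down_closed D" and x: "x \<in> corners D" and z: "z \<in> D" "boxes_le x z"
  shows "z = x"
proof (rule ccontr)
  assume "z \<noteq> x"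
  then have "fst x < fst z \<or> snd x < snd z" using z(2) by (auto simp: boxes_le_def prod_eq_iff)
  then have "boxes_le (Suc (fst x), snd x) z \<or> boxes_le (fst x, Suc (snd x)) z"
    using z(2) by (auto simp: boxes_le_def)
  then have "(Suc (fst x), snd x) \<in> D \<or> (fst x, Suc (snd x)) \<in> D" using down_closed_le[OF D z(1)] by blast
  then show False using x by (auto simp: corners_def)
qed

lemma corner_above:
  assumes D: "D \<in> ferrers n" and z: "z \<in> D"
  obtains x where "x \<in> corners D" "boxes_le z x"
proof -
  have fin: "finite {x \<in> D. boxes_le z x}" using ferrersD(1)[OF D] by simp
  have "z \<in> {x \<in> D. boxes_le z x}" using z by (simp add: boxes_le_def)
  then have "Max ((\<lambda>x. fst x + snd x) ` {x \<in> D. boxes_le z x}) \<in> (\<lambda>x. fst x + snd x) ` {x \<in> D. boxes_le z x}"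
    using fin by (intro Max_in finite_imageI) blast+
  then obtain x where x: "x \<in> D" "boxes_le z x"
    and m: "Max ((\<lambda>x. fst x + snd x) ` {x \<in> D. boxes_le z x}) = fst x + snd x" by auto
  have mx: "fst y + snd y \<le> fst x + snd x" if "y \<in> D" "boxes_le z y" for y
    unfolding m[symmetric] using that fin by (intro Max_ge) auto
  have "x \<in> corners D"
    using x mx[of "(Suc (fst x), snd x)"] mx[of "(fst x, Suc (snd x))"]
    by (cases x) (auto simp: corners_def boxes_le_def)
  then show ?thesis using x(2) that by blast
qed

lemma corners_differ:
  assumes D: "down_closed D" and "x \<in> corners D" "y \<in> corners D" "x \<noteq> y"
  shows "fst x \<noteq> fst y" "snd x \<noteq> snd y"
proof -
  have xy: "x \<in> D" "y \<in> D" using assms by (auto simp: corners_def)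
  have "\<not> boxes_le x y" "\<not> boxes_le y x"
    using corner_maximal[OF D assms(2) xy(2)] corner_maximal[OF D assms(3) xy(1)] assms(4) by auto
  then show "fst x \<noteq> fst y" "snd x \<noteq> snd y" by (auto simp: boxes_le_def)
qed

lemma remove_upset_ferrers:
  assumes D: "D \<in> ferrers N" and A: "A \<subseteq> D" "card A + m = N"
    and up: "\<And>a z. a \<in> A \<Longrightarrow> z \<in> D \<Longrightarrow> boxes_le a z \<Longrightarrow> z \<in> A"
  shows "D - A \<in> ferrers m" "D - (D - A) = A"
proof -
  have "down_closed (D - A)"
  proof (rule down_closedI)
    fix x y assume "y \<in> D - A" "boxes_le x y"
    then show "x \<in> D - A" using down_closed_le[OF ferrersD(2)[OF D], of y x] up[of x y] by auto
  qed
  moreover have "card (D - A) = m"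
    using card_Diff_subset[OF finite_subset[OF A(1) ferrersD(1)[OF D]] A(1)] A(2) ferrersD(3)[OF D] by simp
  ultimately show "D - A \<in> ferrers m" using ferrersD(1)[OF D] by (simp add: ferrers_def)
  show "D - (D - A) = A" using A(1) by auto
qed

lemma remove_pair_strips:
  assumes D: "D \<in> ferrers (Suc (Suc n))" and xy: "x \<in> D" "y \<in> D" "x \<noteq> y"
    and up: "\<And>z. z \<in> D \<Longrightarrow> boxes_le x z \<or> boxes_le y z \<Longrightarrow> z = x \<or> z = y"
  shows "snd x \<noteq> snd y \<Longrightarrow> D - {x, y} \<in> hstrips n D" "fst x \<noteq> fst y \<Longrightarrow> D - {x, y} \<in> vstrips n D"
proof -
  have *: "D - {x, y} \<in> ferrers n" "D - (D - {x, y}) = {x, y}"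
    using remove_upset_ferrers[OF D, of "{x, y}" n] xy up by auto
  show "snd x \<noteq> snd y \<Longrightarrow> D - {x, y} \<in> hstrips n D" "fst x \<noteq> fst y \<Longrightarrow> D - {x, y} \<in> vstrips n D"
    using * by (auto simp: hstrips_def vstrips_def)
qed

lemma subdiagrams_corners:
  assumes D: "D \<in> ferrers (Suc m)"
  shows "subdiagrams m D = (\<lambda>x. D - {x}) ` corners D"
proof (intro equalityI subsetI)
  fix E assume "E \<in> subdiagrams m D"
  then have E: "E \<in> ferrers m" "E \<subseteq> D" by (auto simp: subdiagrams_def)
  have "card (D - E) = 1" using card_Diff_subset[OF ferrersD(1)[OF E(1)] E(2)] ferrersD(3)[OF D] ferrersD(3)[OF E(1)] by simp
  then obtain x where x: "D - E = {x}" by (rule card_1_singletonE)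
  have "z \<notin> D" if "boxes_le x z" "z \<noteq> x" for z
  proof
    assume "z \<in> D"
    then have "z \<in> E" using x that(2) by auto
    then have "x \<in> E" using down_closed_le[OF ferrersD(2)[OF E(1)]] that(1) by blast
    then show False using x by auto
  qed
  then have "x \<in> corners D" using x by (cases x) (auto simp: corners_def boxes_le_def)
  moreover have "E = D - {x}" using x E(2) by auto
  ultimately show "E \<in> (\<lambda>x. D - {x}) ` corners D" by blast
next
  fix E assume "E \<in> (\<lambda>x. D - {x}) ` corners D"
  then obtain x where x: "x \<in> corners D" "E = D - {x}" by auto
  have "x \<in> D" using x(1) by (auto simp: corners_def)
  then have "E \<in> ferrers m"
    unfolding x(2) using corner_maximal[OF ferrersD(2)[OF D] x(1)] by (intro remove_upset_ferrers[OF D]) auto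
  then show "E \<in> subdiagrams m D" using x(2) by (auto simp: subdiagrams_def)
qed

lemma corner_pair_strips:
  assumes D: "D \<in> ferrers (Suc (Suc n))" and xy: "x \<in> corners D" "y \<in> corners D" "x \<noteq> y"
  shows "D - {x, y} \<in> hstrips n D" "D - {x, y} \<in> vstrips n D"
proof -
  note dc = ferrersD(2)[OF D]
  have in_D: "x \<in> D" "y \<in> D" using xy by (auto simp: corners_def)
  have up: "z = x \<or> z = y" if "z \<in> D" "boxes_le x z \<or> boxes_le y z" for z
    using that corner_maximal[OF dc xy(1) that(1)] corner_maximal[OF dc xy(2) that(1)] by blast
  show "D - {x, y} \<in> hstrips n D" "D - {x, y} \<in> vstrips n D"
    using remove_pair_strips[OF D in_D xy(3) up] corners_differ[OF dc xy] by blast+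
qed

text \<open>Distinct corners differ in both coordinates, so every pair of them is a horizontal and a
  vertical strip at once.\<close>

lemma card_corner_pairs:
  assumes D: "D \<in> ferrers (Suc (Suc n))"
  shows "(\<lambda>A. D - A) ` {A. A \<subseteq> corners D \<and> card A = 2} \<subseteq> hstrips n D \<inter> vstrips n D"
    "card ((\<lambda>A. D - A) ` {A. A \<subseteq> corners D \<and> card A = 2}) = card (corners D) choose 2"
proof -
  have sub: "corners D \<subseteq> D" by (auto simp: corners_def)
  then have fin: "finite (corners D)" using ferrersD(1)[OF D] finite_subset by blast
  show "(\<lambda>A. D - A) ` {A. A \<subseteq> corners D \<and> card A = 2} \<subseteq> hstrips n D \<inter> vstrips n D"
    using corner_pair_strips[OF D] by (auto simp: card_2_iff)
  have "inj_on (\<lambda>A. D - A) {A. A \<subseteq> corners D \<and> card A = 2}"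
    using sub by (intro inj_onI) blast
  then show "card ((\<lambda>A. D - A) ` {A. A \<subseteq> corners D \<and> card A = 2}) = card (corners D) choose 2"
    using n_subsets[OF fin, of 2] by (simp add: card_image)
qed

lemma card_subdiagrams:
  assumes D: "D \<in> ferrers (Suc m)"
  shows "card (subdiagrams m D) = card (corners D)"
proof -
  have "inj_on (\<lambda>x. D - {x}) (corners D)"
  proof (rule inj_onI)
    fix x y assume "x \<in> corners D" and eq: "D - {x} = D - {y}"
    then have "x \<in> D" by (auto simp: corners_def)
    then show "x = y" using eq by blast
  qed
  then show ?thesis by (simp add: subdiagrams_corners[OF D] card_image)
qed

text \<open>Pairs of corners count in both strip sets, which gives c(c-1) against c one-box
  removals, and c(c-2) is at least 3 for c \<ge> 3.\<close>

lemma kron_count_three_corners: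
  assumes D: "D \<in> ferrers (Suc (Suc n))" and c: "3 \<le> card (corners D)"
  shows "2 \<le> kron_count n D D"
proof -
  let ?c = "card (corners D)"
  have "?c choose 2 \<le> card (hstrips n D)" "?c choose 2 \<le> card (vstrips n D)"
    using card_corner_pairs(1)[OF D] unfolding card_corner_pairs(2)[OF D, symmetric]
    by (auto intro!: card_mono)
  moreover have "2 * (?c choose 2) = ?c * (?c - 1)" proof -
    have "even (?c * (?c - 1))" by (cases "even ?c") auto
    then show ?thesis by (simp add: choose_two)
  qed
  moreover have "?c * (?c - 1) \<ge> 2 + ?c"
  proof -
    obtain d where "?c = 3 + d" using c le_Suc_ex by blast
    then show ?thesis by (simp add: algebra_simps)
  qed
  ultimately have "card (hstrips n D) + card (vstrips n D) \<ge> 2 + ?c" by linarith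
  then show ?thesis using card_subdiagrams[OF D] by (simp add: kron_count_def)
qed

section \<open>Conjugation of diagrams\<close>

lemma strips_swap:
  shows "prod.swap ` E \<in> ferrers m \<longleftrightarrow> E \<in> ferrers m"
    "hstrips m (prod.swap ` D) = (\<lambda>E. prod.swap ` E) ` vstrips m D"
    "vstrips m (prod.swap ` D) = (\<lambda>E. prod.swap ` E) ` hstrips m D"
    "subdiagrams m (prod.swap ` D) = (\<lambda>E. prod.swap ` E) ` subdiagrams m D"
proof -
  have inv: "prod.swap ` prod.swap ` A = A" for A :: "(nat \<times> nat) set" by (simp add: image_image)
  have dc: "down_closed (prod.swap ` A)" if "down_closed A" for A :: "(nat \<times> nat) set"
    using that unfolding down_closed_def by (metis pair_in_swap_image)
  have card: "card (prod.swap ` A) = card A" for A :: "(nat \<times> nat) set" by (simp add: card_image)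
  have fer: "prod.swap ` A \<in> ferrers m" if "A \<in> ferrers m" for A m
    using that dc card by (auto simp: ferrers_def)
  have fer_iff: "prod.swap ` E \<in> ferrers m \<longleftrightarrow> E \<in> ferrers m" for E using fer inv by metis
  show "prod.swap ` E \<in> ferrers m \<longleftrightarrow> E \<in> ferrers m" by (rule fer_iff)
  have sub: "prod.swap ` A \<subseteq> B \<longleftrightarrow> A \<subseteq> prod.swap ` B" for A B :: "(nat \<times> nat) set"
    by (metis inv image_mono)
  have diff: "prod.swap ` A - prod.swap ` B = prod.swap ` (A - B)" for A B :: "(nat \<times> nat) set"
    by (simp add: image_set_diff)
  have injs: "inj_on snd (prod.swap ` A) \<longleftrightarrow> inj_on fst A" "inj_on fst (prod.swap ` A) \<longleftrightarrow> inj_on snd A" for A :: "(nat \<times> nat) set"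
  proof -
    have "snd \<circ> prod.swap = (fst :: nat \<times> nat \<Rightarrow> nat)" "fst \<circ> prod.swap = (snd :: nat \<times> nat \<Rightarrow> nat)" by auto
    then show "inj_on snd (prod.swap ` A) \<longleftrightarrow> inj_on fst A" "inj_on fst (prod.swap ` A) \<longleftrightarrow> inj_on snd A"
      using comp_inj_on_iff[of prod.swap A "snd :: nat \<times> nat \<Rightarrow> nat"]
        comp_inj_on_iff[of prod.swap A "fst :: nat \<times> nat \<Rightarrow> nat"] by simp_all
  qed
  have set_eq: "P = (\<lambda>E. prod.swap ` E) ` Q" if "\<And>E. E \<in> P \<longleftrightarrow> prod.swap ` E \<in> Q" for P Q :: "(nat \<times> nat) set set"
  proof (intro equalityI subsetI)
    fix E assume "E \<in> P"
    then show "E \<in> (\<lambda>E. prod.swap ` E) ` Q" using that inv by (intro image_eqI[of _ _ "prod.swap ` E"]) auto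
  next
    fix E assume "E \<in> (\<lambda>E. prod.swap ` E) ` Q"
    then show "E \<in> P" using that inv by auto
  qed
  show "hstrips m (prod.swap ` D) = (\<lambda>E. prod.swap ` E) ` vstrips m D"
  proof (rule set_eq)
    fix E :: "(nat \<times> nat) set"
    have "prod.swap ` D - E = prod.swap ` (D - prod.swap ` E)" using diff[of D "prod.swap ` E"] by (simp add: inv)
    then show "E \<in> hstrips m (prod.swap ` D) \<longleftrightarrow> prod.swap ` E \<in> vstrips m D"
      by (simp add: hstrips_def vstrips_def injs fer_iff sub)
  qed
  show "vstrips m (prod.swap ` D) = (\<lambda>E. prod.swap ` E) ` hstrips m D"
  proof (rule set_eq)
    fix E :: "(nat \<times> nat) set"
    have "prod.swap ` D - E = prod.swap ` (D - prod.swap ` E)" using diff[of D "prod.swap ` E"] by (simp add: inv)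
    then show "E \<in> vstrips m (prod.swap ` D) \<longleftrightarrow> prod.swap ` E \<in> hstrips m D"
      by (simp add: hstrips_def vstrips_def injs fer_iff sub)
  qed
  show "subdiagrams m (prod.swap ` D) = (\<lambda>E. prod.swap ` E) ` subdiagrams m D"
  proof (rule set_eq)
    fix E :: "(nat \<times> nat) set"
    show "E \<in> subdiagrams m (prod.swap ` D) \<longleftrightarrow> prod.swap ` E \<in> subdiagrams m D"
      by (simp add: subdiagrams_def fer_iff sub)
  qed
qed

text \<open>Conjugating both diagrams exchanges the two kinds of strips and leaves the count
  unchanged; on characters it means multiplying two factors by the sign.\<close>

lemma kron_count_swap: "kron_count n (prod.swap ` D) (prod.swap ` D') = kron_count n D D'"
proof -
  have inj: "inj (\<lambda>E :: (nat \<times> nat) set. prod.swap ` E)"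
    by (rule injI) (simp add: inj_image_eq_iff)
  show ?thesis
    unfolding kron_count_def strips_swap image_Int[OF inj, symmetric]
    by (simp add: card_image[OF inj_on_subset[OF inj]])
qed

lemma strip_diff:
  assumes D: "D \<in> ferrers (Suc (Suc n))" and E: "E \<in> hstrips n D \<or> E \<in> vstrips n D"
  obtains x y where "x \<in> D" "y \<in> D" "x \<noteq> y" "E = D - {x, y}"
    "\<And>z. z \<in> D \<Longrightarrow> boxes_le x z \<or> boxes_le y z \<Longrightarrow> z = x \<or> z = y"
    "E \<in> hstrips n D \<longleftrightarrow> snd x \<noteq> snd y" "E \<in> vstrips n D \<longleftrightarrow> fst x \<noteq> fst y"
proof -
  have E': "E \<in> ferrers n" "E \<subseteq> D" using E by (auto simp: hstrips_def vstrips_def)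
  obtain x y where xy: "D - E = {x, y}" "x \<noteq> y" "D = insert x (insert y E)" "x \<notin> E" "y \<notin> E"
    using diff_two[OF D E'] by blast
  have up: "z = x \<or> z = y" if "z \<in> D" "boxes_le x z \<or> boxes_le y z" for z
  proof (rule ccontr)
    assume "\<not> (z = x \<or> z = y)"
    then have "z \<in> E" using that(1) xy(3) by auto
    then show False using that(2) down_closed_le[OF ferrersD(2)[OF E'(1)]] xy(4,5) by blast
  qed
  have "inj_on snd (D - E) \<longleftrightarrow> snd x \<noteq> snd y" "inj_on fst (D - E) \<longleftrightarrow> fst x \<noteq> fst y"
    unfolding xy(1) using xy(2) by (auto simp: inj_on_def)
  then have "E \<in> hstrips n D \<longleftrightarrow> snd x \<noteq> snd y" "E \<in> vstrips n D \<longleftrightarrow> fst x \<noteq> fst y"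
    using E' by (simp_all add: hstrips_def vstrips_def)
  moreover have "E = D - {x, y}" using xy by auto
  ultimately show ?thesis using that[of x y] xy(2,3) up by blast
qed

section \<open>Rectangles\<close>

lemma rectangle_ferrers: "{..<a} \<times> {..<b} \<in> ferrers (a * b)"
  by (auto simp: ferrers_def down_closed_def)

lemma hstrips_rectangle:
  assumes ab: "0 < a" "0 < b" "a * b = Suc (Suc n)"
  defines "D \<equiv> {..<a} \<times> {..<b}"
  shows "hstrips n D = (if 2 \<le> b then {D - {(a - 1, b - 1), (a - 1, b - 2)}} else {})"
proof -
  have D: "D \<in> ferrers (Suc (Suc n))" using rectangle_ferrers[of a b] ab(3) by (simp add: D_def)
  let ?c = "(a - 1, b - 1)"
  have cD: "?c \<in> D" using ab by (simp add: D_def)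
  have only: "2 \<le> b \<and> E = D - {?c, (a - 1, b - 2)}" if E: "E \<in> hstrips n D" for E
  proof -
    obtain x y where xy: "x \<in> D" "y \<in> D" "x \<noteq> y" "E = D - {x, y}"
      "\<And>z. z \<in> D \<Longrightarrow> boxes_le x z \<or> boxes_le y z \<Longrightarrow> z = x \<or> z = y" "E \<in> hstrips n D \<longleftrightarrow> snd x \<noteq> snd y"
      using strip_diff[OF D disjI1[OF E]] by metis
    \<comment> \<open>Every box of the rectangle lies weakly north-west of the corner, so an upward
      closed pair has to contain the corner.\<close>
    have "boxes_le x ?c" using xy(1) by (auto simp: D_def boxes_le_def)
    then have "?c = x \<or> ?c = y" using xy(5)[OF cD] by blast
    then obtain w where w: "w \<in> D" "w \<noteq> ?c" "E = D - {?c, w}" "snd w \<noteq> b - 1"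
      "\<And>z. z \<in> D \<Longrightarrow> boxes_le w z \<Longrightarrow> z = ?c \<or> z = w"
    proof
      assume "?c = x"
      then show thesis using that[of y] xy \<open>E \<in> hstrips n D\<close> by auto
    next
      assume c: "?c = y"
      show thesis
      proof (rule that[of x])
        show "x \<in> D" "x \<noteq> ?c" "E = D - {?c, x}" using xy(1,3,4) c by auto
        have "snd ?c = b - 1" by simp
        then show "snd x \<noteq> b - 1" using xy(6) E c by metis
        show "z = ?c \<or> z = x" if "z \<in> D" "boxes_le x z" for z
          using xy(5)[OF that(1)] that(2) c by blast
      qed
    qed
    have lt: "fst w < a" "snd w < b - 1" using w(1,4) by (auto simp: D_def)
    \<comment> \<open>The right neighbour of the second box belongs to the rectangle and hence to
      the removed pair, so it is the corner itself.\<close>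
    have "(fst w, Suc (snd w)) \<in> D" "boxes_le w (fst w, Suc (snd w))" "(fst w, Suc (snd w)) \<noteq> w"
      using lt by (auto simp: D_def boxes_le_def prod_eq_iff)
    then have "(fst w, Suc (snd w)) = ?c" using w(5) by blast
    then have "w = (a - 1, b - 2)" using lt by (auto simp: prod_eq_iff)
    moreover have "2 \<le> b" using lt(2) by simp
    ultimately show ?thesis using w(3) by blast
  qed
  have "D - {?c, (a - 1, b - 2)} \<in> hstrips n D" if b: "2 \<le> b"
  proof (rule remove_pair_strips(1)[OF D])
    show "(a - 1, b - 2) \<in> D" "?c \<in> D" using ab b by (auto simp: D_def)
    show "?c \<noteq> (a - 1, b - 2)" "snd ?c \<noteq> snd (a - 1, b - 2)" using b by auto
    show "z = ?c \<or> z = (a - 1, b - 2)" if "z \<in> D" "boxes_le ?c z \<or> boxes_le (a - 1, b - 2) z" for z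
    proof -
      obtain i j where z: "z = (i, j)" by (cases z)
      have "i < a" "j < b" "a - 1 \<le> i" "b - 2 \<le> j" using that by (auto simp: z D_def boxes_le_def)
      then have "i = a - 1" "j = b - 1 \<or> j = b - 2" by auto
      then show ?thesis by (auto simp: z)
    qed
  qed
  then show ?thesis using only by auto
qed

lemma swap_rectangle: "prod.swap ` ({..<b} \<times> {..<a}) = {..<a} \<times> {..<b}" for a b :: nat
  by (rule product_swap)

lemma vstrips_rectangle:
  assumes ab: "0 < a" "0 < b" "a * b = Suc (Suc n)"
  defines "D \<equiv> {..<a} \<times> {..<b}"
  shows "vstrips n D = (if 2 \<le> a then {D - {(a - 1, b - 1), (a - 2, b - 1)}} else {})"
proof -
  have "vstrips n D = (\<lambda>E. prod.swap ` E) ` hstrips n ({..<b} \<times> {..<a})"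
    unfolding D_def swap_rectangle[of b a, symmetric] by (rule strips_swap(3))
  also have "\<dots> = (if 2 \<le> a then {prod.swap ` ({..<b} \<times> {..<a} - {(b - 1, a - 1), (b - 1, a - 2)})} else {})"
    using hstrips_rectangle[of b a n] ab by (simp add: mult.commute)
  also have "prod.swap ` ({..<b} \<times> {..<a} - {(b - 1, a - 1), (b - 1, a - 2)}) = D - {(a - 1, b - 1), (a - 2, b - 1)}"
    by (simp add: image_set_diff swap_rectangle D_def)
  finally show ?thesis .
qed

lemma corners_rectangle:
  assumes "0 < a" "0 < b" shows "corners ({..<a} \<times> {..<b}) = {(a - 1, b - 1)}"
  using assms by (auto simp: corners_def)

lemma strip_of_insert:
  assumes E: "E \<in> ferrers n" and D': "D' - E = {u, w}" "u \<noteq> w" "E \<subseteq> D'"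
  shows "E \<in> hstrips n D' \<longleftrightarrow> snd u \<noteq> snd w" "E \<in> vstrips n D' \<longleftrightarrow> fst u \<noteq> fst w"
  using assms by (auto simp: hstrips_def vstrips_def inj_on_def)

text \<open>A rectangle has at most one strip of each kind and exactly one one-box removal, so the
  count is h + v - s with truth values h, v, s. It lies in {0, 1} because h and v together imply s,
  and s implies h or v.\<close>

lemma kron_count_rectangle:
  assumes ab: "0 < a" "0 < b" "a * b = Suc (Suc n)" and n: "4 \<le> n" and D': "D' \<in> ferrers (Suc (Suc n))"
  shows "kron_count n ({..<a} \<times> {..<b}) D' \<in> {0, 1}"
proof -
  define D where "D = {..<a} \<times> {..<b}"
  let ?c = "(a - 1, b - 1)"
  define Eh Ev S where "Eh = D - {?c, (a - 1, b - 2)}" and "Ev = D - {?c, (a - 2, b - 1)}" and "S = D - {?c}"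
  have D: "D \<in> ferrers (Suc (Suc n))" using rectangle_ferrers[of a b] ab(3) by (simp add: D_def)
  have hs: "hstrips n D = (if 2 \<le> b then {Eh} else {})" and vs: "vstrips n D = (if 2 \<le> a then {Ev} else {})"
    using hstrips_rectangle[OF ab] vstrips_rectangle[OF ab] by (auto simp: D_def Eh_def Ev_def)
  have ss: "subdiagrams (Suc n) D = {S}"
    using subdiagrams_corners[OF D] corners_rectangle[OF ab(1,2)] by (simp add: D_def S_def)
  have SF: "S \<in> ferrers (Suc n)" using ss by (auto simp: subdiagrams_def)
  define h v s where "h \<longleftrightarrow> 2 \<le> b \<and> Eh \<in> hstrips n D'" and "v \<longleftrightarrow> 2 \<le> a \<and> Ev \<in> vstrips n D'"
    and "s \<longleftrightarrow> S \<in> subdiagrams (Suc n) D'"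
  have count: "kron_count n D D' = of_bool h + of_bool v - of_bool s"
    by (simp add: kron_count_def hs vs ss h_def v_def s_def)
  have 1: s if h v
  proof -
    have "S \<subseteq> Eh \<union> Ev" using that by (auto simp: S_def Eh_def Ev_def h_def v_def)
    also have "\<dots> \<subseteq> D'" using that by (auto simp: h_def v_def hstrips_def vstrips_def)
    finally show ?thesis using SF by (simp add: s_def subdiagrams_def)
  qed
  have 2: "h \<or> v" if s
  proof -
    have SD: "S \<subseteq> D'" using that by (simp add: s_def subdiagrams_def)
    have "card (D' - S) = 1"
      using card_Diff_subset[OF ferrersD(1)[OF SF] SD] ferrersD(3)[OF D'] ferrersD(3)[OF SF] by simp
    then obtain u where u: "D' - S = {u}" by (rule card_1_singletonE)
    have low: "z \<in> D" if "boxes_le z u" "z \<noteq> u" for z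
    proof -
      have "z \<in> D'" using down_closed_le[OF ferrersD(2)[OF D'], of u z] u that(1) by auto
      then show ?thesis using u that(2) by (auto simp: S_def)
    qed
    \<comment> \<open>The second removed box of the horizontal strip is in column
      \<open>b - 2\<close>, so the box \<open>u\<close> by which \<open>D'\<close> exceeds
      \<open>S\<close> spoils the strip only by lying in that same column.\<close>
    have inh: h if "2 \<le> b" "snd u \<noteq> b - 2"
    proof -
      have "Eh \<in> ferrers n" using hs that(1) by (auto simp: hstrips_def)
      moreover have "D' - Eh = {u, (a - 1, b - 2)}"
        using u SD that ab by (auto simp: Eh_def S_def D_def)
      moreover have "Eh \<subseteq> D'" using SD by (auto simp: Eh_def S_def)
      moreover have "u \<noteq> (a - 1, b - 2)" using that(2) by auto
      ultimately show ?thesis using strip_of_insert(1)[of Eh n D' u "(a - 1, b - 2)"] that by (simp add: h_def)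
    qed
    have inv: v if "2 \<le> a" "fst u \<noteq> a - 2"
    proof -
      have "Ev \<in> ferrers n" using vs that(1) by (auto simp: vstrips_def)
      moreover have "D' - Ev = {u, (a - 2, b - 1)}"
        using u SD that ab by (auto simp: Ev_def S_def D_def)
      moreover have "Ev \<subseteq> D'" using SD by (auto simp: Ev_def S_def)
      moreover have "u \<noteq> (a - 2, b - 1)" using that(2) by auto
      ultimately show ?thesis using strip_of_insert(2)[of Ev n D' u "(a - 2, b - 1)"] that by (simp add: v_def)
    qed
    \<comment> \<open>In a single column or row only one kind of strip exists. The length 6 ensures
      that index 0, where the box \<open>u\<close> outside the rectangle lies, differs from
      \<open>a - 2\<close> or \<open>b - 2\<close>.\<close>
    have b1: "6 \<le> a" if "b = 1" using ab(3) n that by simp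
    have a1: "6 \<le> b" if "a = 1" using ab(3) n that by simp
    \<comment> \<open>The extra box either completes the rectangle or extends it to the right or
      downwards; in the last two cases it turns out to sit in the first row or the first
      column.\<close>
    consider "u = ?c" | "b \<le> snd u" | "a \<le> fst u"
    proof -
      have "u \<notin> S" using u by auto
      then have "u = ?c \<or> u \<notin> D" by (auto simp: S_def)
      then show thesis using that by (cases u) (auto simp: D_def not_less)
    qed
    then show ?thesis
    proof cases
      case 1
      show ?thesis
      proof (cases "2 \<le> b")
        case True
        then show ?thesis using inh 1 by simp
      next
        case False
        then have "b = 1" using ab by simp
        then show ?thesis using inv b1 1 by simp
      qed
    next
      case 2
      have "(fst u, snd u - 1) \<in> D" using 2 ab(2) by (intro low) (auto simp: boxes_le_def prod_eq_iff)
      then have "snd u = b" using 2 ab(2) by (auto simp: D_def)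
      moreover have "fst u = 0"
      proof (rule ccontr)
        assume "fst u \<noteq> 0"
        then have "(fst u - 1, snd u) \<in> D" by (intro low) (auto simp: boxes_le_def prod_eq_iff)
        then show False using 2 by (simp add: D_def)
      qed
      ultimately show ?thesis using inh inv b1 ab(2) by (cases "2 \<le> b") (auto simp: not_le)
    next
      case 3
      have "(fst u - 1, snd u) \<in> D" using 3 ab(1) by (intro low) (auto simp: boxes_le_def prod_eq_iff)
      then have "fst u = a" using 3 ab(1) by (auto simp: D_def)
      moreover have "snd u = 0"
      proof (rule ccontr)
        assume "snd u \<noteq> 0"
        then have "(fst u, snd u - 1) \<in> D" by (intro low) (auto simp: boxes_le_def prod_eq_iff)
        then show False using 3 by (simp add: D_def)
      qed
      ultimately show ?thesis using inh inv a1 ab(1) by (cases "2 \<le> a") (auto simp: not_le)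
    qed
  qed
  show ?thesis unfolding D_def[symmetric] count using 1 2 by (cases h; cases v; cases s) auto
qed

section \<open>The shape (n+1,1)\<close>

definition hook :: "nat \<Rightarrow> (nat \<times> nat) set" where
  "hook n = insert (1, 0) ({0} \<times> {..<Suc n})"

lemma hook_ferrers: "hook n \<in> ferrers (Suc (Suc n))"
  by (auto simp: ferrers_def down_closed_def hook_def)

lemma hook_strips:
  assumes n: "2 \<le> n"
  shows "corners (hook n) = {(0, n), (1, 0)}"
    "hstrips n (hook n) = {hook n - {(0, n), (0, n - 1)}, hook n - {(0, n), (1, 0)}}"
    "vstrips n (hook n) = {hook n - {(0, n), (1, 0)}}"
proof -
  note D = hook_ferrers[of n]
  have mem: "(i, j) \<in> hook n \<longleftrightarrow> (i = 0 \<and> j \<le> n) \<or> (i = 1 \<and> j = 0)" for i j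
    by (auto simp: hook_def)
  show c: "corners (hook n) = {(0, n), (1, 0)}"
    using n by (auto simp: corners_def mem)
  have pq: "hook n - {(0, n), (1, 0)} \<in> hstrips n (hook n)" "hook n - {(0, n), (1, 0)} \<in> vstrips n (hook n)"
    using corner_pair_strips[OF D, of "(0, n)" "(1, 0)"] c by auto
  have pr: "hook n - {(0, n), (0, n - 1)} \<in> hstrips n (hook n)"
  proof (rule remove_pair_strips(1)[OF D])
    show "(0, n) \<in> hook n" "(0, n - 1) \<in> hook n" "(0, n) \<noteq> (0, n - 1)" "snd (0, n) \<noteq> snd (0, n - 1)"
      using n by (auto simp: mem)
    show "z = (0, n) \<or> z = (0, n - 1)" if "z \<in> hook n" "boxes_le (0, n) z \<or> boxes_le (0, n - 1) z" for z
    proof -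
      obtain i j where z: "z = (i, j)" by (cases z)
      have "n - 1 \<le> j" using that(2) by (auto simp: z boxes_le_def)
      then have "i = 0" "j = n \<or> j = n - 1" using that(1) n by (auto simp: z mem)
      then show ?thesis by (auto simp: z)
    qed
  qed
  have only: "E = hook n - {(0, n), (1, 0)} \<or> (E = hook n - {(0, n), (0, n - 1)} \<and> E \<notin> vstrips n (hook n))"
    if E: "E \<in> hstrips n (hook n) \<or> E \<in> vstrips n (hook n)" for E
  proof -
    obtain x y where xy: "x \<in> hook n" "y \<in> hook n" "x \<noteq> y" "E = hook n - {x, y}"
      "\<And>z. z \<in> hook n \<Longrightarrow> boxes_le x z \<or> boxes_le y z \<Longrightarrow> z = x \<or> z = y" "E \<in> vstrips n (hook n) \<longleftrightarrow> fst x \<noteq> fst y"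
      using strip_diff[OF D E] by metis
    have row: "\<exists>j\<le>n. w = (0, j)" if "w \<in> hook n" "w \<noteq> (1, 0)" for w
      using that by (cases w) (auto simp: mem)
    have p: "(0, n) \<in> {x, y}"
    proof -
      have "x \<noteq> (1, 0) \<or> y \<noteq> (1, 0)" using xy(3) by auto
      then have "boxes_le x (0, n) \<or> boxes_le y (0, n)" using row[OF xy(1)] row[OF xy(2)] by (auto simp: boxes_le_def)
      then show ?thesis using xy(5)[of "(0, n)"] by (auto simp: mem)
    qed
    then obtain w where w: "{x, y} = {(0, n), w}" "w \<noteq> (0, n)" using xy(3) by blast
    have wD: "w \<in> hook n" using w xy(1,2) by (metis insertI1 insertI2 insertE singletonD)
    show ?thesis
    proof (cases "w = (1, 0)")
      case True
      then show ?thesis using xy(4) w(1) by simp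
    next
      case False
      then obtain j where j: "j \<le> n" "w = (0, j)" using row[OF wD] by blast
      then have "j \<le> n - 1" using w(2) by simp
      then have "boxes_le w (0, n - 1)" by (simp add: j boxes_le_def)
      then have "boxes_le x (0, n - 1) \<or> boxes_le y (0, n - 1)" using w by (metis insertI1 insertI2 insertE singletonD)
      then have "(0, n - 1) \<in> {x, y}" using xy(5)[of "(0, n - 1)"] n by (auto simp: mem)
      then have we: "w = (0, n - 1)" using w n by auto
      then have "fst x = fst y" using w(1) by (auto simp: doubleton_eq_iff)
      then show ?thesis using xy(4,6) w(1) we by simp
    qed
  qed
  show "hstrips n (hook n) = {hook n - {(0, n), (0, n - 1)}, hook n - {(0, n), (1, 0)}}"
    using only pq pr by auto
  show "vstrips n (hook n) = {hook n - {(0, n), (1, 0)}}"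
    using only pq by blast
qed

text \<open>The shape has two horizontal strips, one vertical strip and two one-box removals, so
  five truth values have to be balanced. Whether \<open>D'\<close> contains the two corners of the
  hook decides most of them.\<close>

lemma kron_count_hook:
  assumes n: "4 \<le> n" and D': "D' \<in> ferrers (Suc (Suc n))"
  shows "kron_count n (hook n) D' \<in> {0, 1}"
proof -
  define E1 E2 Sp Sq where "E1 = hook n - {(0, n), (0, n - 1)}" and "E2 = hook n - {(0, n), (1, 0)}"
    and "Sp = hook n - {(0, n)}" and "Sq = hook n - {(1, 0)}"
  have n2: "2 \<le> n" using n by simp
  note hk = hook_strips[OF n2] and D = hook_ferrers[of n]
  have mem: "(i, j) \<in> hook n \<longleftrightarrow> (i = 0 \<and> j \<le> n) \<or> (i = 1 \<and> j = 0)" for i j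
    by (auto simp: hook_def)
  have memE1: "(i, j) \<in> E1 \<longleftrightarrow> (i = 0 \<and> j < n - 1) \<or> (i = 1 \<and> j = 0)"
    and memE2: "(i, j) \<in> E2 \<longleftrightarrow> i = 0 \<and> j < n"
    and memSp: "(i, j) \<in> Sp \<longleftrightarrow> (i = 0 \<and> j < n) \<or> (i = 1 \<and> j = 0)"
    and memSq: "(i, j) \<in> Sq \<longleftrightarrow> i = 0 \<and> j \<le> n" for i j
    by (auto simp: E1_def E2_def Sp_def Sq_def mem)
  have hs: "hstrips n (hook n) = {E1, E2}" and vs: "vstrips n (hook n) = {E2}" and ss: "subdiagrams (Suc n) (hook n) = {Sp, Sq}"
    using hk subdiagrams_corners[OF D] by (simp_all add: E1_def E2_def Sp_def Sq_def)
  have F: "E1 \<in> ferrers n" "E2 \<in> ferrers n" "Sp \<in> ferrers (Suc n)" "Sq \<in> ferrers (Suc n)"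
    using hs vs ss by (auto simp: hstrips_def vstrips_def subdiagrams_def)
  have ne: "E1 \<noteq> E2" "Sp \<noteq> Sq"
  proof -
    have "(1, 0) \<in> E1" "(1, 0) \<notin> E2" "(1, 0) \<in> Sp" "(1, 0) \<notin> Sq" by (simp_all add: memE1 memE2 memSp memSq)
    then show "E1 \<noteq> E2" "Sp \<noteq> Sq" by auto
  qed
  have two: "int (card ({A, B} \<inter> C)) = of_bool (A \<in> C) + of_bool (B \<in> C)" if "A \<noteq> B" for A B :: "(nat \<times> nat) set" and C
    using that by (cases "A \<in> C"; cases "B \<in> C") (auto simp: Int_insert_left)
  have count: "kron_count n (hook n) D' = of_bool (E1 \<in> hstrips n D') + of_bool (E2 \<in> hstrips n D') + of_bool (E2 \<in> vstrips n D')
      - of_bool (Sp \<in> subdiagrams (Suc n) D') - of_bool (Sq \<in> subdiagrams (Suc n) D')"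
    unfolding kron_count_def hs vs ss two[OF ne(1)] two[OF ne(2)] by simp
  note dc = ferrersD(2)[OF D']
  have row0: "(0, n) \<in> D' \<Longrightarrow> j \<le> n \<Longrightarrow> (0, j) \<in> D'" for j using down_closedD[OF dc, of 0 n 0 j] by simp
  have rest: "(1, 0) \<in> D'" if "(i, j) \<in> D'" "0 < i" for i j using down_closedD[OF dc that(1), of 1 0] that(2) by simp
  \<comment> \<open>In order: the hook itself, a single row, a diagram with a shorter first row and
    at least two rows, and a case that leaves too little room for the boxes of
    \<open>D'\<close>.\<close>
  consider "(0, n) \<in> D'" "(1, 0) \<in> D'" | "(0, n) \<in> D'" "(1, 0) \<notin> D'" | "(0, n) \<notin> D'" "(1, 0) \<in> D'"
    | "(0, n) \<notin> D'" "(1, 0) \<notin> D'" by blast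
  then show ?thesis
  proof cases
    case 1
    then have "hook n \<subseteq> D'" using row0 by (auto simp: mem)
    then have "D' = hook n" using card_subset_eq[OF ferrersD(1)[OF D']] ferrersD(3)[OF D'] ferrersD(3)[OF D] by metis
    then show ?thesis unfolding count by (simp add: hs vs ss)
  next
    case 2
    have sub0: "i = 0" if "(i, j) \<in> D'" for i j using rest[OF that] 2(2) by (cases i) auto
    have "D' = {0} \<times> {..<rows D' 0}" using sub0 ferrers_iff[OF D'] by (auto simp: set_eq_iff)
    then have "card D' = card ({0 :: nat} \<times> {..<rows D' 0})" by (rule arg_cong)
    then have "rows D' 0 = Suc (Suc n)" using ferrersD(3)[OF D'] by simp
    then have D'_eq: "(i, j) \<in> D' \<longleftrightarrow> i = 0 \<and> j < Suc (Suc n)" for i j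
      using sub0[of i j] ferrers_iff[OF D', of 0 j] by auto
    have "E1 \<notin> hstrips n D'"
    proof
      assume "E1 \<in> hstrips n D'"
      then have "(1, 0) \<in> D'" using memE1[of 1 0] by (auto simp: hstrips_def)
      then show False using 2(2) by simp
    qed
    moreover have "Sp \<notin> subdiagrams (Suc n) D'"
    proof
      assume "Sp \<in> subdiagrams (Suc n) D'"
      then have "(1, 0) \<in> D'" using memSp[of 1 0] by (auto simp: subdiagrams_def)
      then show False using 2(2) by simp
    qed
    moreover have "Sq \<in> subdiagrams (Suc n) D'"
      using F(4) by (auto simp: subdiagrams_def memSq D'_eq)
    moreover have "E2 \<in> hstrips n D'" "E2 \<notin> vstrips n D'"
    proof -
      have "D' - E2 = {(0, n), (0, Suc n)}" by (auto simp: memE2 D'_eq)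
      moreover have "E2 \<subseteq> D'" by (auto simp: memE2 D'_eq)
      ultimately show "E2 \<in> hstrips n D'" "E2 \<notin> vstrips n D'"
        using strip_of_insert[OF F(2), of D' "(0, n)" "(0, Suc n)"] by auto
    qed
    ultimately show ?thesis unfolding count by simp
  next
    case 3
    have Sq: "Sq \<notin> subdiagrams (Suc n) D'"
    proof
      assume "Sq \<in> subdiagrams (Suc n) D'"
      then have "(0, n) \<in> D'" using memSq[of 0 n] by (auto simp: subdiagrams_def)
      then show False using 3(1) by simp
    qed
    show ?thesis
    proof (cases "Sp \<subseteq> D'")
      case False
      \<comment> \<open>As \<open>D'\<close> contains the box \<open>(1, 0)\<close>, containing
        \<open>E2\<close> would mean containing \<open>Sp\<close>. Only the membership of
        \<open>E1\<close> is left, so the count is 0 or 1.\<close>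
      have "\<not> E2 \<subseteq> D'"
      proof
        assume "E2 \<subseteq> D'"
        then have "Sp \<subseteq> D'" using 3(2) by (auto simp: Sp_def E2_def)
        then show False using False by simp
      qed
      then have "E2 \<notin> hstrips n D'" "E2 \<notin> vstrips n D'" "Sp \<notin> subdiagrams (Suc n) D'"
        using False by (auto simp: hstrips_def vstrips_def subdiagrams_def)
      then show ?thesis unfolding count using Sq by simp
    next
      case True
      have "card (D' - Sp) = 1"
        using card_Diff_subset[OF ferrersD(1)[OF F(3)] True] ferrersD(3)[OF D'] ferrersD(3)[OF F(3)] by simp
      then obtain u where u: "D' - Sp = {u}" by (rule card_1_singletonE)
      obtain i j where ij: "u = (i, j)" by (cases u)
      have uD: "(i, j) \<in> D'" "(i, j) \<notin> Sp" using u ij by auto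
      have i: "0 < i"
      proof (rule ccontr)
        assume "\<not> 0 < i"
        then have "(0, j) \<in> D'" "n \<le> j" using uD by (auto simp: memSp)
        then have "(0, n) \<in> D'" using down_closedD[OF dc, of 0 j 0 n] by simp
        then show False using 3(1) by simp
      qed
      \<comment> \<open>The extra box lies either in the second row or further down in the first
        column. In the first case \<open>E2\<close> becomes a horizontal strip only, in the second a
        vertical one only, so \<open>E2\<close> contributes exactly 1 and balances
        \<open>Sp\<close>.\<close>
      have one: "i = 1 \<and> 0 < j \<or> 1 < i \<and> j = 0"
      proof -
        have "(i, j) \<noteq> (1, 0)" using uD memSp by auto
        moreover have "j = 0" if "1 < i"
        proof -
          have "(i - 1, j) \<in> D'" using down_closedD[OF dc uD(1), of "i - 1" j] by simp
          moreover have "(i - 1, j) \<notin> {u}" using ij i by simp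
          ultimately have "(i - 1, j) \<in> Sp" using u by blast
          then show ?thesis using that by (auto simp: memSp)
        qed
        ultimately show ?thesis using i by (cases "i = 1") auto
      qed
      have jn: "j \<noteq> n - 1"
      proof
        assume jn: "j = n - 1"
        then have "i = 1" using one n by auto
        have "(i, j - 1) \<in> D'" using down_closedD[OF dc uD(1), of i "j - 1"] by simp
        moreover have "(i, j - 1) \<notin> {u}" using ij jn n by simp
        ultimately have "(i, j - 1) \<in> Sp" using u by blast
        then show False using \<open>i = 1\<close> jn n by (auto simp: memSp)
      qed
      have "D' - E1 = {u, (0, n - 1)}" "E1 \<subseteq> D'"
      proof -
        have "Sp - E1 = {(0, n - 1)}" "E1 \<subseteq> Sp" using n by (auto simp: memSp memE1)
        then show "D' - E1 = {u, (0, n - 1)}" "E1 \<subseteq> D'" using u True by auto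
      qed
      then have h1: "E1 \<in> hstrips n D'"
        using strip_of_insert(1)[OF F(1), of D' u "(0, n - 1)"] ij jn by auto
      have "D' - E2 = {u, (1, 0)}" "E2 \<subseteq> D'"
      proof -
        have "Sp - E2 = {(1, 0)}" "E2 \<subseteq> Sp" by (auto simp: memSp memE2)
        then show "D' - E2 = {u, (1, 0)}" "E2 \<subseteq> D'" using u True by auto
      qed
      then have "E2 \<in> hstrips n D' \<longleftrightarrow> j \<noteq> 0" "E2 \<in> vstrips n D' \<longleftrightarrow> i \<noteq> 1"
        using strip_of_insert[OF F(2), of D' u "(1, 0)"] ij one by auto
      then have "of_bool (E2 \<in> hstrips n D') + of_bool (E2 \<in> vstrips n D') = (1 :: int)" using one by auto
      moreover have "Sp \<in> subdiagrams (Suc n) D'" using F(3) True by (simp add: subdiagrams_def)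
      ultimately show ?thesis unfolding count using h1 Sq by simp
    qed
  next
    case 4
    have "D' \<subseteq> {0} \<times> {..<n}"
    proof (rule subrelI)
      fix i j assume ij: "(i, j) \<in> D'"
      then have "i = 0" using rest[OF ij] 4(2) by (cases i) auto
      moreover have "j < n"
      proof (rule ccontr)
        assume "\<not> j < n"
        then have "(0, n) \<in> D'" using down_closedD[OF dc ij, of 0 n] by simp
        then show False using 4(1) by simp
      qed
      ultimately show "(i, j) \<in> {0} \<times> {..<n}" by simp
    qed
    then have "card D' \<le> card ({0 :: nat} \<times> {..<n})" by (intro card_mono) auto
    then show ?thesis using ferrersD(3)[OF D'] by simp
  qed
qed

section \<open>Shapes with two corners, parametrised by the corner boxes themselves\<close>

definition two_step :: "nat \<Rightarrow> nat \<Rightarrow> nat \<Rightarrow> nat \<Rightarrow> (nat \<times> nat) set" where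
  "two_step i1 j1 i2 j2 = {(i, j). i \<le> i1 \<and> j \<le> j1 \<or> i \<le> i2 \<and> j \<le> j2}"

lemma swap_two_step: "prod.swap ` two_step i1 j1 i2 j2 = two_step j2 i2 j1 i1"
  by (auto simp: two_step_def image_iff)

text \<open>The strips exhibited are the pair of corners and the horizontal domino ending at either
  corner, each under the condition that makes it removable.\<close>

lemma card_hstrips_two_step:
  assumes ij: "i1 < i2" "j2 < j1" and D: "two_step i1 j1 i2 j2 \<in> ferrers (Suc (Suc n))"
  shows "1 + of_bool (j2 + 2 \<le> j1) + of_bool (1 \<le> j2) \<le> card (hstrips n (two_step i1 j1 i2 j2))"
proof -
  let ?D = "two_step i1 j1 i2 j2"
  let ?x = "(i1, j1)" and ?y = "(i2, j2)" and ?r = "(i1, j1 - 1)" and ?s = "(i2, j2 - 1)"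
  have mem: "(i, j) \<in> ?D \<longleftrightarrow> i \<le> i1 \<and> j \<le> j1 \<or> i \<le> i2 \<and> j \<le> j2" for i j by (simp add: two_step_def)
  have up: "z = ?x \<or> z = ?y" if "z \<in> ?D" "boxes_le ?x z \<or> boxes_le ?y z" for z
    using that ij by (cases z) (auto simp: mem boxes_le_def)
  have 1: "?D - {?x, ?y} \<in> hstrips n ?D"
    by (rule remove_pair_strips(1)[OF D _ _ _ up]) (use ij in \<open>auto simp: mem\<close>)
  have 2: "?D - {?x, ?r} \<in> hstrips n ?D" if h: "j2 + 2 \<le> j1"
  proof (rule remove_pair_strips(1)[OF D])
    show "z = ?x \<or> z = ?r" if "z \<in> ?D" "boxes_le ?x z \<or> boxes_le ?r z" for z
      using that ij h by (cases z) (auto simp: mem boxes_le_def)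
  qed (use ij h in \<open>auto simp: mem\<close>)
  have 3: "?D - {?y, ?s} \<in> hstrips n ?D" if h: "1 \<le> j2"
  proof (rule remove_pair_strips(1)[OF D])
    show "z = ?y \<or> z = ?s" if "z \<in> ?D" "boxes_le ?y z \<or> boxes_le ?s z" for z
      using that ij h by (cases z) (auto simp: mem boxes_le_def)
  qed (use ij h in \<open>auto simp: mem\<close>)
  define \<A> where "\<A> = {{?x, ?y}} \<union> (if j2 + 2 \<le> j1 then {{?x, ?r}} else {}) \<union> (if 1 \<le> j2 then {{?y, ?s}} else {})"
  have sub: "A \<subseteq> ?D" if "A \<in> \<A>" for A
    using that ij by (auto simp: \<A>_def mem split: if_splits)
  have "inj_on (\<lambda>A. ?D - A) \<A>"
  proof (rule inj_onI)
    fix A B assume "A \<in> \<A>" "B \<in> \<A>" "?D - A = ?D - B"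
    then show "A = B" using sub[of A] sub[of B] by blast
  qed
  then have "card ((\<lambda>A. ?D - A) ` \<A>) = card \<A>" by (rule card_image)
  moreover have "(\<lambda>A. ?D - A) ` \<A> \<subseteq> hstrips n ?D"
    using 1 2 3 by (auto simp: \<A>_def)
  moreover have "card \<A> = 1 + of_bool (j2 + 2 \<le> j1) + of_bool (1 \<le> j2)"
  proof -
    have "{?x, ?y} \<noteq> {?x, ?r}" "{?x, ?y} \<noteq> {?y, ?s}" "{?x, ?r} \<noteq> {?y, ?s}"
      using ij by (auto simp: doubleton_eq_iff)
    then show ?thesis by (auto simp: \<A>_def card_insert_if)
  qed
  ultimately show ?thesis using card_mono[OF finite_strips(2)] by metis
qed

lemma corners_two_step:
  assumes "i1 < i2" "j2 < j1" shows "corners (two_step i1 j1 i2 j2) = {(i1, j1), (i2, j2)}"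
  using assms by (auto simp: corners_def two_step_def)

text \<open>The four truth values are the possible dominoes, horizontal or vertical, at the upper or
  the lower corner. The pair of corners counts once in each strip set and cancels the two one-box
  removals; the vertical part comes from the horizontal one by conjugation.\<close>

lemma kron_count_two_step:
  assumes ij: "i1 < i2" "j2 < j1" and D: "two_step i1 j1 i2 j2 \<in> ferrers (Suc (Suc n))"
  shows "of_bool (j2 + 2 \<le> j1) + of_bool (1 \<le> j2) + of_bool (i1 + 2 \<le> i2) + of_bool (1 \<le> i1)
    \<le> kron_count n (two_step i1 j1 i2 j2) (two_step i1 j1 i2 j2)"
proof -
  let ?D = "two_step i1 j1 i2 j2"
  have sD: "two_step j2 i2 j1 i1 \<in> ferrers (Suc (Suc n))"
    using D strips_swap(1)[of ?D "Suc (Suc n)"] by (simp add: swap_two_step)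
  have inj: "inj (\<lambda>E :: (nat \<times> nat) set. prod.swap ` E)" by (rule injI) (simp add: inj_image_eq_iff)
  have "hstrips n (two_step j2 i2 j1 i1) = (\<lambda>E. prod.swap ` E) ` vstrips n ?D"
    using strips_swap(2)[of n ?D] by (simp only: swap_two_step)
  then have "card (vstrips n ?D) = card (hstrips n (two_step j2 i2 j1 i1))"
    by (simp add: card_image[OF inj_on_subset[OF inj]])
  moreover have "1 + of_bool (i1 + 2 \<le> i2) + of_bool (1 \<le> i1) \<le> card (hstrips n (two_step j2 i2 j1 i1))"
    using card_hstrips_two_step[OF ij(2,1) sD] by simp
  moreover have "1 + of_bool (j2 + 2 \<le> j1) + of_bool (1 \<le> j2) \<le> card (hstrips n ?D)"
    by (rule card_hstrips_two_step[OF ij D])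
  moreover have "card (subdiagrams (Suc n) ?D) = 2"
    using card_subdiagrams[OF D] corners_two_step[OF ij] ij by simp
  ultimately show ?thesis
    by (auto simp: kron_count_def of_bool_def split: if_splits)
qed

lemma card_two_step_flat: "card (two_step 0 (Suc j) (Suc 0) j) = 2 * j + 3"
proof -
  have "two_step 0 (Suc j) (Suc 0) j = {0} \<times> {..Suc j} \<union> {Suc 0} \<times> {..j}"
    by (auto simp: two_step_def le_Suc_eq)
  moreover have "card ({0 :: nat} \<times> {..Suc j} \<union> {Suc 0} \<times> {..j}) = card ({0 :: nat} \<times> {..Suc j}) + card ({Suc 0} \<times> {..j})"
    by (rule card_Un_disjoint) auto
  ultimately show ?thesis by (simp add: card_cartesian_product)
qed

text \<open>The shape is \<open>(b+1,b)\<close> with \<open>b = j + 1\<close>; the witness is \<open>(b+1,b-1,1)\<close>.\<close>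

lemma kron_count_near_rectangle:
  assumes "two_step 0 (Suc j) (Suc 0) j \<in> ferrers (Suc (Suc n))" and j: "2 \<le> j"
  shows "\<exists>D'\<in>ferrers (Suc (Suc n)). 2 \<le> kron_count n (two_step 0 (Suc j) (Suc 0) j) D'"
proof -
  define D where "D = two_step 0 (Suc j) (Suc 0) j"
  \<comment> \<open>In terms of b, \<open>S\<close> is (b+1,b-1), \<open>E1\<close> is (b,b-1) and
    \<open>E2\<close> is (b+1,b-2). The strip \<open>E1\<close> counts in both kinds,
    \<open>E2\<close> as a horizontal one, and \<open>S\<close> is the only possible common one-box
    removal, so the count is at least 3 - 1.\<close>
  define S where "S = D - {(1, j)}"
  define D' where "D' = insert (2, 0) S"
  define E1 where "E1 = D - {(0, Suc j), (1, j)}"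
  define E2 where "E2 = D - {(1, j), (1, j - 1)}"
  have D: "D \<in> ferrers (Suc (Suc n))" using assms(1) by (simp add: D_def)
  have mem: "(a, b) \<in> D \<longleftrightarrow> a = 0 \<and> b \<le> Suc j \<or> a = 1 \<and> b \<le> j"
    and memS: "(a, b) \<in> S \<longleftrightarrow> a = 0 \<and> b \<le> Suc j \<or> a = 1 \<and> b < j"
    and mem': "(a, b) \<in> D' \<longleftrightarrow> a = 0 \<and> b \<le> Suc j \<or> a = 1 \<and> b < j \<or> a = 2 \<and> b = 0"
    and memE1: "(a, b) \<in> E1 \<longleftrightarrow> a = 0 \<and> b \<le> j \<or> a = 1 \<and> b < j"
    and memE2: "(a, b) \<in> E2 \<longleftrightarrow> a = 0 \<and> b \<le> Suc j \<or> a = 1 \<and> b < j - 1" for a b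
    using j by (auto simp: S_def D'_def E1_def E2_def D_def two_step_def le_Suc_eq)
  have dc: "down_closed D'"
    unfolding down_closed_def mem'
  proof (intro allI impI)
    fix a b a' b' :: nat
    assume "a = 0 \<and> b \<le> Suc j \<or> a = 1 \<and> b < j \<or> a = 2 \<and> b = 0" "a' \<le> a" "b' \<le> b"
    then show "a' = 0 \<and> b' \<le> Suc j \<or> a' = 1 \<and> b' < j \<or> a' = 2 \<and> b' = 0" using j by linarith
  qed
  have cS: "card S = Suc n" using ferrersD(1,3)[OF D] mem[of 1 j] by (simp add: S_def)
  have finS: "finite S" using ferrersD(1)[OF D] by (simp add: S_def)
  have "card D' = Suc (Suc n)" using cS finS memS[of 2 0] by (simp add: D'_def)
  then have D': "D' \<in> ferrers (Suc (Suc n))" using dc finS by (simp add: ferrers_def D'_def)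
  have "corners D = {(0, Suc j), (1, j)}" using corners_two_step[of 0 "Suc 0" j "Suc j"] by (simp add: D_def)
  then have E1: "E1 \<in> hstrips n D" "E1 \<in> vstrips n D"
    unfolding E1_def using corner_pair_strips[OF D, of "(0, Suc j)" "(1, j)"] by simp_all
  have E2: "E2 \<in> hstrips n D"
    unfolding E2_def
  proof (rule remove_pair_strips(1)[OF D])
    show "z = (1, j) \<or> z = (1, j - 1)" if "z \<in> D" "boxes_le (1, j) z \<or> boxes_le (1, j - 1) z" for z
    proof -
      obtain a b where z: "z = (a, b)" by (cases z)
      have "1 \<le> a" "j - 1 \<le> b" using that(2) by (auto simp: z boxes_le_def)
      then have "a = 1" "b = j \<or> b = j - 1" using that(1) by (auto simp: z mem)
      then show ?thesis by (auto simp: z)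
    qed
  qed (use j in \<open>simp_all add: mem\<close>)
  have F: "E1 \<in> ferrers n" "E2 \<in> ferrers n" using E1(1) E2 by (simp_all add: hstrips_def)
  have "D' - E1 = {(2, 0), (0, Suc j)}" "E1 \<subseteq> D'" by (auto simp: mem' memE1)
  then have E1': "E1 \<in> hstrips n D'" "E1 \<in> vstrips n D'"
    using strip_of_insert[OF F(1), of D' "(2, 0)" "(0, Suc j)"] by simp_all
  have "D' - E2 = {(2, 0), (1, j - 1)}" "E2 \<subseteq> D'" using j by (auto simp: mem' memE2)
  then have E2': "E2 \<in> hstrips n D'"
    using strip_of_insert(1)[OF F(2), of D' "(2, 0)" "(1, j - 1)"] j by simp
  have "E1 \<noteq> E2"
  proof
    assume "E1 = E2"
    then show False using memE1[of 0 "Suc j"] memE2[of 0 "Suc j"] by simp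
  qed
  then have "card {E1, E2} = 2" by simp
  moreover have "card {E1, E2} \<le> card (hstrips n D \<inter> hstrips n D')"
    by (rule card_mono) (use E1(1) E2 E1'(1) E2' in simp_all)
  ultimately have h: "2 \<le> card (hstrips n D \<inter> hstrips n D')" by simp
  have "card {E1} \<le> card (vstrips n D \<inter> vstrips n D')"
    by (rule card_mono) (use E1(2) E1'(2) in simp_all)
  then have v: "1 \<le> card (vstrips n D \<inter> vstrips n D')" by simp
  have "M = S" if "M \<in> subdiagrams (Suc n) D \<inter> subdiagrams (Suc n) D'" for M
  proof (rule card_subset_eq[OF finS])
    have M: "M \<in> ferrers (Suc n)" "M \<subseteq> D" "M \<subseteq> D'" using that by (auto simp: subdiagrams_def)
    have "(2, 0) \<notin> D" by (simp add: mem)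
    then show "M \<subseteq> S" using M(2,3) by (auto simp: D'_def)
    show "card M = card S" using cS ferrersD(3)[OF M(1)] by simp
  qed
  then have "subdiagrams (Suc n) D \<inter> subdiagrams (Suc n) D' \<subseteq> {S}" by blast
  then have "card (subdiagrams (Suc n) D \<inter> subdiagrams (Suc n) D') \<le> card {S}" by (intro card_mono) simp_all
  then have "2 \<le> kron_count n D D'" using h v by (simp add: kron_count_def)
  then show ?thesis using D' unfolding D_def by blast
qed

section \<open>The classification of diagrams\<close>

theorem kron_count_classification:
  assumes n: "4 \<le> n" and D: "D \<in> ferrers (Suc (Suc n))"
  shows "(\<forall>D'\<in>ferrers (Suc (Suc n)). kron_count n D D' \<in> {0, 1}) \<longleftrightarrow>
    D = hook n \<or> D = prod.swap ` hook n \<or> (\<exists>a b. 0 < a \<and> 0 < b \<and> D = {..<a} \<times> {..<b})"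
proof
  assume "D = hook n \<or> D = prod.swap ` hook n \<or> (\<exists>a b. 0 < a \<and> 0 < b \<and> D = {..<a} \<times> {..<b})"
  then show "\<forall>D'\<in>ferrers (Suc (Suc n)). kron_count n D D' \<in> {0, 1}"
  proof (elim disjE exE conjE)
    assume "D = hook n"
    then show ?thesis using kron_count_hook[OF n] by blast
  next
    assume e: "D = prod.swap ` hook n"
    show ?thesis
    proof
      fix D' assume D': "D' \<in> ferrers (Suc (Suc n))"
      have "kron_count n D D' = kron_count n (prod.swap ` hook n) (prod.swap ` (prod.swap ` D'))"
        by (simp add: e image_image)
      also have "\<dots> = kron_count n (hook n) (prod.swap ` D')" by (rule kron_count_swap)
      also have "\<dots> \<in> {0, 1}" using kron_count_hook[OF n] strips_swap(1)[of D'] D' by blast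
      finally show "kron_count n D D' \<in> {0, 1}" .
    qed
  next
    fix a b assume ab: "0 < a" "0 < b" and e: "D = {..<a} \<times> {..<b}"
    have "a * b = Suc (Suc n)" using ferrersD(3)[OF D] by (simp add: e card_cartesian_product)
    then show ?thesis using kron_count_rectangle[OF ab _ n] e by blast
  qed
next
  assume mf: "\<forall>D'\<in>ferrers (Suc (Suc n)). kron_count n D D' \<in> {0, 1}"
  then have DD: "kron_count n D D \<in> {0, 1}" using D by blast
  have sub: "corners D \<subseteq> D" by (auto simp: corners_def)
  then have fin: "finite (corners D)" using ferrersD(1)[OF D] finite_subset by blast
  \<comment> \<open>A diagram is the set of boxes weakly north-west of its corners, so one corner
    means a rectangle and two corners mean a \<open>two_step\<close> shape.\<close>
  have gen: "z \<in> D \<longleftrightarrow> (\<exists>x\<in>corners D. boxes_le z x)" for z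
  proof
    assume "z \<in> D"
    then obtain x where "x \<in> corners D" "boxes_le z x" by (rule corner_above[OF D])
    then show "\<exists>x\<in>corners D. boxes_le z x" by blast
  next
    assume "\<exists>x\<in>corners D. boxes_le z x"
    then obtain x where "x \<in> D" "boxes_le z x" using sub by blast
    then show "z \<in> D" by (rule down_closed_le[OF ferrersD(2)[OF D]])
  qed
  have "D \<noteq> {}" using ferrersD(3)[OF D] by auto
  then have "corners D \<noteq> {}" using gen by blast
  then have "card (corners D) \<noteq> 0" using fin by simp
  moreover have "\<not> 3 \<le> card (corners D)" using kron_count_three_corners[OF D] DD by auto
  ultimately have "card (corners D) = 1 \<or> card (corners D) = 2" by linarith
  then show "D = hook n \<or> D = prod.swap ` hook n \<or> (\<exists>a b. 0 < a \<and> 0 < b \<and> D = {..<a} \<times> {..<b})"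
  proof
    assume "card (corners D) = 1"
    then obtain x where x: "corners D = {x}" by (rule card_1_singletonE)
    obtain i j where ij: "x = (i, j)" by (cases x)
    have "D = {..<Suc i} \<times> {..<Suc j}" using gen by (auto simp: x ij boxes_le_def less_Suc_eq_le)
    then show ?thesis by blast
  next
    assume "card (corners D) = 2"
    then obtain x y where xy: "corners D = {x, y}" "x \<noteq> y" by (auto simp: card_2_iff)
    have "fst x \<noteq> fst y" using corners_differ(1)[OF ferrersD(2)[OF D]] xy by auto
    then obtain i1 j1 i2 j2 where c: "corners D = {(i1, j1), (i2, j2)}" "i1 < i2"
    proof (cases "fst x < fst y")
      case True
      then show ?thesis using that[of "fst x" "snd x" "fst y" "snd y"] xy by simp
    next
      case False
      then show ?thesis using that[of "fst y" "snd y" "fst x" "snd x"] xy \<open>fst x \<noteq> fst y\<close> by auto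
    qed
    have j: "j2 < j1"
    proof (rule ccontr)
      assume "\<not> j2 < j1"
      then have "boxes_le (i1, j1) (i2, j2)" using c(2) by (simp add: boxes_le_def)
      then have "(i2, j2) = (i1, j1)" using corner_maximal[OF ferrersD(2)[OF D], of "(i1, j1)" "(i2, j2)"] c(1) sub by auto
      then show False using c(2) by simp
    qed
    have De: "D = two_step i1 j1 i2 j2" using gen by (auto simp: c(1) two_step_def boxes_le_def)
    have bools: "of_bool (j2 + 2 \<le> j1) + of_bool (1 \<le> j2) + of_bool (i1 + 2 \<le> i2) + of_bool (1 \<le> i1) \<le> (1 :: int)"
    proof -
      have "kron_count n D D \<le> 1" using DD by auto
      then show ?thesis unfolding De by (rule order_trans[OF kron_count_two_step[OF c(2) j D[unfolded De]]])
    qed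
    \<comment> \<open>Stated for an arbitrary diagram so that it also applies to the conjugate. The
      size 2 j + 3 is at least 6, whence j \<ge> 2.\<close>
    have flat: False if fl: "D = two_step 0 (Suc j) (Suc 0) j" "\<forall>D'\<in>ferrers (Suc (Suc n)). kron_count n D D' \<in> {0, 1}"
      "D \<in> ferrers (Suc (Suc n))" for D j
    proof -
      have "2 * j + 3 = Suc (Suc n)" using ferrersD(3)[OF fl(3)] fl(1) card_two_step_flat[of j] by simp
      then have "2 \<le> j" using n by simp
      then obtain D' where "D' \<in> ferrers (Suc (Suc n))" "2 \<le> kron_count n D D'"
        using kron_count_near_rectangle[of j n] fl(1,3) by blast
      then show False using fl(1,2) by force
    qed
    \<comment> \<open>At most one of the four domino conditions holds. The cases allow, in this
      order, a horizontal domino at the upper corner, a vertical one at the lower, a horizontal one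
      at the lower and a vertical one at the upper; with no domino at all the first case
      applies.\<close>
    consider "j2 = 0" "i1 = 0" "i2 = 1" | "j2 = 0" "i1 = 0" "j1 = 1" | "i1 = 0" "i2 = 1" "j1 = Suc j2"
      | "j2 = 0" "j1 = 1" "i2 = Suc i1"
      using bools c(2) j by (auto simp: of_bool_def split: if_splits)
    then show ?thesis
    proof cases
      case 1
      have "D = insert (1, 0) ({0} \<times> {..<Suc j1})"
        unfolding De 1 by (auto simp: two_step_def le_Suc_eq)
      moreover have "card (insert (1, 0) ({0 :: nat} \<times> {..<Suc j1})) = Suc (Suc j1)" by simp
      ultimately show ?thesis using ferrersD(3)[OF D] by (auto simp: hook_def)
    next
      case 2
      have "D = prod.swap ` insert (1, 0) ({0} \<times> {..<Suc i2})"
        unfolding De 2 by (auto simp: two_step_def le_Suc_eq image_iff)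
      moreover have "card (prod.swap ` insert (1, 0) ({0 :: nat} \<times> {..<Suc i2})) = Suc (Suc i2)"
        by (subst card_image) auto
      ultimately show ?thesis using ferrersD(3)[OF D] by (auto simp: hook_def)
    next
      case 3
      then have False using flat[of D j2] mf D De by simp
      then show ?thesis ..
    next
      case 4
      have s: "prod.swap ` D = two_step 0 (Suc i1) (Suc 0) i1" unfolding De 4 by (simp add: swap_two_step)
      have "kron_count n (prod.swap ` D) D' \<in> {0, 1}" if D': "D' \<in> ferrers (Suc (Suc n))" for D'
      proof -
        have "kron_count n (prod.swap ` D) D' = kron_count n (prod.swap ` D) (prod.swap ` (prod.swap ` D'))"
          by (simp add: image_image)
        also have "\<dots> = kron_count n D (prod.swap ` D')" by (rule kron_count_swap)
        also have "\<dots> \<in> {0, 1}" using mf strips_swap(1)[of D'] D' by blast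
        finally show ?thesis .
      qed
      then have False using flat[of "prod.swap ` D" i1] s strips_swap(1)[of D] D by blast
      then show ?thesis ..
    qed
  qed
qed

section \<open>Linear independence of Schur functions\<close>

text \<open>The exponents of the leading monomial of the Schur function, in which variable i occurs
  \<lambda>_i times.\<close>

definition part_content :: "nat list \<Rightarrow> nat multiset" where
  "part_content l = image_mset fst (mset_set (young_diagram l))"

lemma ssyt_row_le:
  assumes l: "l \<in> partitions_of n" and T: "T \<in> ssyt l" and ij: "(i, j) \<in> young_diagram l"
  shows "i \<le> T (i, j)"
  using ij
proof (induction i)
  case (Suc i)
  have "(i, j) \<in> young_diagram l" using young_diagram_down[OF l Suc.prems, of i j] by simp
  then have "i \<le> T (i, j)" by (rule Suc.IH)
  moreover have "T (i, j) < T (Suc i, j)" using T Suc.prems by (auto simp: ssyt_def)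
  ultimately show ?case by simp
qed simp

lemma size_filter_image:
  assumes "finite A"
  shows "size (filter_mset P (image_mset f (mset_set A))) = card {x \<in> A. P (f x)}"
  using assms by (simp add: filter_mset_image_mset)

text \<open>Columns increase strictly from at least 0, so an entry in row \<open>i\<close> is at
  least \<open>i\<close>, and all entries below \<open>t\<close> sit in the first \<open>t\<close>
  rows.\<close>

lemma schur_dominance:
  assumes l: "l \<in> partitions_of n" and v: "v \<in> partitions_of m" and nz: "schur l (part_content v) \<noteq> 0"
  shows "(\<Sum>i<t. row_len v i) \<le> (\<Sum>i<t. row_len l i)" "n = m"
proof -
  have "card {T \<in> ssyt l. image_mset T (mset_set (young_diagram l)) = part_content v} \<noteq> 0"
    using nz unfolding schur_def by (metis of_nat_0)
  then have "{T \<in> ssyt l. image_mset T (mset_set (young_diagram l)) = part_content v} \<noteq> {}"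
    by (metis card.empty)
  then obtain T where T: "T \<in> ssyt l" "image_mset T (mset_set (young_diagram l)) = part_content v"
    by auto
  have "size (image_mset T (mset_set (young_diagram l))) = size (part_content v)" using T(2) by simp
  then show "n = m" using size_l[OF l] size_l[OF v] by (simp add: part_content_def card_young_diagram)
  have "(\<Sum>i<t. row_len v i) = card {x \<in> young_diagram v. fst x < t}"
    using card_young_diagram_rows[of v t] by (simp add: case_prod_unfold)
  also have "\<dots> = size (filter_mset (\<lambda>i. i < t) (part_content v))"
    unfolding part_content_def by (rule size_filter_image[symmetric]) simp
  also have "\<dots> = size (filter_mset (\<lambda>i. i < t) (image_mset T (mset_set (young_diagram l))))"
    by (simp only: T(2))
  also have "\<dots> = card {x \<in> young_diagram l. T x < t}"
    by (rule size_filter_image) simp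
  also have "\<dots> \<le> card {x \<in> young_diagram l. fst x < t}"
  proof (rule card_mono)
    show "{x \<in> young_diagram l. T x < t} \<subseteq> {x \<in> young_diagram l. fst x < t}"
    proof
      fix x assume x: "x \<in> {x \<in> young_diagram l. T x < t}"
      then have "fst x \<le> T x" using ssyt_row_le[OF l T(1), of "fst x" "snd x"] by simp
      then show "x \<in> {x \<in> young_diagram l. fst x < t}" using x by simp
    qed
  qed simp
  also have "\<dots> = (\<Sum>i<t. row_len l i)"
    using card_young_diagram_rows[of l t] by (simp add: case_prod_unfold)
  finally show "(\<Sum>i<t. row_len v i) \<le> (\<Sum>i<t. row_len l i)" .
qed

lemma schur_diagonal:
  assumes l: "l \<in> partitions_of n" shows "schur l (part_content l) \<noteq> 0"
proof -
  let ?S = "{T \<in> ssyt l. image_mset T (mset_set (young_diagram l)) = part_content l}"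
  let ?T = "restrict fst (young_diagram l)"
  \<comment> \<open>The cardinality of an infinite set would be 0, so finiteness has to come first;
    the prescribed content confines the entries to a finite set.\<close>
  have "?S \<subseteq> young_diagram l \<rightarrow>\<^sub>E set_mset (part_content l)"
  proof
    fix T assume T: "T \<in> ?S"
    then have "set_mset (image_mset T (mset_set (young_diagram l))) = set_mset (part_content l)" by simp
    then have "T ` young_diagram l = set_mset (part_content l)" by simp
    then show "T \<in> young_diagram l \<rightarrow>\<^sub>E set_mset (part_content l)" using T by (auto simp: ssyt_def PiE_def)
  qed
  then have fin: "finite ?S" by (rule finite_subset) (simp add: finite_PiE)
  have "image_mset ?T (mset_set (young_diagram l)) = part_content l"
    unfolding part_content_def by (rule image_mset_cong) simp
  moreover have "?T \<in> ssyt l"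
  proof -
    have "?T (i, j) \<le> ?T (i, Suc j)" if "(i, Suc j) \<in> young_diagram l" for i j
      using that young_diagram_down[OF l that, of i j] by simp
    moreover have "?T (i, j) < ?T (Suc i, j)" if "(Suc i, j) \<in> young_diagram l" for i j
      using that young_diagram_down[OF l that, of i j] by simp
    ultimately show ?thesis unfolding ssyt_def by blast
  qed
  ultimately have "?T \<in> ?S" by simp
  then have "?S \<noteq> {}" by blast
  then have "card ?S \<noteq> 0" using card_0_eq[OF fin] by blast
  then show ?thesis unfolding schur_def by (simp only: of_nat_eq_0_iff not_False_eq_True)
qed

lemma row_len_inj:
  assumes "l \<in> partitions_of n" "v \<in> partitions_of m" "\<And>i. row_len l i = row_len v i"
  shows "l = v"
proof -
  have "young_diagram l = young_diagram v" by (simp add: young_diagram_row_len assms(3))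
  then show ?thesis by (rule young_diagram_inj[OF assms(1,2)])
qed

text \<open>Triangularity with respect to dominance. The sum \<Phi> of all partial sums increases
  with dominance, and agreement of \<Phi> under dominance forces equality because \<open>K\<close>
  exceeds every length involved. At a partition of the support with maximal \<Phi>, its leading
  monomial therefore receives a contribution from that partition only.\<close>

lemma schur_independent:
  assumes fin: "finite A" and A: "A \<subseteq> integer_partitions"
    and zero: "\<And>M. (\<Sum>v\<in>A. d v * schur v M) = 0" and v: "v \<in> A"
  shows "d v = 0"
proof (rule ccontr)
  assume "d v \<noteq> 0"
  define A' where "A' = {v \<in> A. d v \<noteq> 0}"
  have A': "finite A'" "A' \<noteq> {}" using fin v \<open>d v \<noteq> 0\<close> by (auto simp: A'_def)
  define K where "K = Suc (Max (length ` A'))"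
  have len: "length w < K" if "w \<in> A'" for w
    unfolding K_def using A' that by (auto simp: less_Suc_eq_le intro: Max_ge)
  define \<Phi> where "\<Phi> w = (\<Sum>t<Suc K. \<Sum>i<t. row_len w i)" for w
  have "Max (\<Phi> ` A') \<in> \<Phi> ` A'" using A' by (intro Max_in) auto
  then obtain w where w: "w \<in> A'" and wmax: "Max (\<Phi> ` A') = \<Phi> w" by auto
  have mx: "\<Phi> u \<le> \<Phi> w" if "u \<in> A'" for u unfolding wmax[symmetric] using A' that by (intro Max_ge) auto
  obtain m where wp: "w \<in> partitions_of m" using w A by (auto simp: A'_def integer_partitions_def)
  have other: "schur u (part_content w) = 0" if u: "u \<in> A'" "u \<noteq> w" for u
  proof (rule ccontr)
    assume nz: "schur u (part_content w) \<noteq> 0"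
    obtain k where up: "u \<in> partitions_of k" using u A by (auto simp: A'_def integer_partitions_def)
    note dom = schur_dominance(1)[OF up wp nz]
    have "(\<Sum>t<Suc K. \<Sum>i<t. row_len w i) = (\<Sum>t<Suc K. \<Sum>i<t. row_len u i)"
      using mx[OF u(1)] sum_mono[of "{..<Suc K}" "\<lambda>t. \<Sum>i<t. row_len w i" "\<lambda>t. \<Sum>i<t. row_len u i"] dom
      by (intro antisym) (simp_all add: \<Phi>_def)
    then have eq: "(\<Sum>i<t. row_len w i) = (\<Sum>i<t. row_len u i)" if "t < Suc K" for t
      using sum_mono_inv[of "\<lambda>t. \<Sum>i<t. row_len w i" "{..<Suc K}" "\<lambda>t. \<Sum>i<t. row_len u i" t] dom that by simp
    have "row_len u i = row_len w i" for i
    proof (cases "i < K")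
      case True
      then show ?thesis using eq[of "Suc i"] eq[of i] by simp
    next
      case False
      then show ?thesis using len[OF u(1)] len[OF w] by (simp add: row_len_def)
    qed
    then show False using row_len_inj[OF up wp] u(2) by blast
  qed
  have "0 = (\<Sum>u\<in>A. d u * schur u (part_content w))" by (simp add: zero)
  also have "\<dots> = (\<Sum>u\<in>{w}. d u * schur u (part_content w))"
    using w other by (intro sum.mono_neutral_right fin) (auto simp: A'_def)
  finally have "d w * schur w (part_content w) = 0" by simp
  then show False using schur_diagonal[OF wp] w by (simp add: A'_def)
qed

lemma finite_partitions_of: "finite (partitions_of n)"
proof (rule finite_imageD)
  show "finite (young_diagram ` partitions_of n)"
    by (rule finite_subset[OF _ finite_ferrers[of n]]) (auto simp: young_diagram_ferrers)
  show "inj_on young_diagram (partitions_of n)" by (rule inj_onI) (rule young_diagram_inj)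
qed

text \<open>Independence identifies any admissible expansion with the given one. The comparison runs
  over the union of the two index sets, since the admissible expansion may a priori involve
  partitions of other sizes.\<close>

lemma multiplicity_free_iff:
  "multiplicity_free (\<lambda>M. \<Sum>v\<in>partitions_of n. g v * schur v M) \<longleftrightarrow> (\<forall>v\<in>partitions_of n. g v \<in> {0, 1})"
proof
  assume g: "\<forall>v\<in>partitions_of n. g v \<in> {0, 1}"
  define c where "c v = (if v \<in> partitions_of n then g v else 0)" for v
  have supp: "{v \<in> integer_partitions. c v \<noteq> 0} = {v \<in> partitions_of n. c v \<noteq> 0}"
    by (auto simp: c_def integer_partitions_def)
  have "(\<Sum>v\<in>partitions_of n. g v * schur v M) = (\<Sum>v\<in>{v \<in> integer_partitions. c v \<noteq> 0}. c v * schur v M)" for M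
    unfolding supp by (intro sum.mono_neutral_cong_right finite_partitions_of) (auto simp: c_def)
  then show "multiplicity_free (\<lambda>M. \<Sum>v\<in>partitions_of n. g v * schur v M)"
    unfolding multiplicity_free_def using finite_partitions_of[of n] g
    by (intro exI[of _ c]) (auto simp: supp, auto simp: c_def)
next
  assume "multiplicity_free (\<lambda>M. \<Sum>v\<in>partitions_of n. g v * schur v M)"
  then obtain c where fin: "finite {v \<in> integer_partitions. c v \<noteq> 0}"
    and eq: "(\<lambda>M. \<Sum>v\<in>partitions_of n. g v * schur v M) = (\<lambda>M. \<Sum>v\<in>{v \<in> integer_partitions. c v \<noteq> 0}. c v * schur v M)"
    and c: "\<forall>v\<in>integer_partitions. c v \<in> {0, 1}"
    unfolding multiplicity_free_def by blast
  define A where "A = {v \<in> integer_partitions. c v \<noteq> 0} \<union> partitions_of n"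
  define d where "d v = c v - (if v \<in> partitions_of n then g v else 0)" for v
  have A: "finite A" "A \<subseteq> integer_partitions"
    using fin finite_partitions_of by (auto simp: A_def integer_partitions_def)
  have zero: "(\<Sum>v\<in>A. d v * schur v M) = 0" for M
  proof -
    have "(\<Sum>v\<in>A. d v * schur v M) =
        (\<Sum>v\<in>A. c v * schur v M) - (\<Sum>v\<in>A. (if v \<in> partitions_of n then g v else 0) * schur v M)"
      by (simp add: d_def left_diff_distrib sum_subtractf)
    also have "(\<Sum>v\<in>A. c v * schur v M) = (\<Sum>v\<in>{v \<in> integer_partitions. c v \<noteq> 0}. c v * schur v M)"
      using A by (intro sum.mono_neutral_right) (auto simp: A_def)
    also have "(\<Sum>v\<in>A. (if v \<in> partitions_of n then g v else 0) * schur v M) = (\<Sum>v\<in>partitions_of n. g v * schur v M)"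
      using A by (intro sum.mono_neutral_cong_right) (auto simp: A_def)
    finally show ?thesis using fun_cong[OF eq, of M] by simp
  qed
  show "\<forall>v\<in>partitions_of n. g v \<in> {0, 1}"
  proof
    fix v assume v: "v \<in> partitions_of n"
    then have "d v = 0" by (intro schur_independent[OF A zero]) (simp add: A_def)
    moreover have "v \<in> integer_partitions" using v by (auto simp: integer_partitions_def)
    ultimately show "g v \<in> {0, 1}" using v c by (auto simp: d_def)
  qed
qed

section \<open>The diagrams of the listed partitions, and the theorem\<close>

lemma young_diagram_replicate: "young_diagram (replicate k m) = {..<k} \<times> {..<m}"
  by (auto simp: young_diagram_def)

lemma young_diagram_hook: "young_diagram [Suc n, 1] = hook n"
  by (auto simp: young_diagram_def hook_def less_Suc_eq nth_Cons')

lemma young_diagram_hook_conj: "young_diagram (2 # replicate n 1) = prod.swap ` hook n"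
proof -
  have "(i, j) \<in> young_diagram (2 # replicate n 1) \<longleftrightarrow> (j, i) \<in> hook n" for i j
    by (cases i) (auto simp: young_diagram_def hook_def less_2_cases_iff)
  then have "young_diagram (2 # replicate n 1) = {(i, j). (j, i) \<in> hook n}" by auto
  also have "\<dots> = prod.swap ` hook n" by force
  finally show ?thesis .
qed

lemma sorted_wrt_replicate: "sorted_wrt (\<ge>) (replicate k (r :: nat))"
  by (simp add: sorted_wrt_iff_nth_less)

theorem theorem4p5:
  fixes n :: nat and l :: "nat list"
  assumes "n \<ge> 6" and "l \<in> partitions_of n"
  shows "multiplicity_free (kronecker_schur [n - 2, 2] l) \<longleftrightarrow>
           l = [n - 1, 1] \<or> l = [n] \<or> l = replicate n 1 \<or> l = 2 # replicate (n - 2) 1 \<or>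
           (\<exists>m k. m > 0 \<and> k > 0 \<and> l = replicate k m)"
  proof -
  define m where "m = n - 2"
  have n: "n = Suc (Suc m)" "4 \<le> m" using assms(1) by (auto simp: m_def)
  note l = assms(2)[unfolded n(1)]
  define D where "D = young_diagram l"
  have D: "D \<in> ferrers (Suc (Suc m))" unfolding D_def by (rule young_diagram_ferrers[OF l])
  have eq_iff: "l = l' \<longleftrightarrow> D = young_diagram l'" if "l' \<in> partitions_of (Suc (Suc m))" for l'
    using young_diagram_inj[OF l that] by (auto simp: D_def)
  have "kronecker_schur [n - 2, 2] l = (\<lambda>M. \<Sum>v\<in>partitions_of n. kronecker_coeff [m, 2] l v * schur v M)"
    by (simp add: kronecker_schur_def n)
  then have "multiplicity_free (kronecker_schur [n - 2, 2] l) \<longleftrightarrow>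
      (\<forall>v\<in>partitions_of n. kronecker_coeff [m, 2] l v \<in> {0, 1})"
    by (simp only: multiplicity_free_iff)
  also have "\<dots> \<longleftrightarrow> (\<forall>v\<in>partitions_of (Suc (Suc m)). kron_count m D (young_diagram v) \<in> {0, 1})"
    using kronecker_coeff_count[OF _ l] n(2) by (simp add: n(1) D_def)
  also have "\<dots> \<longleftrightarrow> (\<forall>D'\<in>ferrers (Suc (Suc m)). kron_count m D D' \<in> {0, 1})"
    using young_diagram_ferrers young_diagram_surj by metis
  also have "\<dots> \<longleftrightarrow> D = hook m \<or> D = prod.swap ` hook m \<or> (\<exists>a b. 0 < a \<and> 0 < b \<and> D = {..<a} \<times> {..<b})"
    by (rule kron_count_classification[OF n(2) D])
  also have "D = hook m \<longleftrightarrow> l = [n - 1, 1]"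
    using eq_iff[of "[Suc m, 1]"] young_diagram_hook[of m] by (simp add: n(1) partitions_of_def)
  also have "D = prod.swap ` hook m \<longleftrightarrow> l = 2 # replicate (n - 2) 1"
    using eq_iff[of "2 # replicate m 1"] young_diagram_hook_conj[of m]
    by (simp add: n(1) partitions_of_def sorted_wrt_replicate sum_list_replicate)
  also have "(\<exists>a b. 0 < a \<and> 0 < b \<and> D = {..<a} \<times> {..<b}) \<longleftrightarrow> (\<exists>r k. r > 0 \<and> k > 0 \<and> l = replicate k r)"
  proof -
    have "D = {..<k} \<times> {..<r} \<longleftrightarrow> l = replicate k r" if "0 < k" "0 < r" for k r
    proof
      assume e: "D = {..<k} \<times> {..<r}"
      then have "k * r = Suc (Suc m)" using ferrersD(3)[OF D] by (simp add: card_cartesian_product)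
      then have "replicate k r \<in> partitions_of (Suc (Suc m))"
        using that by (auto simp: partitions_of_def sum_list_replicate sorted_wrt_replicate)
      then show "l = replicate k r" using eq_iff e young_diagram_replicate by simp
    qed (simp add: D_def young_diagram_replicate)
    then show ?thesis by blast
  qed
  also have "l = [n - 1, 1] \<or> l = 2 # replicate (n - 2) 1 \<or> (\<exists>r k. r > 0 \<and> k > 0 \<and> l = replicate k r) \<longleftrightarrow>
      l = [n - 1, 1] \<or> l = [n] \<or> l = replicate n 1 \<or> l = 2 # replicate (n - 2) 1 \<or>
      (\<exists>m k. m > 0 \<and> k > 0 \<and> l = replicate k m)"
  proof -
    \<comment> \<open>The partitions (n) and (1^n) are themselves rectangles, so naming them
      separately does not enlarge the list.\<close>
    have "[n] = replicate 1 n" "0 < n" by (simp_all add: n(1))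
    then show ?thesis by (metis zero_less_one)
  qed
  finally show ?thesis .
qed

end
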